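(* Let $k\ge1$, let $M$ be a $(4k+1)$-dimensional (smooth, Riemannian) manifold, let $\nabla_0^{TM},\nabla_1^{TM}$ be two connections on $TM$, and let $\xi$ be a two-dimensional oriented Euclidean real vector bundle over $M$ with a Euclidean connection $\nabla^{\xi}$. With the transgressed forms $CS\widetilde{\Phi_L}, CS\widetilde{\Phi_W}, CS\widetilde{\Phi_W'}$ defined in the context: 1) $\{CS\widetilde{\Phi_L}(\nabla_0^{TM},\nabla_1^{TM},\nabla^{\xi},\tau)\}^{(4k+1)}$ is a modular form of weight $2k+2$ over $\Gamma_0(2)$; $\{CS\widetilde{\Phi_W}(\nabla_0^{TM},\nabla_1^{TM},\nabla^{\xi},\tau)\}^{(4k+1)}$ is a modular form of weight $2k+2$ over $\Gamma^0(2)$; $\{CS\widetilde{\Phi_W'}(\nabla_0^{TM},\nabla_1^{TM},\nabla^{\xi},\tau)\}^{(4k+1)}$ is a modular form of weight $2k+2$ over $\Gamma_\theta$. 2) The following equalities hold: $$\Big\{CS\widetilde{\Phi_L}\big(\nabla_0^{TM},\nabla_1^{TM},\nabla^{\xi},-\tfrac1\tau\big)\Big\}^{(4k+1)}=(2\tau)^{2k+2}\{CS\widetilde{\Phi_W}(\nabla_0^{TM},\nabla_1^{TM},\nabla^{\xi},\tau)\}^{(4k+1)},$$ $$CS\widetilde{\Phi_W}(\nabla_0^{TM},\nabla_1^{TM},\nabla^{\xi},\tau+1)=CS\widetilde{\Phi_W'}(\nabla_0^{TM},\nabla_1^{TM},\nabla^{\xi},\tau).$$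
   Context: Theta functions. For $\tau\in\mathbf H$ (upper half plane), $q=e^{2\pi\sqrt{-1}\tau}$, $q^{a}=e^{2\pi\sqrt{-1}a\tau}$, $v\in\mathbf C$: $\theta(v,\tau)=2q^{1/8}\sin(\pi v)\prod_{j\ge1}(1-q^j)(1-e^{2\pi\sqrt{-1}v}q^j)(1-e^{-2\pi\sqrt{-1}v}q^j)$, $\theta_1(v,\tau)=2q^{1/8}\cos(\pi v)\prod_{j\ge1}(1-q^j)(1+e^{2\pi\sqrt{-1}v}q^j)(1+e^{-2\pi\sqrt{-1}v}q^j)$, $\theta_2(v,\tau)=\prod_{j\ge1}(1-q^j)(1-e^{2\pi\sqrt{-1}v}q^{j-1/2})(1-e^{-2\pi\sqrt{-1}v}q^{j-1/2})$, $\theta_3(v,\tau)=\prod_{j\ge1}(1-q^j)(1+e^{2\pi\sqrt{-1}v}q^{j-1/2})(1+e^{-2\pi\sqrt{-1}v}q^{j-1/2})$. A prime denotes $\partial/\partial v$. Modular forms. $\Gamma_0(2)$, resp. $\Gamma^0(2)$, is the subgroup of matrices $\begin{pmatrix}a&b\\c&d\end{pmatrix}\in SL_2(\mathbf Z)$ with $c$ even, resp. $b$ even; $\Gamma_\theta$ is the subgroup of those congruent mod 2 to $\begin{pmatrix}1&0\\0&1\end{pmatrix}$ or $\begin{pmatrix}0&1\\1&0\end{pmatrix}$. A modular form of weight $w$ over $\Gamma\subset SL_2(\mathbf Z)$ is a holomorphic function $f$ on $\mathbf H$ with $f\big(\frac{a\tau+b}{c\tau+d}\big)=\chi(g)(c\tau+d)^{w}f(\tau)$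 for all $g=\begin{pmatrix}a&b\\c&d\end{pmatrix}\in\Gamma$, where $\chi:\Gamma\to\mathbf C^*$ is a character. For functions of $\tau$ with values in differential forms the condition is understood coefficientwise (pointwise on $M$). $\{\cdot\}^{(p)}$ denotes the degree $p$ component of a form. Conventions. A power series is evaluated on a curvature or an even form of positive degree by substitution (nilpotency), and for a power series $f$ with nonzero constant term $\det^{1/2}(f(R))$ is the usual Chern–Weil square root $\exp(\frac12\mathrm{tr}\log f(R))$. Removable singularities at the origin are understood as removed. Characteristic forms. Let $c=e(\xi,\nabla^\xi)$ be the Euler form of $(\xi,\nabla^\xi)$ (so that the Chern roots of $\xi\otimes\mathbf C$ are $\pm c$) and $u=c/(2\pi\sqrt{-1})$. For a connection $\nabla^{TM}$ on $TM$ with curvature $R^{TM}$ put $\widetilde{\Phi_L}(\nabla^{TM},\nabla^\xi,\tau)=\frac{\sqrt2^{\,4k+1}}{\pi\sqrt{-1}}\det^{1/2}\Big(f_L(\tfrac{R^{TM}}{4\pi^2},\tau)\Big)\frac{\theta'(0,\tau)}{\theta(u,\tau)}\Big(\frac{\theta_1(u,\tau)}{\theta_1(0,\tau)}-\frac{\theta_1(0,\tau)}{\theta_1(u,\tau)}\frac{\theta_3(u,\tau)}{\theta_3(0,\tau)}\frac{\theta_2(u,\tau)}{\theta_2(0,\tau)}\Big)$, $\widetilde{\Phi_W}(\nabla^{TM},\nabla^\xi,\tau)=\frac{1}{2\pi\sqrt{-1}}\det^{1/2}\Big(f_W(\tfrac{R^{TM}}{4\pi^2},\tau)\Big)\frac{\theta'(0,\tau)}{\theta(u,\tau)}\Big(\frac{\theta_2(u,\tau)}{\theta_2(0,\tau)}-\frac{\theta_2(0,\tau)}{\theta_2(u,\tau)}\frac{\theta_3(u,\tau)}{\theta_3(0,\tau)}\frac{\theta_1(u,\tau)}{\theta_1(0,\tau)}\Big)$,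 $\widetilde{\Phi_W'}(\nabla^{TM},\nabla^\xi,\tau)=\frac{1}{2\pi\sqrt{-1}}\det^{1/2}\Big(f_{W'}(\tfrac{R^{TM}}{4\pi^2},\tau)\Big)\frac{\theta'(0,\tau)}{\theta(u,\tau)}\Big(\frac{\theta_3(u,\tau)}{\theta_3(0,\tau)}-\frac{\theta_3(0,\tau)}{\theta_3(u,\tau)}\frac{\theta_2(u,\tau)}{\theta_2(0,\tau)}\frac{\theta_1(u,\tau)}{\theta_1(0,\tau)}\Big)$, where $f_L(z,\tau)=z\frac{\theta'(0,\tau)}{\theta(z,\tau)}\frac{\theta_1(z,\tau)}{\theta_1(0,\tau)}$, $f_W(z,\tau)=z\frac{\theta'(0,\tau)}{\theta(z,\tau)}\frac{\theta_2(z,\tau)}{\theta_2(0,\tau)}$, $f_{W'}(z,\tau)=z\frac{\theta'(0,\tau)}{\theta(z,\tau)}\frac{\theta_3(z,\tau)}{\theta_3(0,\tau)}$. (For Euclidean $\nabla^{TM}$ these are, respectively, the forms $\widehat L(TM)\frac{\cosh(c/2)}{\sinh(c/2)}\Big(\mathrm{ch}(\Theta_1(T_CM+\xi_C,\mathbf C^2))-\frac{\mathrm{ch}(\Theta_1(T_CM+\xi_C,\xi_C))}{\cosh^2(c/2)}\Big)$ and, for $j=2,3$, $\frac{\widehat A(TM)}{2\sinh(c/2)}\Big(\mathrm{ch}(\Theta_j(T_CM+\xi_C,\mathbf C^2))-\cosh(\tfrac c2)\mathrm{ch}(\Theta_j(T_CM+\xi_C,\xi_C))\Big)$. Here $\widehat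 A(TM)=\det^{1/2}\Big(\frac{\frac{\sqrt{-1}}{4\pi}R^{TM}}{\sinh(\frac{\sqrt{-1}}{4\pi}R^{TM})}\Big)$, $\widehat L(TM)=\det^{1/2}\Big(\frac{\frac{\sqrt{-1}}{2\pi}R^{TM}}{\tanh(\frac{\sqrt{-1}}{4\pi}R^{TM})}\Big)$, and, with $\widetilde E=E-\dim E$ and $S_t,\wedge_t$ the total symmetric and exterior powers, $\Theta_1(V,\eta)=\bigotimes_{n\ge1}S_{q^n}(\widetilde V)\otimes\bigotimes_{m\ge1}\wedge_{q^m}(\widetilde V-2\widetilde\eta)\otimes\bigotimes_{r\ge1}\wedge_{q^{r-1/2}}(\widetilde\eta)\otimes\bigotimes_{s\ge1}\wedge_{-q^{s-1/2}}(\widetilde\eta)$, $\Theta_2(V,\eta)=\bigotimes_{n\ge1}S_{q^n}(\widetilde V)\otimes\bigotimes_{m\ge1}\wedge_{-q^{m-1/2}}(\widetilde V-2\widetilde\eta)\otimes\bigotimes_{r\ge1}\wedge_{q^{r-1/2}}(\widetilde\eta)\otimes\bigotimes_{s\ge1}\wedge_{q^{s}}(\widetilde\eta)$, $\Theta_3(V,\eta)=\bigotimes_{n\ge1}S_{q^n}(\widetilde V)\otimes\bigotimes_{m\ge1}\wedge_{q^{m-1/2}}(\widetilde V-2\widetilde\eta)\otimes\bigotimes_{r\ge1}\wedge_{q^{r}}(\widetilde\eta)\otimes\bigotimes_{s\ge1}\wedge_{-q^{s-1/2}}(\widetilde\eta)$, with $\mathbf C^2$ the trivial bundle.) Transgressed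 forms. Let $A=\nabla_1^{TM}-\nabla_0^{TM}\in\Omega^1(M,\mathrm{End}\,TM)$, $\nabla_t^{TM}=(1-t)\nabla_0^{TM}+t\nabla_1^{TM}$ with curvature $R_t^{TM}$, and $Z_t=R_t^{TM}/(4\pi^2)$. Define $CS\widetilde{\Phi_L}(\nabla_0^{TM},\nabla_1^{TM},\nabla^\xi,\tau)=\frac{\sqrt2}{8\pi^2}\int_0^1\widetilde{\Phi_L}(\nabla_t^{TM},\nabla^\xi,\tau)\,\mathrm{tr}\Big[A\Big(\frac1{Z_t}-\frac{\theta'(Z_t,\tau)}{\theta(Z_t,\tau)}+\frac{\theta_1'(Z_t,\tau)}{\theta_1(Z_t,\tau)}\Big)\Big]dt$, $CS\widetilde{\Phi_W}(\nabla_0^{TM},\nabla_1^{TM},\nabla^\xi,\tau)=\frac{1}{8\pi^2}\int_0^1\widetilde{\Phi_W}(\nabla_t^{TM},\nabla^\xi,\tau)\,\mathrm{tr}\Big[A\Big(\frac1{Z_t}-\frac{\theta'(Z_t,\tau)}{\theta(Z_t,\tau)}+\frac{\theta_2'(Z_t,\tau)}{\theta_2(Z_t,\tau)}\Big)\Big]dt$, $CS\widetilde{\Phi_W'}(\nabla_0^{TM},\nabla_1^{TM},\nabla^\xi,\tau)=\frac{1}{8\pi^2}\int_0^1\widetilde{\Phi_W'}(\nabla_t^{TM},\nabla^\xi,\tau)\,\mathrm{tr}\Big[A\Big(\frac1{Z_t}-\frac{\theta'(Z_t,\tau)}{\theta(Z_t,\tau)}+\frac{\theta_3'(Z_t,\tau)}{\theta_3(Z_t,\tau)}\Big)\Big]dt$.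 *)

theory Defs
  imports "HOL-Complex_Analysis.Complex_Analysis" "HOL-Library.Function_Algebras"
begin

no_notation fps_nth (infixl \<open>$\<close> 75)

section \<open>Theta functions\<close>

definition upper_half_plane :: "complex set" where
  "upper_half_plane = {\<tau>. Im \<tau> > 0}"

definition qpow :: "complex \<Rightarrow> real \<Rightarrow> complex" where
  "qpow \<tau> a = exp (2 * of_real pi * \<i> * of_real a * \<tau>)"

definition evar :: "complex \<Rightarrow> complex" where
  "evar v = exp (2 * of_real pi * \<i> * v)"

text \<open>The products over j >= 1 are indexed by j = Suc n.\<close>

definition theta :: "complex \<Rightarrow> complex \<Rightarrow> complex" where
  "theta v \<tau> = 2 * qpow \<tau> (1/8) * sin (of_real pi * v) *
     (\<Prod>n. (1 - qpow \<tau> (real (Suc n))) * (1 - evar v * qpow \<tau> (real (Suc n))) * (1 - evar (- v) * qpow \<tau> (real (Suc n))))"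

definition theta1 :: "complex \<Rightarrow> complex \<Rightarrow> complex" where
  "theta1 v \<tau> = 2 * qpow \<tau> (1/8) * cos (of_real pi * v) *
     (\<Prod>n. (1 - qpow \<tau> (real (Suc n))) * (1 + evar v * qpow \<tau> (real (Suc n))) * (1 + evar (- v) * qpow \<tau> (real (Suc n))))"

definition theta2 :: "complex \<Rightarrow> complex \<Rightarrow> complex" where
  "theta2 v \<tau> =
     (\<Prod>n. (1 - qpow \<tau> (real (Suc n))) * (1 - evar v * qpow \<tau> (real (Suc n) - 1/2)) * (1 - evar (- v) * qpow \<tau> (real (Suc n) - 1/2)))"

definition theta3 :: "complex \<Rightarrow> complex \<Rightarrow> complex" where
  "theta3 v \<tau> =
     (\<Prod>n. (1 - qpow \<tau> (real (Suc n))) * (1 + evar v * qpow \<tau> (real (Suc n) - 1/2)) * (1 + evar (- v) * qpow \<tau> (real (Suc n) - 1/2)))"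

definition theta' :: "complex \<Rightarrow> complex \<Rightarrow> complex" where
  "theta' v \<tau> = deriv (\<lambda>x. theta x \<tau>) v"

definition theta1' :: "complex \<Rightarrow> complex \<Rightarrow> complex" where
  "theta1' v \<tau> = deriv (\<lambda>x. theta1 x \<tau>) v"

definition theta2' :: "complex \<Rightarrow> complex \<Rightarrow> complex" where
  "theta2' v \<tau> = deriv (\<lambda>x. theta2 x \<tau>) v"

definition theta3' :: "complex \<Rightarrow> complex \<Rightarrow> complex" where
  "theta3' v \<tau> = deriv (\<lambda>x. theta3 x \<tau>) v"


section \<open>Congruence subgroups, characters\<close>

definition SL2Z :: "(int^2^2) set" where
  "SL2Z = {g. det g = 1}"

definition Gamma_lower0 :: "(int^2^2) set" where
  "Gamma_lower0 = {g \<in> SL2Z. even (g$2$1)}"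

definition Gamma_upper0 :: "(int^2^2) set" where
  "Gamma_upper0 = {g \<in> SL2Z. even (g$1$2)}"

definition Gamma_theta :: "(int^2^2) set" where
  "Gamma_theta = {g \<in> SL2Z.
     (odd (g$1$1) \<and> even (g$1$2) \<and> even (g$2$1) \<and> odd (g$2$2)) \<or>
     (even (g$1$1) \<and> odd (g$1$2) \<and> odd (g$2$1) \<and> even (g$2$2))}"

definition automorphy :: "int^2^2 \<Rightarrow> complex \<Rightarrow> complex" where
  "automorphy g \<tau> = of_int (g$2$1) * \<tau> + of_int (g$2$2)"

definition moebius_act :: "int^2^2 \<Rightarrow> complex \<Rightarrow> complex" where
  "moebius_act g \<tau> = (of_int (g$1$1) * \<tau> + of_int (g$1$2)) / automorphy g \<tau>"

definition group_character :: "(int^2^2) set \<Rightarrow> (int^2^2 \<Rightarrow> complex) \<Rightarrow> bool" where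
  "group_character \<Gamma> \<psi> \<longleftrightarrow>
     (\<forall>g\<in>\<Gamma>. \<psi> g \<noteq> 0) \<and> (\<forall>g\<in>\<Gamma>. \<forall>g'\<in>\<Gamma>. \<psi> (g ** g') = \<psi> g * \<psi> g')"

definition modular_with :: "(int^2^2) set \<Rightarrow> (int^2^2 \<Rightarrow> complex) \<Rightarrow> nat \<Rightarrow> (complex \<Rightarrow> complex) \<Rightarrow> bool" where
  "modular_with \<Gamma> \<psi> w f \<longleftrightarrow> f holomorphic_on upper_half_plane \<and>
     (\<forall>g\<in>\<Gamma>. \<forall>\<tau>\<in>upper_half_plane. f (moebius_act g \<tau>) = \<psi> g * automorphy g \<tau> ^ w * f \<tau>)"


section \<open>The complex exterior algebra\<close>

text \<open>An element of the exterior algebra on the covectors dual to a frame indexed by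
  the linearly ordered set 'n: the coefficient at I = {i1 < ... < ir} belongs to the monomial
  dx i1 ... dx ir.\<close>

typedef 'n ext = "UNIV :: ('n set \<Rightarrow> complex) set"
  morphisms ext_coeff Abs_ext ..

setup_lifting type_definition_ext

lemma ext_eqI: "(\<And>I. ext_coeff x I = ext_coeff y I) \<Longrightarrow> x = y"
  by transfer auto

definition inversions :: "'n::linorder set \<Rightarrow> 'n set \<Rightarrow> nat" where
  "inversions I J = card {(i, j) \<in> I \<times> J. j < i}"

instantiation ext :: (type) ab_group_add
begin
lift_definition zero_ext :: "'a ext" is "\<lambda>I. 0" .
lift_definition plus_ext :: "'a ext \<Rightarrow> 'a ext \<Rightarrow> 'a ext" is "\<lambda>x y I. x I + y I" .
lift_definition minus_ext :: "'a ext \<Rightarrow> 'a ext \<Rightarrow> 'a ext" is "\<lambda>x y I. x I - y I" .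
lift_definition uminus_ext :: "'a ext \<Rightarrow> 'a ext" is "\<lambda>x I. - x I" .
instance by standard (transfer; force simp: algebra_simps)+
end

lemma inversions_Un_left:
  fixes I :: "'n::{finite,linorder} set"
  assumes "I \<inter> J = {}"
  shows "inversions (I \<union> J) K = inversions I K + inversions J K"
proof -
  have "{(i, j) \<in> (I \<union> J) \<times> K. j < i} = {(i, j) \<in> I \<times> K. j < i} \<union> {(i, j) \<in> J \<times> K. j < i}"
    by auto
  moreover have "{(i, j) \<in> I \<times> K. j < i} \<inter> {(i, j) \<in> J \<times> K. j < i} = {}"
    using assms by auto
  ultimately show ?thesis
    unfolding inversions_def by (simp add: card_Un_disjoint)
qed

lemma inversions_Un_right:
  fixes I :: "'n::{finite,linorder} set"
  assumes "J \<inter> K = {}"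
  shows "inversions I (J \<union> K) = inversions I J + inversions I K"
proof -
  have "{(i, j) \<in> I \<times> (J \<union> K). j < i} = {(i, j) \<in> I \<times> J. j < i} \<union> {(i, j) \<in> I \<times> K. j < i}"
    by auto
  moreover have "{(i, j) \<in> I \<times> J. j < i} \<inter> {(i, j) \<in> I \<times> K. j < i} = {}"
    using assms by auto
  ultimately show ?thesis
    unfolding inversions_def by (simp add: card_Un_disjoint)
qed

lemma wedge_assoc_aux:
  fixes a b c :: "'n::{finite,linorder} set \<Rightarrow> complex"
  shows "(\<Sum>J\<in>Pow K. (-1) ^ inversions J (K - J) *
            (\<Sum>I\<in>Pow J. (-1) ^ inversions I (J - I) * a I * b (J - I)) * c (K - J)) =
         (\<Sum>I\<in>Pow K. (-1) ^ inversions I (K - I) * a I *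
            (\<Sum>L\<in>Pow (K - I). (-1) ^ inversions L (K - I - L) * b L * c (K - I - L)))"
proof -
  let ?s = "\<lambda>I J. (-1) ^ inversions I J :: complex"
  have "(\<Sum>J\<in>Pow K. ?s J (K - J) * (\<Sum>I\<in>Pow J. ?s I (J - I) * a I * b (J - I)) * c (K - J)) =
        (\<Sum>(J, I)\<in>Sigma (Pow K) Pow.
            ?s J (K - J) * (?s I (J - I) * a I * b (J - I)) * c (K - J))"
    by (simp add: sum.Sigma[symmetric] sum_distrib_left sum_distrib_right)
  also have "\<dots> = (\<Sum>(I, L)\<in>Sigma (Pow K) (\<lambda>I. Pow (K - I)).
            ?s I (K - I) * a I * (?s L (K - I - L) * b L * c (K - I - L)))"
  proof (rule sum.reindex_bij_witness[where i = "\<lambda>(I, L). (I \<union> L, I)" and j = "\<lambda>(J, I). (I, J - I)"])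
    fix x assume "x \<in> Sigma (Pow K) Pow"
    then obtain J I where x: "x = (J, I)" "J \<subseteq> K" "I \<subseteq> J" by auto
    have e: "K - I - (J - I) = K - J" using x by auto
    have J: "J = I \<union> (J - I)" and KI: "K - I = (J - I) \<union> (K - J)" using x by auto
    have "inversions J (K - J) = inversions I (K - J) + inversions (J - I) (K - J)"
      by (subst J, rule inversions_Un_left) auto
    moreover have "inversions I (K - I) = inversions I (J - I) + inversions I (K - J)"
      by (subst KI, rule inversions_Un_right) auto
    ultimately show "(case (case x of (J, I) \<Rightarrow> (I, J - I)) of (I, L) \<Rightarrow>
        ?s I (K - I) * a I * (?s L (K - I - L) * b L * c (K - I - L))) =
      (case x of (J, I) \<Rightarrow> ?s J (K - J) * (?s I (J - I) * a I * b (J - I)) * c (K - J))"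
      by (simp add: x(1) e power_add)
  qed auto
  finally show ?thesis
    by (simp add: sum.Sigma[symmetric] sum_distrib_left sum_distrib_right)
qed

instantiation ext :: ("{finite,linorder}") ring_1
begin
lift_definition one_ext :: "'a ext" is "\<lambda>I. if I = {} then 1 else 0" .
lift_definition times_ext :: "'a ext \<Rightarrow> 'a ext \<Rightarrow> 'a ext" is
  "\<lambda>x y K. \<Sum>I\<in>Pow K. (-1) ^ inversions I (K - I) * x I * y (K - I)" .
instance
proof
  fix x y z :: "'a ext"
  show "x * y * z = x * (y * z)"
    by transfer (rule ext, rule wedge_assoc_aux)
  show "1 * x = x"
  proof (transfer, rule ext)
    fix x :: "'a set \<Rightarrow> complex" and K
    have "(\<Sum>I\<in>Pow K. (-1) ^ inversions I (K - I) * (if I = {} then 1 else 0) * x (K - I)) =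
          (\<Sum>I\<in>Pow K. if I = {} then (-1) ^ inversions I (K - I) * x (K - I) else 0)"
      by (intro sum.cong) auto
    then show "(\<Sum>I\<in>Pow K. (-1) ^ inversions I (K - I) * (if I = {} then 1 else 0) * x (K - I)) = x K"
      by (simp add: sum.delta inversions_def)
  qed
  show "x * 1 = x"
  proof (transfer, rule ext)
    fix x :: "'a set \<Rightarrow> complex" and K
    have "(\<Sum>I\<in>Pow K. (-1) ^ inversions I (K - I) * x I * (if K - I = {} then 1 else 0)) =
          (\<Sum>I\<in>Pow K. if I = K then (-1) ^ inversions I (K - I) * x I else 0)"
      by (intro sum.cong) auto
    then show "(\<Sum>I\<in>Pow K. (-1) ^ inversions I (K - I) * x I * (if K - I = {} then 1 else 0)) = x K"
      by (simp add: sum.delta inversions_def)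
  qed
  show "(x + y) * z = x * z + y * z"
    by transfer (auto simp: algebra_simps sum.distrib)
  show "x * (y + z) = x * y + x * z"
    by transfer (auto simp: algebra_simps sum.distrib)
  show "(0 :: 'a ext) \<noteq> 1"
    by transfer (auto simp: fun_eq_iff)
qed
end

lift_definition cscale :: "complex \<Rightarrow> 'n ext \<Rightarrow> 'n ext" (infixr "*\<^sub>C" 75) is
  "\<lambda>z x I. z * x I" .

lift_definition dx :: "'n \<Rightarrow> 'n ext" is "\<lambda>i I. if I = {i} then 1 else 0" .

lift_definition degree_part :: "nat \<Rightarrow> 'n ext \<Rightarrow> 'n ext" is
  "\<lambda>d x I. if card I = d then x I else 0" .

definition one_form :: "('n::{finite,linorder} \<Rightarrow> real) \<Rightarrow> 'n ext" where
  "one_form w = (\<Sum>i\<in>UNIV. of_real (w i) *\<^sub>C dx i)"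

definition two_form :: "('n::{finite,linorder} \<Rightarrow> 'n \<Rightarrow> real) \<Rightarrow> 'n ext" where
  "two_form w = (\<Sum>i\<in>UNIV. \<Sum>j | i < j. of_real (w i j) *\<^sub>C (dx i * dx j))"

text \<open>Substitution into a power series. Every element of positive degree has vanishing m-th power
  for m > CARD('n), so on such elements the finite sums below are the full series.\<close>

definition ext_series :: "complex fps \<Rightarrow> 'n::{finite,linorder} ext \<Rightarrow> 'n ext" where
  "ext_series F x = (\<Sum>m\<le>CARD('n). fps_nth F m *\<^sub>C x ^ m)"

definition mat_pow :: "'a::semiring_1^'r^'r \<Rightarrow> nat \<Rightarrow> 'a^'r^'r" where
  "mat_pow Z m = ((\<lambda>Y. Z ** Y) ^^ m) (mat 1)"

definition mat_series :: "complex fps \<Rightarrow> 'n::{finite,linorder} ext^'r^'r \<Rightarrow> 'n ext^'r^'r" where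
  "mat_series F Z = (\<chi> i j. \<Sum>m\<le>CARD('n). fps_nth F m *\<^sub>C (mat_pow Z m $ i $ j))"

text \<open>Taylor series at the origin of a function with a removable singularity there.\<close>

definition taylor0 :: "(complex \<Rightarrow> complex) \<Rightarrow> complex fps" where
  "taylor0 f = fps_expansion (remove_sings f) 0"

text \<open>exp (1/2 tr log f(Z)), for f with f(0) = 1 after removal of the singularity; then log f has
  no constant term and the exponential is applied to a form of positive degree.\<close>

definition det_half :: "(complex \<Rightarrow> complex) \<Rightarrow> 'n::{finite,linorder} ext^'r^'r \<Rightarrow> 'n ext" where
  "det_half f Z = ext_series (fps_exp 1)
     ((1/2) *\<^sub>C trace (mat_series (taylor0 (\<lambda>z. Ln (remove_sings f z))) Z))"


section \<open>Smooth manifolds\<close>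

fun Ck_on :: "nat \<Rightarrow> 'a::euclidean_space set \<Rightarrow> ('a \<Rightarrow> 'b::real_normed_vector) \<Rightarrow> bool" where
  "Ck_on 0 S f \<longleftrightarrow> continuous_on S f"
| "Ck_on (Suc r) S f \<longleftrightarrow> (\<forall>x\<in>S. f differentiable (at x)) \<and>
     (\<forall>v. Ck_on r S (\<lambda>x. frechet_derivative f (at x) v))"

definition C_infinity_on :: "'a::euclidean_space set \<Rightarrow> ('a \<Rightarrow> 'b::real_normed_vector) \<Rightarrow> bool" where
  "C_infinity_on S f \<longleftrightarrow> (\<forall>r. Ck_on r S f)"

text \<open>A chart is its domain U together with a coordinate map, which matters only on U.\<close>

type_synonym ('m, 'n) chart = "'m set \<times> ('m \<Rightarrow> real^'n)"

definition smooth_manifold ::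
    "('m::{t2_space,second_countable_topology}, 'n::finite) chart set \<Rightarrow> bool" where
  "smooth_manifold \<A> \<longleftrightarrow>
     (\<Union>(U, \<phi>)\<in>\<A>. U) = UNIV \<and>
     (\<forall>(U, \<phi>)\<in>\<A>. open U \<and> open (\<phi> ` U) \<and> homeomorphism U (\<phi> ` U) \<phi> (inv_into U \<phi>)) \<and>
     (\<forall>(U, \<phi>)\<in>\<A>. \<forall>(U', \<phi>')\<in>\<A>. C_infinity_on (\<phi> ` (U \<inter> U')) (\<phi>' \<circ> inv_into U \<phi>))"

definition smooth_fun ::
    "('m::topological_space, 'n::finite) chart set \<Rightarrow> 'm set \<Rightarrow> ('m \<Rightarrow> real) \<Rightarrow> bool" where
  "smooth_fun \<A> W f \<longleftrightarrow> (\<forall>(U, \<phi>)\<in>\<A>. C_infinity_on (\<phi> ` (U \<inter> W)) (f \<circ> inv_into U \<phi>))"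

text \<open>Pointwise vector space structure on functions, used for sections and for derivations.\<close>

instantiation "fun" :: (type, real_vector) real_vector
begin
definition scaleR_fun :: "real \<Rightarrow> ('a \<Rightarrow> 'b) \<Rightarrow> 'a \<Rightarrow> 'b" where
  "scaleR_fun c f = (\<lambda>x. c *\<^sub>R f x)"
instance
  by standard (auto simp: scaleR_fun_def fun_eq_iff scaleR_add_right scaleR_add_left)
end

text \<open>Tangent vectors at p are the derivations at p of the algebra of smooth functions, extended
  by 0 to all other functions.\<close>

type_synonym 'm tvec = "('m \<Rightarrow> real) \<Rightarrow> real"

definition tangent_space ::
    "('m::topological_space, 'n::finite) chart set \<Rightarrow> 'm \<Rightarrow> 'm tvec set" where
  "tangent_space \<A> p = {v.
     (\<forall>f. \<not> smooth_fun \<A> UNIV f \<longrightarrow> v f = 0) \<and>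
     (\<forall>f g a b. smooth_fun \<A> UNIV f \<longrightarrow> smooth_fun \<A> UNIV g \<longrightarrow>
        v (\<lambda>q. a * f q + b * g q) = a * v f + b * v g) \<and>
     (\<forall>f g. smooth_fun \<A> UNIV f \<longrightarrow> smooth_fun \<A> UNIV g \<longrightarrow>
        v (\<lambda>q. f q * g q) = v f * g p + f p * v g)}"

definition coord_vector ::
    "('m::topological_space, 'n::finite) chart set \<Rightarrow> ('m, 'n) chart \<Rightarrow> 'n \<Rightarrow> 'm \<Rightarrow> 'm tvec" where
  "coord_vector \<A> C i p = (\<lambda>f. if smooth_fun \<A> UNIV f
     then frechet_derivative (f \<circ> inv_into (fst C) (snd C)) (at (snd C p)) (axis i 1) else 0)"


section \<open>Vector bundles, metrics, connections\<close>

text \<open>A bundle of rank CARD('r): a family of fibres, which are subspaces of some ambient vector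
  space, with a covering set of local frames. A local frame (U, e) is a trivialisation over U
  and determines the smooth structure.\<close>

record ('m, 'v, 'r) vbundle =
  fibre :: "'m \<Rightarrow> 'v set"
  frames :: "('m set \<times> ('r \<Rightarrow> 'm \<Rightarrow> 'v)) set"

definition basis_of :: "'v::real_vector set \<Rightarrow> ('r \<Rightarrow> 'v) \<Rightarrow> bool" where
  "basis_of V b \<longleftrightarrow> inj b \<and> independent (range b) \<and> span (range b) = V"

definition basis_coord :: "('r \<Rightarrow> 'v::real_vector) \<Rightarrow> 'v \<Rightarrow> 'r \<Rightarrow> real" where
  "basis_coord b v i = representation (range b) v (b i)"

definition vector_bundle ::
    "('m::topological_space, 'n::finite) chart set \<Rightarrow> ('m, 'v::real_vector, 'r::finite) vbundle \<Rightarrow> bool" where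
  "vector_bundle \<A> E \<longleftrightarrow>
     (\<Union>(U, e)\<in>frames E. U) = UNIV \<and>
     (\<forall>(U, e)\<in>frames E. open U \<and> (\<forall>p\<in>U. basis_of (fibre E p) (\<lambda>a. e a p))) \<and>
     (\<forall>(U, e)\<in>frames E. \<forall>(U', e')\<in>frames E. \<forall>a b.
        smooth_fun \<A> (U \<inter> U') (\<lambda>p. basis_coord (\<lambda>a. e a p) (e' b p) a))"

definition basis_change :: "('r::finite \<Rightarrow> 'v::real_vector) \<Rightarrow> ('r \<Rightarrow> 'v) \<Rightarrow> real^'r^'r" where
  "basis_change b b' = (\<chi> i j. basis_coord b (b' j) i)"

text \<open>An orientation is given by the choice of the frames in the record, all of them positive.\<close>

definition oriented_bundle ::
    "('m::topological_space, 'n::finite) chart set \<Rightarrow> ('m, 'v::real_vector, 'r::finite) vbundle \<Rightarrow> bool" where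
  "oriented_bundle \<A> E \<longleftrightarrow> vector_bundle \<A> E \<and>
     (\<forall>(U, e)\<in>frames E. \<forall>(U', e')\<in>frames E. \<forall>p\<in>U \<inter> U'.
        det (basis_change (\<lambda>a. e a p) (\<lambda>a. e' a p)) > 0)"

definition positive_basis :: "('m, 'v::real_vector, 'r::finite) vbundle \<Rightarrow> 'm \<Rightarrow> ('r \<Rightarrow> 'v) \<Rightarrow> bool" where
  "positive_basis E p b \<longleftrightarrow> basis_of (fibre E p) b \<and>
     (\<exists>(U, e)\<in>frames E. p \<in> U \<and> det (basis_change (\<lambda>a. e a p) b) > 0)"

definition tangent_bundle ::
    "('m::topological_space, 'n::finite) chart set \<Rightarrow> ('m, 'm tvec, 'n) vbundle" where
  "tangent_bundle \<A> = \<lparr> fibre = tangent_space \<A>,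
     frames = (\<lambda>C. (fst C, coord_vector \<A> C)) ` \<A> \<rparr>"

definition smooth_section ::
    "('m::topological_space, 'n::finite) chart set \<Rightarrow> ('m, 'v::real_vector, 'r::finite) vbundle \<Rightarrow>
      ('m \<Rightarrow> 'v) \<Rightarrow> bool" where
  "smooth_section \<A> E s \<longleftrightarrow> (\<forall>p. s p \<in> fibre E p) \<and>
     (\<forall>(U, e)\<in>frames E. \<forall>a. smooth_fun \<A> U (\<lambda>p. basis_coord (\<lambda>a. e a p) (s p) a))"

abbreviation smooth_field ::
    "('m::topological_space, 'n::finite) chart set \<Rightarrow> ('m \<Rightarrow> 'm tvec) \<Rightarrow> bool" where
  "smooth_field \<A> \<equiv> smooth_section \<A> (tangent_bundle \<A>)"

definition bundle_metric ::
    "('m::topological_space, 'n::finite) chart set \<Rightarrow> ('m, 'v::real_vector, 'r::finite) vbundle \<Rightarrow>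
      ('m \<Rightarrow> 'v \<Rightarrow> 'v \<Rightarrow> real) \<Rightarrow> bool" where
  "bundle_metric \<A> E h \<longleftrightarrow>
     (\<forall>p. \<forall>v\<in>fibre E p. \<forall>w\<in>fibre E p. h p v w = h p w v \<and> (v \<noteq> 0 \<longrightarrow> h p v v > 0) \<and>
        (\<forall>v'\<in>fibre E p. \<forall>a b. h p (a *\<^sub>R v + b *\<^sub>R v') w = a * h p v w + b * h p v' w)) \<and>
     (\<forall>(U, e)\<in>frames E. \<forall>a b. smooth_fun \<A> U (\<lambda>p. h p (e a p) (e b p)))"

type_synonym ('m, 'v) connection_op = "('m \<Rightarrow> 'm tvec) \<Rightarrow> ('m \<Rightarrow> 'v) \<Rightarrow> ('m \<Rightarrow> 'v)"

definition connection ::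
    "('m::topological_space, 'n::finite) chart set \<Rightarrow> ('m, 'v::real_vector, 'r::finite) vbundle \<Rightarrow>
      ('m, 'v) connection_op \<Rightarrow> bool" where
  "connection \<A> E D \<longleftrightarrow>
     (\<forall>X s. smooth_field \<A> X \<longrightarrow> smooth_section \<A> E s \<longrightarrow> smooth_section \<A> E (D X s)) \<and>
     (\<forall>X Y s. smooth_field \<A> X \<longrightarrow> smooth_field \<A> Y \<longrightarrow> smooth_section \<A> E s \<longrightarrow>
        D (X + Y) s = D X s + D Y s) \<and>
     (\<forall>f X s. smooth_fun \<A> UNIV f \<longrightarrow> smooth_field \<A> X \<longrightarrow> smooth_section \<A> E s \<longrightarrow>
        D (\<lambda>p. f p *\<^sub>R X p) s = (\<lambda>p. f p *\<^sub>R D X s p)) \<and>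
     (\<forall>X s s'. smooth_field \<A> X \<longrightarrow> smooth_section \<A> E s \<longrightarrow> smooth_section \<A> E s' \<longrightarrow>
        D X (s + s') = D X s + D X s') \<and>
     (\<forall>f X s. smooth_fun \<A> UNIV f \<longrightarrow> smooth_field \<A> X \<longrightarrow> smooth_section \<A> E s \<longrightarrow>
        D X (\<lambda>p. f p *\<^sub>R s p) = (\<lambda>p. X p f *\<^sub>R s p + f p *\<^sub>R D X s p))"

definition euclidean_connection ::
    "('m::topological_space, 'n::finite) chart set \<Rightarrow> ('m, 'v::real_vector, 'r::finite) vbundle \<Rightarrow>
      ('m \<Rightarrow> 'v \<Rightarrow> 'v \<Rightarrow> real) \<Rightarrow> ('m, 'v) connection_op \<Rightarrow> bool" where
  "euclidean_connection \<A> E h D \<longleftrightarrow> connection \<A> E D \<and>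
     (\<forall>X s s'. smooth_field \<A> X \<longrightarrow> smooth_section \<A> E s \<longrightarrow> smooth_section \<A> E s' \<longrightarrow>
        (\<forall>p. X p (\<lambda>q. h q (s q) (s' q)) = h p (D X s p) (s' p) + h p (s p) (D X s' p)))"

definition lie_bracket :: "('m \<Rightarrow> 'm tvec) \<Rightarrow> ('m \<Rightarrow> 'm tvec) \<Rightarrow> 'm \<Rightarrow> 'm tvec" where
  "lie_bracket X Y p = (\<lambda>f. X p (\<lambda>q. Y q f) - Y p (\<lambda>q. X q f))"

definition curvature ::
    "('m, 'v::real_vector) connection_op \<Rightarrow> ('m \<Rightarrow> 'm tvec) \<Rightarrow> ('m \<Rightarrow> 'm tvec) \<Rightarrow> ('m \<Rightarrow> 'v) \<Rightarrow> 'm \<Rightarrow> 'v" where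
  "curvature D X Y s = D X (D Y s) - D Y (D X s) - D (lie_bracket X Y) s"

definition connection_path ::
    "('m, 'v::real_vector) connection_op \<Rightarrow> ('m, 'v) connection_op \<Rightarrow> real \<Rightarrow> ('m, 'v) connection_op" where
  "connection_path D0 D1 t = (\<lambda>X s. (1 - t) *\<^sub>R D0 X s + t *\<^sub>R D1 X s)"


section \<open>Differential forms in frames\<close>

text \<open>A frame (p, X, s) at the point p: smooth vector fields X whose values at p form a basis of
  the tangent space, and smooth sections s of the oriented Euclidean plane bundle whose values at p
  form an oriented orthonormal basis of the fibre. A differential form on M is represented by the
  function that sends a frame (p, X, s) to the form at p, written in the coframe dx dual to X at p.
  By tensoriality curvatures and differences of connections at p depend only on the values at p
  of the fields and sections they are applied to.\<close>

type_synonym ('m, 'n, 'v) frame = "'m \<times> ('n \<Rightarrow> 'm \<Rightarrow> 'm tvec) \<times> (2 \<Rightarrow> 'm \<Rightarrow> 'v)"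
type_synonym ('m, 'n, 'v) form = "('m, 'n, 'v) frame \<Rightarrow> 'n ext"

definition adapted_frames ::
    "('m::topological_space, 'n::finite) chart set \<Rightarrow> ('m, 'v::real_vector, 2) vbundle \<Rightarrow>
      ('m \<Rightarrow> 'v \<Rightarrow> 'v \<Rightarrow> real) \<Rightarrow> ('m, 'n, 'v) frame set" where
  "adapted_frames \<A> \<xi> h = {(p, X, s).
     (\<forall>i. smooth_field \<A> (X i)) \<and> basis_of (tangent_space \<A> p) (\<lambda>i. X i p) \<and>
     (\<forall>a. smooth_section \<A> \<xi> (s a)) \<and> positive_basis \<xi> p (\<lambda>a. s a p) \<and>
     (\<forall>a b. h p (s a p) (s b p) = (if a = b then 1 else 0))}"

text \<open>Matrix of the End(E)-valued curvature 2-form with respect to the basis s of the fibre at p: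
  R (s b) is the sum over a of the (a, b) entry times s a.\<close>

definition curvature_matrix ::
    "('m, 'v::real_vector) connection_op \<Rightarrow> 'm \<Rightarrow> ('n::{finite,linorder} \<Rightarrow> 'm \<Rightarrow> 'm tvec) \<Rightarrow>
      ('r::finite \<Rightarrow> 'm \<Rightarrow> 'v) \<Rightarrow> 'n ext^'r^'r" where
  "curvature_matrix D p X s =
     (\<chi> a b. two_form (\<lambda>i j. basis_coord (\<lambda>c. s c p) (curvature D (X i) (X j) (s b) p) a))"

definition difference_matrix ::
    "('m, 'm tvec) connection_op \<Rightarrow> ('m, 'm tvec) connection_op \<Rightarrow> 'm \<Rightarrow>
      ('n::{finite,linorder} \<Rightarrow> 'm \<Rightarrow> 'm tvec) \<Rightarrow> (('n ext, 'n) vec, 'n) vec" where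
  "difference_matrix D0 D1 p X =
     (\<chi> a b. one_form (\<lambda>i. basis_coord (\<lambda>c. X c p) (D1 (X i) (X b) p - D0 (X i) (X b) p) a))"

definition scaled_curvature ::
    "('m, 'm tvec) connection_op \<Rightarrow> 'm \<Rightarrow> ('n::{finite,linorder} \<Rightarrow> 'm \<Rightarrow> 'm tvec) \<Rightarrow> (('n ext, 'n) vec, 'n) vec" where
  "scaled_curvature D p X =
     (\<chi> a b. (1 / (4 * of_real pi ^ 2)) *\<^sub>C (curvature_matrix D p X X $ a $ b))"

text \<open>Euler form Pf(R/2pi), with R written in an oriented orthonormal basis and
  Pf ((0, r), (-r, 0)) = r. With this sign the Euler form of an oriented plane bundle is the first
  Chern form of the corresponding complex line bundle; the Chern roots of the complexification,
  i.e. the eigenvalues of iR/2pi, are plus and minus the Euler form.\<close>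

definition euler_form ::
    "('m, 'v::real_vector) connection_op \<Rightarrow> 'm \<Rightarrow> ('n::{finite,linorder} \<Rightarrow> 'm \<Rightarrow> 'm tvec) \<Rightarrow>
      (2 \<Rightarrow> 'm \<Rightarrow> 'v) \<Rightarrow> 'n ext" where
  "euler_form D p X s = (1 / (2 * of_real pi)) *\<^sub>C (curvature_matrix D p X s $ 1 $ 2)"

definition u_form ::
    "('m, 'v::real_vector) connection_op \<Rightarrow> 'm \<Rightarrow> ('n::{finite,linorder} \<Rightarrow> 'm \<Rightarrow> 'm tvec) \<Rightarrow>
      (2 \<Rightarrow> 'm \<Rightarrow> 'v) \<Rightarrow> 'n ext" where
  "u_form D p X s = (1 / (2 * of_real pi * \<i>)) *\<^sub>C euler_form D p X s"


section \<open>Characteristic forms and their transgressions\<close>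

definition f_L :: "complex \<Rightarrow> complex \<Rightarrow> complex" where
  "f_L \<tau> z = z * (theta' 0 \<tau> / theta z \<tau>) * (theta1 z \<tau> / theta1 0 \<tau>)"

definition f_W :: "complex \<Rightarrow> complex \<Rightarrow> complex" where
  "f_W \<tau> z = z * (theta' 0 \<tau> / theta z \<tau>) * (theta2 z \<tau> / theta2 0 \<tau>)"

definition f_W' :: "complex \<Rightarrow> complex \<Rightarrow> complex" where
  "f_W' \<tau> z = z * (theta' 0 \<tau> / theta z \<tau>) * (theta3 z \<tau> / theta3 0 \<tau>)"

definition G_L :: "complex \<Rightarrow> complex \<Rightarrow> complex" where
  "G_L \<tau> u = theta' 0 \<tau> / theta u \<tau> *
     (theta1 u \<tau> / theta1 0 \<tau> -
      theta1 0 \<tau> / theta1 u \<tau> * (theta3 u \<tau> / theta3 0 \<tau>) * (theta2 u \<tau> / theta2 0 \<tau>))"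

definition G_W :: "complex \<Rightarrow> complex \<Rightarrow> complex" where
  "G_W \<tau> u = theta' 0 \<tau> / theta u \<tau> *
     (theta2 u \<tau> / theta2 0 \<tau> -
      theta2 0 \<tau> / theta2 u \<tau> * (theta3 u \<tau> / theta3 0 \<tau>) * (theta1 u \<tau> / theta1 0 \<tau>))"

definition G_W' :: "complex \<Rightarrow> complex \<Rightarrow> complex" where
  "G_W' \<tau> u = theta' 0 \<tau> / theta u \<tau> *
     (theta3 u \<tau> / theta3 0 \<tau> -
      theta3 0 \<tau> / theta3 u \<tau> * (theta2 u \<tau> / theta2 0 \<tau>) * (theta1 u \<tau> / theta1 0 \<tau>))"

definition h_L :: "complex \<Rightarrow> complex \<Rightarrow> complex" where
  "h_L \<tau> z = 1 / z - theta' z \<tau> / theta z \<tau> + theta1' z \<tau> / theta1 z \<tau>"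

definition h_W :: "complex \<Rightarrow> complex \<Rightarrow> complex" where
  "h_W \<tau> z = 1 / z - theta' z \<tau> / theta z \<tau> + theta2' z \<tau> / theta2 z \<tau>"

definition h_W' :: "complex \<Rightarrow> complex \<Rightarrow> complex" where
  "h_W' \<tau> z = 1 / z - theta' z \<tau> / theta z \<tau> + theta3' z \<tau> / theta3 z \<tau>"

definition Phi_L ::
    "nat \<Rightarrow> ('m, 'm tvec) connection_op \<Rightarrow> ('m, 'v::real_vector) connection_op \<Rightarrow> complex \<Rightarrow>
      ('m, 'n::{finite,linorder}, 'v) form" where
  "Phi_L k D D\<xi> \<tau> = (\<lambda>(p, X, s). (of_real (sqrt 2) ^ (4 * k + 1) / (of_real pi * \<i>)) *\<^sub>C
     (det_half (f_L \<tau>) (scaled_curvature D p X) * ext_series (taylor0 (G_L \<tau>)) (u_form D\<xi> p X s)))"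

definition Phi_W ::
    "('m, 'm tvec) connection_op \<Rightarrow> ('m, 'v::real_vector) connection_op \<Rightarrow> complex \<Rightarrow>
      ('m, 'n::{finite,linorder}, 'v) form" where
  "Phi_W D D\<xi> \<tau> = (\<lambda>(p, X, s). (1 / (2 * of_real pi * \<i>)) *\<^sub>C
     (det_half (f_W \<tau>) (scaled_curvature D p X) * ext_series (taylor0 (G_W \<tau>)) (u_form D\<xi> p X s)))"

definition Phi_W' ::
    "('m, 'm tvec) connection_op \<Rightarrow> ('m, 'v::real_vector) connection_op \<Rightarrow> complex \<Rightarrow>
      ('m, 'n::{finite,linorder}, 'v) form" where
  "Phi_W' D D\<xi> \<tau> = (\<lambda>(p, X, s). (1 / (2 * of_real pi * \<i>)) *\<^sub>C
     (det_half (f_W' \<tau>) (scaled_curvature D p X) * ext_series (taylor0 (G_W' \<tau>)) (u_form D\<xi> p X s)))"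

definition ext_integral01 :: "(real \<Rightarrow> 'n ext) \<Rightarrow> 'n ext" where
  "ext_integral01 F = Abs_ext (\<lambda>I. integral {0..1} (\<lambda>t. ext_coeff (F t) I))"

definition CS_L ::
    "nat \<Rightarrow> ('m, 'm tvec) connection_op \<Rightarrow> ('m, 'm tvec) connection_op \<Rightarrow>
      ('m, 'v::real_vector) connection_op \<Rightarrow> complex \<Rightarrow> ('m, 'n::{finite,linorder}, 'v) form" where
  "CS_L k D0 D1 D\<xi> \<tau> = (\<lambda>(p, X, s). (of_real (sqrt 2) / (8 * of_real pi ^ 2)) *\<^sub>C
     ext_integral01 (\<lambda>t. Phi_L k (connection_path D0 D1 t) D\<xi> \<tau> (p, X, s) *
       trace (difference_matrix D0 D1 p X **
         mat_series (taylor0 (h_L \<tau>)) (scaled_curvature (connection_path D0 D1 t) p X))))"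

definition CS_W ::
    "('m, 'm tvec) connection_op \<Rightarrow> ('m, 'm tvec) connection_op \<Rightarrow>
      ('m, 'v::real_vector) connection_op \<Rightarrow> complex \<Rightarrow> ('m, 'n::{finite,linorder}, 'v) form" where
  "CS_W D0 D1 D\<xi> \<tau> = (\<lambda>(p, X, s). (1 / (8 * of_real pi ^ 2)) *\<^sub>C
     ext_integral01 (\<lambda>t. Phi_W (connection_path D0 D1 t) D\<xi> \<tau> (p, X, s) *
       trace (difference_matrix D0 D1 p X **
         mat_series (taylor0 (h_W \<tau>)) (scaled_curvature (connection_path D0 D1 t) p X))))"

definition CS_W' ::
    "('m, 'm tvec) connection_op \<Rightarrow> ('m, 'm tvec) connection_op \<Rightarrow>
      ('m, 'v::real_vector) connection_op \<Rightarrow> complex \<Rightarrow> ('m, 'n::{finite,linorder}, 'v) form" where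
  "CS_W' D0 D1 D\<xi> \<tau> = (\<lambda>(p, X, s). (1 / (8 * of_real pi ^ 2)) *\<^sub>C
     ext_integral01 (\<lambda>t. Phi_W' (connection_path D0 D1 t) D\<xi> \<tau> (p, X, s) *
       trace (difference_matrix D0 D1 p X **
         mat_series (taylor0 (h_W' \<tau>)) (scaled_curvature (connection_path D0 D1 t) p X))))"

text \<open>Modularity of a form-valued function of tau: every coefficient at every point and in every
  frame from the set P is modular, with one common character.\<close>

definition modular_form ::
    "('m, 'n, 'v) frame set \<Rightarrow> (int^2^2) set \<Rightarrow> nat \<Rightarrow> (complex \<Rightarrow> ('m, 'n, 'v) form) \<Rightarrow> bool" where
  "modular_form P \<Gamma> w F \<longleftrightarrow> (\<exists>\<psi>. group_character \<Gamma> \<psi> \<and>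
     (\<forall>fr\<in>P. \<forall>I. modular_with \<Gamma> \<psi> w (\<lambda>\<tau>. ext_coeff (F \<tau> fr) I)))"

end

theory Submission
  imports Defs
begin

text \<open>
  Everything is expressed through the three quotients
  $F_i(v) = \theta'(0)\,\theta_i(v) / (\theta(v)\,\theta_i(0))$, which have a simple pole with residue 1 at
  the origin: $f_i = z F_i$, the factor $G_i$ is $F_i - F_1 F_2 F_3 / F_i^2$, and $h_i$ is the logarithmic
  derivative of $f_i$. The quotients are elliptic up to signs, so the law
  $F_i(z, -1/\tau) = \tau F_j(\tau z, \tau)$ follows from Liouville's theorem without Jacobi's imaginary
  transformation: the difference of the two sides is entire and bounded, hence constant, and it changes sign under
  a period. In particular all multiplier systems cancel and the characters are trivial.
  The power of $\tau$ is then counted by the degree in the exterior algebra: with $l^2 = \tau$, multiplying forms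
  of degree $d$ by $l^d$ is an algebra endomorphism that multiplies the curvatures by $\tau$.
\<close>

section \<open>Theta functions as infinite products\<close>

text \<open>The congruence subgroups are never given by generators: all of SL2(Z) acts on a family
  indexed by three parity pairs, and each subgroup is the stabiliser of one pair. Hence the three
  forms are treated as members of one family, and the second summand of G_i is written with F_1 F_2
  F_3, which the whole group preserves up to rescaling, so that only F_i has to be followed. The
  weight 2k+2 splits as 2k+1+1. In degree 4k+1 one degree comes from the connection difference,
  which the substitution of tau z for z leaves alone, and the other 4k come from curvatures, one
  factor tau for each degree 2; dividing by z in G_i and differentiating in h_i give one factor tau
  each. Holomorphy in tau survives the integral over the path because nilpotency truncates every
  series: the integrand is a finite sum of products a(tau) c(t), and only the Taylor coefficients in
  z have to be shown holomorphic in tau, by Cauchy estimates for the partial products.\<close>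

definition qpoch :: "complex \<Rightarrow> complex \<Rightarrow> complex" where
  "qpoch a q = (\<Prod>n. 1 - a * q ^ n)"

lemma convergent_prod_qpoch:
  fixes a q :: complex
  assumes "norm q < 1"
  shows "convergent_prod (\<lambda>n. 1 - a * q ^ n)"
proof -
  have "summable (\<lambda>n. norm a * norm q ^ n)"
    using assms by (intro summable_mult summable_geometric) auto
  moreover have "norm (1 - a * q ^ n - 1) = norm a * norm q ^ n" for n
    by (simp add: norm_mult norm_power)
  ultimately have "summable (\<lambda>n. norm (1 - a * q ^ n - 1))"
    by (simp only:)
  then show ?thesis
    by (intro abs_convergent_prod_imp_convergent_prod summable_imp_abs_convergent_prod)
qed

lemma qpoch_LIMSEQ:
  assumes "norm q < 1"
  shows "(\<lambda>N. \<Prod>n<N. 1 - a * q ^ n) \<longlonglongrightarrow> qpoch a q"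
proof -
  have "(\<lambda>N. \<Prod>n\<le>N. 1 - a * q ^ n) \<longlonglongrightarrow> qpoch a q"
    unfolding qpoch_def by (rule convergent_prod_LIMSEQ[OF convergent_prod_qpoch[OF assms]])
  then show ?thesis
    unfolding lessThan_Suc_atMost[symmetric] by (rule LIMSEQ_imp_Suc)
qed

lemma qpoch_rec:
  assumes "norm q < 1"
  shows "qpoch a q = (1 - a) * qpoch (a * q) q"
proof (rule LIMSEQ_unique)
  show "(\<lambda>N. \<Prod>n<Suc N. 1 - a * q ^ n) \<longlonglongrightarrow> qpoch a q"
    using qpoch_LIMSEQ[OF assms] by (rule LIMSEQ_Suc)
  have "(\<lambda>N. (1 - a) * (\<Prod>n<N. 1 - a * q * q ^ n)) \<longlonglongrightarrow> (1 - a) * qpoch (a * q) q"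
    by (intro tendsto_mult tendsto_const qpoch_LIMSEQ assms)
  then show "(\<lambda>N. \<Prod>n<Suc N. 1 - a * q ^ n) \<longlonglongrightarrow> (1 - a) * qpoch (a * q) q"
    unfolding prod.lessThan_Suc_shift by (simp add: mult.assoc)
qed

lemma qpoch_eq_0_iff:
  assumes "norm q < 1"
  shows "qpoch a q = 0 \<longleftrightarrow> (\<exists>n. a * q ^ n = 1)"
proof -
  have "(\<lambda>n. 1 - a * q ^ n) has_prod qpoch a q"
    unfolding qpoch_def by (rule convergent_prod_has_prod[OF convergent_prod_qpoch[OF assms]])
  from has_prod_eq_0_iff[OF this] have "qpoch a q = 0 \<longleftrightarrow> (\<exists>n. 0 = 1 - a * q ^ n)"
    unfolding image_iff by simp
  also have "\<dots> \<longleftrightarrow> (\<exists>n. a * q ^ n = 1)"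
    by (intro ex_cong1) (auto simp: algebra_simps)
  finally show ?thesis .
qed

text \<open>The maxima r of |q| and M of |a| over the compact set give the summable majorant M r^n.
  Both arguments may vary, because the statement serves for holomorphy in a at fixed q and for joint
  convergence in (tau, v).\<close>

lemma uniform_limit_qpoch:
  fixes a q :: "'a::topological_space \<Rightarrow> complex"
  assumes "compact A" "continuous_on A a" "continuous_on A q" "\<And>x. x \<in> A \<Longrightarrow> norm (q x) < 1"
  shows "uniform_limit A (\<lambda>N x. \<Prod>n<N. 1 - a x * q x ^ n) (\<lambda>x. qpoch (a x) (q x)) sequentially"
proof (cases "A = {}")
  case False
  obtain r where r: "r < 1" "\<And>x. x \<in> A \<Longrightarrow> norm (q x) \<le> r"
    using continuous_attains_sup[OF \<open>compact A\<close> False continuous_on_norm[OF assms(3)]] assms(4)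
    by metis
  obtain M where M: "\<And>x. x \<in> A \<Longrightarrow> norm (a x) \<le> M"
    using continuous_attains_sup[OF \<open>compact A\<close> False continuous_on_norm[OF assms(2)]]
    by metis
  have nn: "r \<ge> 0" "M \<ge> 0"
    using False r(2) M norm_ge_zero order_trans by blast+
  have "uniformly_convergent_on A (\<lambda>N x. \<Sum>n<N. norm (- (a x * q x ^ n)))"
  proof (rule Weierstrass_m_test'_ev)
    show "\<forall>\<^sub>F n in sequentially. \<forall>x\<in>A. norm (norm (- (a x * q x ^ n))) \<le> M * r ^ n"
      using r M nn by (auto intro!: always_eventually mult_mono power_mono simp: norm_mult norm_power)
    show "summable (\<lambda>n. M * r ^ n)"
      using r nn by (intro summable_mult summable_geometric) auto
  qed
  then have "uniformly_convergent_on A (\<lambda>N x. \<Prod>n<N. 1 + (- (a x * q x ^ n)))"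
    using assms by (intro Infinite_Products.uniformly_convergent_on_prod continuous_intros)
  then obtain l where l: "uniform_limit A (\<lambda>N x. \<Prod>n<N. 1 - a x * q x ^ n) l sequentially"
    by (auto simp: uniformly_convergent_on_def)
  have "l x = qpoch (a x) (q x)" if "x \<in> A" for x
    by (rule LIMSEQ_unique[OF tendsto_uniform_limitI[OF l that] qpoch_LIMSEQ[OF assms(4)[OF that]]])
  then have "uniform_limit A (\<lambda>N x. \<Prod>n<N. 1 - a x * q x ^ n) l sequentially \<longleftrightarrow> ?thesis"
    by (intro uniform_limit_cong') auto
  then show ?thesis
    using l by simp
qed auto

lemma holomorphic_on_qpoch [holomorphic_intros]:
  assumes "norm q < 1" "f holomorphic_on A" "open A"
  shows "(\<lambda>z. qpoch (f z) q) holomorphic_on A"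
proof -
  have "(\<lambda>a. qpoch a q) holomorphic_on UNIV"
  proof (rule holomorphic_uniform_sequence)
    fix x :: complex
    have "uniform_limit (cball x 1) (\<lambda>N z. \<Prod>n<N. 1 - z * q ^ n) (\<lambda>z. qpoch z q) sequentially"
      using assms by (intro uniform_limit_qpoch continuous_intros) auto
    then show "\<exists>d>0. cball x d \<subseteq> UNIV \<and>
        uniform_limit (cball x d) (\<lambda>N z. \<Prod>n<N. 1 - z * q ^ n) (\<lambda>z. qpoch z q) sequentially"
      by (intro exI[of _ 1]) auto
  qed (auto intro!: holomorphic_intros)
  then have "((\<lambda>a. qpoch a q) \<circ> f) holomorphic_on A"
    using assms(2) by (intro holomorphic_on_compose) (auto intro: holomorphic_on_subset)
  then show ?thesis by (simp add: o_def)
qed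

text \<open>Up to the factor (q;q) this is the Jacobi triple product. The asymmetry between a q and
  1/a absorbs the factor 1 - 1/a hidden in the sine or cosine, so that all four theta functions
  become one function at arguments differing by half periods.\<close>

definition qprod2 :: "complex \<Rightarrow> complex \<Rightarrow> complex" where
  "qprod2 a q = qpoch (a * q) q * qpoch (inverse a) q"

text \<open>Passing from a to a q removes the factor 1 - a q from one product and adds 1 - 1/(a q)
  to the other; the quotient of the two is the monomial - 1/(a q).\<close>

lemma qprod2_shift:
  assumes "norm q < 1" "q \<noteq> 0" "a \<noteq> 0"
  shows "qprod2 (a * q) q = - inverse (a * q) * qprod2 a q"
proof -
  have "qpoch (inverse (a * q)) q = (1 - inverse (a * q)) * qpoch (inverse a) q"
    using qpoch_rec[OF assms(1), of "inverse (a * q)"] assms by (simp add: field_simps)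
  moreover have "qpoch (a * q) q = (1 - a * q) * qpoch (a * q * q) q"
    by (rule qpoch_rec[OF assms(1)])
  moreover have "y * ((1 - inverse (a * q)) * x) = - inverse (a * q) * ((1 - a * q) * y * x)" for x y
    using assms by (simp add: field_simps)
  ultimately show ?thesis
    unfolding qprod2_def by (simp only:)
qed

lemma qprod2_eq_0:
  assumes "norm q < 1" "q \<noteq> 0" "a \<noteq> 0" "qprod2 a q = 0"
  shows "\<exists>n::int. a = q powi n"
proof -
  from assms have "qpoch (a * q) q = 0 \<or> qpoch (inverse a) q = 0"
    by (auto simp: qprod2_def)
  then show ?thesis
  proof
    assume "qpoch (a * q) q = 0"
    \<comment> \<open>The factors of this product start at a q, hence it accounts for the negative
      exponents; the other one starts at 1/a and gives the nonnegative ones.\<close>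
    then obtain n where "a * q ^ Suc n = 1"
      using assms by (auto simp: qpoch_eq_0_iff mult.assoc)
    then have "a = inverse (q ^ Suc n)"
      using assms by (metis inverse_unique inverse_inverse_eq mult.commute)
    then show ?thesis
      by (intro exI[of _ "- int (Suc n)"]) (simp add: power_int_minus del: power_Suc of_nat_Suc)
  next
    assume "qpoch (inverse a) q = 0"
    then obtain n where "inverse a * q ^ n = 1"
      using assms by (auto simp: qpoch_eq_0_iff)
    then have "a = q ^ n"
      using assms by (simp add: field_simps)
    then show ?thesis
      by (intro exI[of _ "int n"]) simp
  qed
qed

lemma qpow_add: "qpow \<tau> (a + b) = qpow \<tau> a * qpow \<tau> b"
  by (simp add: qpow_def ring_distribs exp_add)

lemma qpow_of_nat: "qpow \<tau> (real n) = qpow \<tau> 1 ^ n"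
  by (simp add: qpow_def exp_of_nat_mult[symmetric] mult_ac)

lemma qpow_nonzero [simp]: "qpow \<tau> a \<noteq> 0"
  by (simp add: qpow_def)

lemma evar_nonzero [simp]: "evar v \<noteq> 0"
  by (simp add: evar_def)

lemma evar_minus: "evar (- v) = inverse (evar v)"
  by (simp add: evar_def exp_minus)

lemma norm_qpow_1: "\<tau> \<in> upper_half_plane \<Longrightarrow> norm (qpow \<tau> 1) < 1"
  by (simp add: qpow_def upper_half_plane_def norm_exp_eq_Re)

lemma prodinf_three_qpoch:
  assumes "norm q < 1"
  shows "(\<Prod>n. (1 - q ^ Suc n) * (1 - a * q ^ n) * (1 - b * q ^ n)) = qpoch q q * qpoch a q * qpoch b q"
proof (rule LIMSEQ_unique)
  have "convergent_prod (\<lambda>n. (1 - q ^ Suc n) * (1 - a * q ^ n) * (1 - b * q ^ n))"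
    unfolding power_Suc by (intro convergent_prod_mult convergent_prod_qpoch assms)
  then have "(\<lambda>N. \<Prod>n\<le>N. (1 - q ^ Suc n) * (1 - a * q ^ n) * (1 - b * q ^ n)) \<longlonglongrightarrow>
      (\<Prod>n. (1 - q ^ Suc n) * (1 - a * q ^ n) * (1 - b * q ^ n))"
    by (rule convergent_prod_LIMSEQ)
  then show "(\<lambda>N. \<Prod>n<N. (1 - q ^ Suc n) * (1 - a * q ^ n) * (1 - b * q ^ n)) \<longlonglongrightarrow>
      (\<Prod>n. (1 - q ^ Suc n) * (1 - a * q ^ n) * (1 - b * q ^ n))"
    unfolding lessThan_Suc_atMost[symmetric] by (rule LIMSEQ_imp_Suc)
  show "(\<lambda>N. \<Prod>n<N. (1 - q ^ Suc n) * (1 - a * q ^ n) * (1 - b * q ^ n)) \<longlonglongrightarrow>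
      qpoch q q * qpoch a q * qpoch b q"
    unfolding prod.distrib power_Suc by (intro tendsto_mult qpoch_LIMSEQ assms)
qed

lemma theta_eq_qpoch:
  assumes "\<tau> \<in> upper_half_plane"
  defines "q \<equiv> qpow \<tau> 1"
  shows "theta v \<tau> = 2 * qpow \<tau> (1/8) * sin (of_real pi * v) *
           (qpoch q q * qpoch (evar v * q) q * qpoch (evar (- v) * q) q)"
    and "theta1 v \<tau> = 2 * qpow \<tau> (1/8) * cos (of_real pi * v) *
           (qpoch q q * qpoch (- evar v * q) q * qpoch (- evar (- v) * q) q)"
    and "theta2 v \<tau> = qpoch q q * qpoch (evar v * qpow \<tau> (1/2)) q * qpoch (evar (- v) * qpow \<tau> (1/2)) q"
    and "theta3 v \<tau> = qpoch q q * qpoch (- evar v * qpow \<tau> (1/2)) q * qpoch (- evar (- v) * qpow \<tau> (1/2)) q"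
proof -
  have q: "norm q < 1"
    unfolding q_def by (rule norm_qpow_1[OF assms(1)])
  have p: "qpow \<tau> (real (Suc n)) = q ^ Suc n" for n
    unfolding q_def by (rule qpow_of_nat)
  \<comment> \<open>The exponents j - 1/2 with j = n + 1 become 1/2 + n, so theta2 and theta3 start
    at q^{1/2} where theta and theta1 start at q.\<close>
  have p': "qpow \<tau> (real (Suc n) - 1/2) = qpow \<tau> (1/2) * q ^ n" for n
    using qpow_add[of \<tau> "1/2" "real n"] by (simp add: q_def qpow_of_nat algebra_simps)
  have e: "1 - x * q ^ Suc n = 1 - x * q * q ^ n" "1 + x * q ^ Suc n = 1 - (- x * q) * q ^ n"
      "1 - x * (qpow \<tau> (1/2) * q ^ n) = 1 - x * qpow \<tau> (1/2) * q ^ n"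
      "1 + x * (qpow \<tau> (1/2) * q ^ n) = 1 - (- x * qpow \<tau> (1/2)) * q ^ n" for x n
    by (simp_all add: mult.assoc)
  show "theta v \<tau> = 2 * qpow \<tau> (1/8) * sin (of_real pi * v) *
           (qpoch q q * qpoch (evar v * q) q * qpoch (evar (- v) * q) q)"
    unfolding theta_def p e prodinf_three_qpoch[OF q] ..
  show "theta1 v \<tau> = 2 * qpow \<tau> (1/8) * cos (of_real pi * v) *
           (qpoch q q * qpoch (- evar v * q) q * qpoch (- evar (- v) * q) q)"
    unfolding theta1_def p e prodinf_three_qpoch[OF q] ..
  show "theta2 v \<tau> = qpoch q q * qpoch (evar v * qpow \<tau> (1/2)) q * qpoch (evar (- v) * qpow \<tau> (1/2)) q"
    unfolding theta2_def p' p e prodinf_three_qpoch[OF q] ..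
  show "theta3 v \<tau> = qpoch q q * qpoch (- evar v * qpow \<tau> (1/2)) q * qpoch (- evar (- v) * qpow \<tau> (1/2)) q"
    unfolding theta3_def p' p e prodinf_three_qpoch[OF q] ..
qed

section \<open>Quotients of theta functions\<close>

text \<open>The parity pair (x, y) stands for the half period (x tau + y) / 2 at which the function vanishes;
  the modular group permutes the three nonzero pairs. The pair (False, False) is not used.\<close>

definition half_theta :: "bool \<Rightarrow> bool \<Rightarrow> complex \<Rightarrow> complex \<Rightarrow> complex" where
  "half_theta x y v \<tau> = (if x then if y then theta3 v \<tau> else theta2 v \<tau> else theta1 v \<tau>)"

definition theta_ratio :: "bool \<Rightarrow> bool \<Rightarrow> complex \<Rightarrow> complex \<Rightarrow> complex" where
  "theta_ratio x y v \<tau> = theta' 0 \<tau> / theta v \<tau> * (half_theta x y v \<tau> / half_theta x y 0 \<tau>)"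

text \<open>With a = \<open>evar v\<close>, 2 sin(pi v) = -i e^{i pi v} (1 - 1/a) and 2 cos(pi v) =
  e^{i pi v} (1 + 1/a): the trigonometric factor supplies the missing first factor of the product in
  1/a. For theta2 and theta3 the half period sits in the argument a q^{-1/2} and nothing is
  missing.\<close>

lemma theta_eq_qprod2:
  assumes "\<tau> \<in> upper_half_plane"
  defines "q \<equiv> qpow \<tau> 1"
  shows "theta v \<tau> = - \<i> * qpow \<tau> (1/8) * qpoch q q * exp (\<i> * of_real pi * v) * qprod2 (evar v) q"
    and "theta1 v \<tau> = qpow \<tau> (1/8) * qpoch q q * exp (\<i> * of_real pi * v) * qprod2 (- evar v) q"
    and "theta2 v \<tau> = qpoch q q * qprod2 (evar v * qpow \<tau> (-1/2)) q"
    and "theta3 v \<tau> = qpoch q q * qprod2 (- evar v * qpow \<tau> (-1/2)) q"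
proof -
  have q: "norm q < 1"
    unfolding q_def by (rule norm_qpow_1[OF assms(1)])
  define E where "E = exp (\<i> * of_real pi * v)"
  have E: "E \<noteq> 0" "exp (\<i> * (of_real pi * v)) = E" "exp (- (\<i> * (of_real pi * v))) = inverse E"
    by (simp_all add: E_def exp_minus mult.assoc)
  have e: "evar v = E * E"
    by (simp add: evar_def E_def exp_add[symmetric] algebra_simps)
  have s: "2 * sin (of_real pi * v) = - \<i> * exp (\<i> * of_real pi * v) * (1 - inverse (evar v))"
    unfolding sin_exp_eq e E E_def[symmetric] using E(1) by (simp add: field_simps)
  have c: "2 * cos (of_real pi * v) = exp (\<i> * of_real pi * v) * (1 + inverse (evar v))"
    unfolding cos_exp_eq e E E_def[symmetric] using E(1) by (simp add: field_simps)
  have r: "qpoch (inverse (evar v)) q = (1 - inverse (evar v)) * qpoch (inverse (evar v) * q) q"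
    "qpoch (- inverse (evar v)) q = (1 + inverse (evar v)) * qpoch (- inverse (evar v) * q) q"
    using qpoch_rec[OF q, of "inverse (evar v)"] qpoch_rec[OF q, of "- inverse (evar v)"] by simp_all
  note th = theta_eq_qpoch[OF assms(1), folded q_def]
  have "theta v \<tau> = qpow \<tau> (1/8) * (2 * sin (of_real pi * v)) *
      (qpoch q q * qpoch (evar v * q) q * qpoch (evar (- v) * q) q)"
    unfolding th by simp
  then show "theta v \<tau> = - \<i> * qpow \<tau> (1/8) * qpoch q q * exp (\<i> * of_real pi * v) * qprod2 (evar v) q"
    unfolding s by (simp add: evar_minus qprod2_def r)
  have "theta1 v \<tau> = qpow \<tau> (1/8) * (2 * cos (of_real pi * v)) *
      (qpoch q q * qpoch (- evar v * q) q * qpoch (- evar (- v) * q) q)"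
    unfolding th by simp
  then show "theta1 v \<tau> = qpow \<tau> (1/8) * qpoch q q * exp (\<i> * of_real pi * v) * qprod2 (- evar v) q"
    unfolding c by (simp add: evar_minus qprod2_def r)
  have "qpow \<tau> (-1/2) * q = qpow \<tau> (1/2)" "inverse (qpow \<tau> (-1/2)) = qpow \<tau> (1/2)"
    unfolding q_def qpow_add[symmetric] by (simp_all add: qpow_def exp_minus)
  then show "theta2 v \<tau> = qpoch q q * qprod2 (evar v * qpow \<tau> (-1/2)) q"
    "theta3 v \<tau> = qpoch q q * qprod2 (- evar v * qpow \<tau> (-1/2)) q"
    unfolding th by (simp_all add: evar_minus qprod2_def mult.assoc)
qed

lemma qpoch_nonzero:
  assumes "norm q < 1" "norm a < 1"
  shows "qpoch a q \<noteq> 0"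
proof
  assume "qpoch a q = 0"
  then obtain n where "a * q ^ n = 1"
    using assms(1) by (auto simp: qpoch_eq_0_iff)
  then have "norm a * norm q ^ n = 1"
    by (metis norm_mult norm_power norm_one)
  moreover have "norm a * norm q ^ n \<le> norm a * 1"
    using assms by (intro mult_left_mono power_le_one) auto
  ultimately show False using assms by simp
qed

text \<open>This confines the poles of the quotients to the lattice. The prefactors have no zeros,
  \<open>qprod2\<close> vanishes only when \<open>evar v\<close> is an integral power of q, and the
  logarithm is determined up to an integer.\<close>

lemma theta_zero:
  assumes "\<tau> \<in> upper_half_plane" "theta v \<tau> = 0"
  shows "\<exists>m n::int. v = of_int m + of_int n * \<tau>"
proof -
  let ?q = "qpow \<tau> 1"
  have q: "norm ?q < 1"
    by (rule norm_qpow_1[OF assms(1)])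
  then have "qprod2 (evar v) ?q = 0"
    using assms qpoch_nonzero[OF q q] by (simp add: theta_eq_qprod2)
  then obtain n :: int where "evar v = ?q powi n"
    using qprod2_eq_0[OF q qpow_nonzero evar_nonzero] by metis
  also have "\<dots> = exp (2 * of_real pi * \<i> * (of_int n * \<tau>))"
    by (simp add: qpow_def exp_power_int mult_ac)
  finally obtain m :: int where "2 * of_real pi * \<i> * v = 2 * of_real pi * \<i> * (of_int n * \<tau>) + (of_int (2 * m) * pi) * \<i>"
    unfolding evar_def exp_eq by auto
  then have "2 * of_real pi * \<i> * v = 2 * of_real pi * \<i> * (of_int m + of_int n * \<tau>)"
    by (simp add: algebra_simps)
  then show ?thesis by auto
qed

lemma half_theta_0_nonzero:
  assumes "\<tau> \<in> upper_half_plane"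
  shows "half_theta x y 0 \<tau> \<noteq> 0"
proof -
  have "norm (qpow \<tau> (1/2)) < 1"
    using assms by (simp add: qpow_def upper_half_plane_def norm_exp_eq_Re)
  with norm_qpow_1[OF assms] show ?thesis
    using assms by (simp add: half_theta_def theta_eq_qpoch qpoch_nonzero evar_def)
qed

lemma holomorphic_theta:
  assumes "\<tau> \<in> upper_half_plane"
  shows "(\<lambda>v. theta v \<tau>) holomorphic_on UNIV"
  using norm_qpow_1[OF assms] unfolding theta_eq_qpoch[OF assms] evar_def
  by (intro holomorphic_intros) auto

lemma holomorphic_half_theta:
  assumes "\<tau> \<in> upper_half_plane"
  shows "(\<lambda>v. half_theta x y v \<tau>) holomorphic_on UNIV"
proof -
  have "(\<lambda>v. theta1 v \<tau>) holomorphic_on UNIV" "(\<lambda>v. theta2 v \<tau>) holomorphic_on UNIV"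
    "(\<lambda>v. theta3 v \<tau>) holomorphic_on UNIV"
    using norm_qpow_1[OF assms] unfolding theta_eq_qpoch[OF assms] evar_def
    by (intro holomorphic_intros; simp)+
  then show ?thesis
    by (cases x; cases y) (simp_all add: half_theta_def)
qed

lemma theta_0 [simp]: "theta 0 \<tau> = 0"
  by (simp add: theta_def)

text \<open>Since the sine vanishes at 0, only its derivative contributes and leaves 2 pi q^{1/8}
  (q;q)^3, a product without zeros.\<close>

lemma theta'_0_nonzero:
  assumes "\<tau> \<in> upper_half_plane"
  shows "theta' 0 \<tau> \<noteq> 0"
proof -
  let ?q = "qpow \<tau> 1"
  define g where "g v = qpoch ?q ?q * qpoch (evar v * ?q) ?q * qpoch (evar (- v) * ?q) ?q" for v
  have q: "norm ?q < 1"
    by (rule norm_qpow_1[OF assms])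
  have "g holomorphic_on UNIV"
    using q unfolding g_def evar_def by (intro holomorphic_intros) auto
  then have "(g has_field_derivative deriv g 0) (at 0)"
    by (simp add: holomorphic_derivI)
  then have "((\<lambda>v. 2 * qpow \<tau> (1/8) * sin (of_real pi * v) * g v) has_field_derivative
      2 * qpow \<tau> (1/8) * of_real pi * g 0) (at 0)"
    by (auto intro!: derivative_eq_intros)
  then have "theta' 0 \<tau> = 2 * qpow \<tau> (1/8) * of_real pi * g 0"
    unfolding theta'_def theta_eq_qpoch[OF assms] g_def by (rule DERIV_imp_deriv)
  moreover have "g 0 \<noteq> 0"
    using q by (simp add: g_def qpoch_nonzero evar_def)
  ultimately show ?thesis by simp
qed

section \<open>Periods of the quotients and translation of the modulus\<close>

lemma evar_add: "evar (v + w) = evar v * evar w"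
  by (simp add: evar_def ring_distribs exp_add)

lemma evar_1 [simp]: "evar 1 = 1"
  by (simp add: evar_def exp_eq_1)

lemma theta_ratio_shift_1:
  assumes "\<tau> \<in> upper_half_plane"
  shows "theta_ratio x y (v + 1) \<tau> = (if x then - 1 else 1) * theta_ratio x y v \<tau>"
proof -
  have "exp (\<i> * of_real pi * (v + 1)) = - exp (\<i> * of_real pi * v)"
    by (simp add: ring_distribs exp_add mult.commute[of \<i> "of_real pi"])
  then show ?thesis
    by (simp add: theta_ratio_def half_theta_def theta_eq_qprod2[OF assms] evar_add)
qed

text \<open>All four functions acquire the factor q^{-1/2} e^{-2 pi i v} up to sign: minus for theta
  and theta2, plus for theta1 and theta3. The quotient by theta keeps only a sign, recorded by y.
  The pair (False, False) is excluded because it would denote theta1 with the wrong sign.\<close>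

lemma theta_ratio_shift_tau:
  assumes "\<tau> \<in> upper_half_plane" "x \<or> y"
  shows "theta_ratio x y (v + \<tau>) \<tau> = (if y then - 1 else 1) * theta_ratio x y v \<tau>"
proof -
  let ?q = "qpow \<tau> 1" and ?h = "qpow \<tau> (-1/2)"
  define \<kappa> where "\<kappa> = ?h * inverse (evar v)"
  have q: "norm ?q < 1" "?q \<noteq> 0" and k: "\<kappa> \<noteq> 0"
    using norm_qpow_1[OF assms(1)] by (auto simp: \<kappa>_def)
  have e: "evar (v + \<tau>) = evar v * ?q"
    by (simp add: evar_add) (simp add: evar_def qpow_def)
  have h: "?q * (?h * ?h) = 1"
    unfolding qpow_add[symmetric] by (simp add: qpow_def)
  have x: "exp (\<i> * of_real pi * (v + \<tau>)) = exp (\<i> * of_real pi * v) * (?q * ?h)"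
    unfolding qpow_add[symmetric] by (simp add: qpow_def ring_distribs exp_add[symmetric] mult_ac add_ac)
  have sh: "qprod2 (a * ?q) ?q = - inverse (a * ?q) * qprod2 a ?q" if "a \<noteq> 0" for a
    by (rule qprod2_shift[OF q that])
  have th: "theta (v + \<tau>) \<tau> = - \<kappa> * theta v \<tau>"
    unfolding theta_eq_qprod2[OF assms(1)] e x sh[OF evar_nonzero] \<kappa>_def by (simp add: field_simps)
  have "- evar v * ?q = (- evar v) * ?q" by simp
  then have th1: "theta1 (v + \<tau>) \<tau> = \<kappa> * theta1 v \<tau>"
    unfolding theta_eq_qprod2[OF assms(1)] e x \<kappa>_def using sh[of "- evar v"] by (simp add: field_simps)
  have a: "evar v * ?q * ?h = evar v * ?h * ?q" "- (evar v * ?q) * ?h = (- evar v * ?h) * ?q" by simp_all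
  have i: "inverse (evar v * ?h * ?q) = \<kappa>"
    unfolding \<kappa>_def using h by (simp add: field_simps)
  have th2: "theta2 (v + \<tau>) \<tau> = - \<kappa> * theta2 v \<tau>"
    unfolding theta_eq_qprod2[OF assms(1)] e a using sh[of "evar v * ?h"] i by simp
  have th3: "theta3 (v + \<tau>) \<tau> = \<kappa> * theta3 v \<tau>"
    unfolding theta_eq_qprod2[OF assms(1)] e a using sh[of "- evar v * ?h"] i by simp
  show ?thesis
    using assms(2) k by (auto simp: theta_ratio_def half_theta_def th th1 th2 th3 divide_simps)
qed

text \<open>Translation of tau by 1 fixes q, multiplies q^{1/8} by an eighth root of unity, which
  cancels in the quotients, and negates q^{1/2}, which exchanges theta2 and theta3.\<close>

lemma theta_T:
  assumes "\<tau> \<in> upper_half_plane"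
  defines "\<kappa> \<equiv> exp (\<i> * of_real pi / 4)"
  shows "theta v (\<tau> + 1) = \<kappa> * theta v \<tau>"
    and "half_theta x y v (\<tau> + 1) = (if x then 1 else \<kappa>) * half_theta x (x \<noteq> y) v \<tau>"
proof -
  have "\<tau> + 1 \<in> upper_half_plane"
    using assms(1) by (simp add: upper_half_plane_def)
  note th = theta_eq_qpoch[OF assms(1)] theta_eq_qpoch[OF this]
  have 1: "qpow (\<tau> + 1) 1 = qpow \<tau> 1"
    by (simp add: qpow_def ring_distribs exp_add)
  have 8: "qpow (\<tau> + 1) (1/8) = \<kappa> * qpow \<tau> (1/8)"
    by (simp add: qpow_def \<kappa>_def ring_distribs exp_add[symmetric] add_divide_distrib mult_ac add_ac)
  have 2: "qpow (\<tau> + 1) (1/2) = - qpow \<tau> (1/2)"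
    by (simp add: qpow_def ring_distribs exp_add)
  show "theta v (\<tau> + 1) = \<kappa> * theta v \<tau>"
    unfolding th 1 8 by simp
  show "half_theta x y v (\<tau> + 1) = (if x then 1 else \<kappa>) * half_theta x (x \<noteq> y) v \<tau>"
    unfolding half_theta_def th 1 8 2 by simp
qed

lemma theta_ratio_T:
  assumes "\<tau> \<in> upper_half_plane"
  shows "theta_ratio x y v (\<tau> + 1) = theta_ratio x (x \<noteq> y) v \<tau>"
proof -
  have "theta' 0 (\<tau> + 1) = exp (\<i> * of_real pi / 4) * theta' 0 \<tau>"
    unfolding theta'_def theta_T[OF assms]
    using holomorphic_theta[OF assms]
    by (intro deriv_cmult) (auto intro: holomorphic_on_imp_differentiable_at)
  then show ?thesis
    by (simp add: theta_ratio_def theta_T[OF assms])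
qed

section \<open>A Liouville argument for functions with unimodular multipliers\<close>

lemma norm_int_multiple_periodic:
  fixes g :: "complex \<Rightarrow> complex"
  assumes "\<And>z. norm (g (z + w)) = norm (g z)"
  shows "norm (g (z + of_int n * w)) = norm (g z)"
proof (induction n rule: int_induct[where k = 0])
  case (step1 i)
  then show ?case
    using assms[of "z + of_int i * w"] by (simp add: ring_distribs add_ac)
next
  case (step2 i)
  then show ?case
    using assms[of "z + of_int (i - 1) * w"] by (simp add: ring_distribs add_ac)
qed simp

text \<open>The imaginary part forces n = 0, and then m is an integer of modulus below 1. This
  separates the singularities from each other and gives a disc in which 0 is the only one.\<close>

lemma lattice_small_eq_0:
  assumes \<omega>: "Im \<omega> > 0" and small: "norm (of_int m + of_int n * \<omega>) < min 1 (Im \<omega>)"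
  shows "of_int m + of_int n * \<omega> = 0"
proof -
  let ?z = "of_int m + of_int n * \<omega>"
  have "\<bar>of_int n\<bar> * Im \<omega> = \<bar>Im ?z\<bar>"
    using \<omega> by (simp add: abs_mult)
  also have "\<dots> < 1 * Im \<omega>"
    using abs_Im_le_cmod[of ?z] small by linarith
  finally have n: "n = 0"
    using \<omega> by (simp only: mult_less_cancel_right) linarith
  then have "norm (of_int m :: complex) < 1"
    using small by simp
  then have "m = 0"
    unfolding norm_of_int by linarith
  with n show ?thesis by simp
qed

text \<open>One limit at 0 suffices: the multipliers carry it to every lattice point, so all
  singularities are removable. The functional equations are demanded at all z, also where f only has
  a value assigned by division by 0; \<open>remove_sings\<close> replaces these values, and the
  equations pass to the extension as limits.\<close>

lemma quasi_periodic_eq_0: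
  fixes f :: "complex \<Rightarrow> complex" and \<omega> s1 s2 :: complex
  assumes \<Lambda>_def: "\<Lambda> = {z. \<exists>m n::int. z = of_int m + of_int n * \<omega>}"
    and \<omega>: "Im \<omega> > 0" and f: "f analytic_on - \<Lambda>" "f \<midarrow>0\<rightarrow> c"
    and per: "\<And>z. f (z + 1) = s1 * f z" "\<And>z. f (z + \<omega>) = s2 * f z"
    and s: "norm s1 = 1" "norm s2 = 1" "s1 \<noteq> 1 \<or> s2 \<noteq> 1"
    and z: "z \<notin> \<Lambda>"
  shows "f z = 0"
proof -
  have nz: "s1 \<noteq> 0" "s2 \<noteq> 0" using s by auto
  have f1: "\<exists>s\<noteq>0. \<forall>z. f (z + of_int m) = s * f z" for m :: int
  proof (induction m rule: int_induct[where k = 0])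
    case (step1 i)
    then obtain s where s: "s \<noteq> 0" "\<And>z. f (z + of_int i) = s * f z" by blast
    show ?case
      by (rule exI[of _ "s1 * s"]) (use nz s per(1) in \<open>auto simp: add.assoc[symmetric]\<close>)
  next
    case (step2 i)
    then obtain s where s: "s \<noteq> 0" "\<And>z. f (z + of_int i) = s * f z" by blast
    have "f (z + of_int (i - 1)) = s / s1 * f z" for z
      using s(2)[of z] per(1)[of "z + of_int (i - 1)"] nz by (simp add: field_simps)
    then show ?case
      using nz s(1) by (intro exI[of _ "s / s1"]) auto
  qed (auto intro: exI[of _ 1])
  have f2: "\<exists>s\<noteq>0. \<forall>z. f (z + of_int n * \<omega>) = s * f z" for n :: int
  proof (induction n rule: int_induct[where k = 0])
    case (step1 i)
    then obtain s where s: "s \<noteq> 0" "\<And>z. f (z + of_int i * \<omega>) = s * f z" by blast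
    have "f (z + of_int (i + 1) * \<omega>) = s2 * s * f z" for z
      using s(2)[of z] per(2)[of "z + of_int i * \<omega>"] by (simp add: ring_distribs add_ac)
    then show ?case
      using nz s(1) by (intro exI[of _ "s2 * s"]) auto
  next
    case (step2 i)
    then obtain s where s: "s \<noteq> 0" "\<And>z. f (z + of_int i * \<omega>) = s * f z" by blast
    have "f (z + of_int (i - 1) * \<omega>) = s / s2 * f z" for z
      using s(2)[of z] per(2)[of "z + of_int (i - 1) * \<omega>"] nz by (simp add: field_simps)
    then show ?case
      using nz s(1) by (intro exI[of _ "s / s2"]) auto
  qed (auto intro: exI[of _ 1])
  have lat: "\<exists>c. f \<midarrow>l\<rightarrow> c" if "l \<in> \<Lambda>" for l
  proof -
    obtain m n :: int where l: "l = of_int m + of_int n * \<omega>"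
      using \<open>l \<in> \<Lambda>\<close> by (auto simp: \<Lambda>_def)
    obtain s t where st: "\<And>z. f (z + of_int m) = s * f z" "\<And>z. f (z + of_int n * \<omega>) = t * f z"
      using f1 f2 by metis
    have "f (z + l) = s * t * f z" for z
      using st(1)[of "z + of_int n * \<omega>"] st(2)[of z] by (simp add: l add_ac)
    then have "(\<lambda>z. f (l + z)) \<midarrow>0\<rightarrow> s * t * c"
      using f(2) by (auto intro!: tendsto_intros simp: add.commute)
    then show ?thesis
      by (auto simp: LIM_offset_zero_iff)
  qed
  define r where "r = min 1 (Im \<omega>)"
  have r: "r > 0" using \<omega> by (simp add: r_def)
  have disc: "w \<notin> \<Lambda>" if "l \<in> \<Lambda>" "w \<in> ball l r - {l}" for l w
  proof
    assume "w \<in> \<Lambda>"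
    obtain m n :: int where l: "l = of_int m + of_int n * \<omega>"
      using \<open>l \<in> \<Lambda>\<close> by (auto simp: \<Lambda>_def)
    obtain m' n' :: int where w: "w = of_int m' + of_int n' * \<omega>"
      using \<open>w \<in> \<Lambda>\<close> by (auto simp: \<Lambda>_def)
    have "w - l = of_int (m' - m) + of_int (n' - n) * \<omega>"
      by (simp add: l w algebra_simps)
    moreover have "norm (w - l) < min 1 (Im \<omega>)"
      using that by (simp add: r_def dist_norm norm_minus_commute)
    ultimately have "w - l = 0"
      using lattice_small_eq_0[OF \<omega>] by metis
    with that show False by simp
  qed
  define g where "g = remove_sings f"
  have g: "g analytic_on {w}" for w
  proof (cases "w \<in> \<Lambda>")
    case True
    have "isolated_singularity_at f w"
      unfolding isolated_singularity_at_def
      using r disc[OF True] by (intro exI[of _ r] conjI analytic_on_subset[OF f(1)]) auto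
    then show ?thesis
      using lat[OF True] remove_sings_analytic_at unfolding g_def by blast
  next
    case False
    then show ?thesis
      unfolding g_def by (intro remove_sings_analytic_on analytic_on_subset[OF f(1)]) auto
  qed
  have lim: "f \<midarrow>w\<rightarrow> g w" for w
  proof (cases "w \<in> \<Lambda>")
    case True
    then show ?thesis using lat[OF True] unfolding g_def by (metis remove_sings_eqI)
  next
    case False
    then have "f analytic_on {w}" by (intro analytic_on_subset[OF f(1)]) auto
    then show ?thesis unfolding g_def
      by (simp add: analytic_at_imp_isCont isContD)
  qed
  have gper: "g (w + a) = t * g w" if "\<And>z. f (z + a) = t * f z" for w a t
  proof (rule LIM_unique)
    have "(\<lambda>z. f (z + a)) \<midarrow>(w + a - a)\<rightarrow> g (w + a)"
      using lim by (rule LIM_offset)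
    then show "(\<lambda>z. t * f z) \<midarrow>w\<rightarrow> g (w + a)"
      by (simp add: that)
    show "(\<lambda>z. t * f z) \<midarrow>w\<rightarrow> t * g w"
      by (intro tendsto_intros lim)
  qed
  have hol: "g holomorphic_on UNIV"
    using g analytic_on_analytic_at analytic_imp_holomorphic by blast
  \<comment> \<open>The compact set is a closed period parallelogram; multipliers of modulus 1
    spread its bound over the plane.\<close>
  have "bounded (g ` ((\<lambda>(s, t). of_real s + of_real t * \<omega>) ` ({0..1} \<times> {0..1})))"
    by (intro compact_imp_bounded compact_continuous_image compact_Times compact_Icc
        continuous_on_subset[OF holomorphic_on_imp_continuous_on[OF hol]])
       (auto intro!: continuous_intros simp: case_prod_beta)
  then obtain B where B: "\<And>s t. s \<in> {0..1} \<Longrightarrow> t \<in> {0..1} \<Longrightarrow> norm (g (of_real s + of_real t * \<omega>)) \<le> B"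
    unfolding bounded_iff by force
  have "norm (g w) \<le> B" for w
  proof -
    define t where "t = Im w / Im \<omega>"
    define s where "s = Re (w - of_real t * \<omega>)"
    have w: "w = of_real s + of_real t * \<omega>"
      using \<omega> by (simp add: complex_eq_iff s_def t_def)
    have "w = of_real (frac s) + of_real (frac t) * \<omega> + of_int \<lfloor>s\<rfloor> * 1 + of_int \<lfloor>t\<rfloor> * \<omega>"
      by (subst w) (simp add: frac_def algebra_simps)
    moreover have "norm (g (z + 1)) = norm (g z)" "norm (g (z + \<omega>)) = norm (g z)" for z
      using gper[OF per(1)] gper[OF per(2)] s by (simp_all add: norm_mult)
    ultimately have "norm (g w) = norm (g (of_real (frac s) + of_real (frac t) * \<omega>))"
      by (metis norm_int_multiple_periodic)
    also have "\<dots> \<le> B"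
      by (intro B) (simp_all add: frac_lt_1 less_imp_le)
    finally show ?thesis .
  qed
  then have "bounded (range g)"
    unfolding bounded_iff by blast
  then obtain C where C: "\<And>w. g w = C"
    using Liouville_theorem[OF hol] by (auto simp: constant_on_def)
  have "C = s1 * C" "C = s2 * C"
    using gper[OF per(1), of 0] gper[OF per(2), of 0] by (simp_all add: C)
  then have "C = 0" using s(3) by auto
  moreover have "g z = f z"
    unfolding g_def using z by (intro remove_sings_at_analytic analytic_on_subset[OF f(1)]) auto
  ultimately show ?thesis using C by simp
qed

section \<open>Power series of the quotients and the law under inversion\<close>

definition theta_fps :: "complex \<Rightarrow> complex fps" where
  "theta_fps \<tau> = fps_expansion (\<lambda>v. theta v \<tau>) 0"

definition half_theta_fps :: "bool \<Rightarrow> bool \<Rightarrow> complex \<Rightarrow> complex fps" where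
  "half_theta_fps x y \<tau> = fps_expansion (\<lambda>v. half_theta x y v \<tau>) 0"

text \<open>Series of z F_i(z), formed by an explicit division of the theta series and not as the
  expansion of the quotient, so that holomorphy of its coefficients in tau can be derived from that
  of the theta series.\<close>

definition ratio_fps :: "bool \<Rightarrow> bool \<Rightarrow> complex \<Rightarrow> complex fps" where
  "ratio_fps x y \<tau> = fps_const (theta' 0 \<tau> / half_theta x y 0 \<tau>) * half_theta_fps x y \<tau> *
     inverse (fps_shift 1 (theta_fps \<tau>))"

lemma theta_has_fps_expansion:
  "\<tau> \<in> upper_half_plane \<Longrightarrow> (\<lambda>v. theta v \<tau>) has_fps_expansion theta_fps \<tau>"
  unfolding theta_fps_def by (rule has_fps_expansion_fps_expansion[OF _ _ holomorphic_theta]) auto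

lemma half_theta_has_fps_expansion:
  "\<tau> \<in> upper_half_plane \<Longrightarrow> (\<lambda>v. half_theta x y v \<tau>) has_fps_expansion half_theta_fps x y \<tau>"
  unfolding half_theta_fps_def by (rule has_fps_expansion_fps_expansion[OF _ _ holomorphic_half_theta]) auto

lemma theta_fps_nth:
  assumes "\<tau> \<in> upper_half_plane"
  shows "fps_nth (theta_fps \<tau>) 0 = 0" "fps_nth (theta_fps \<tau>) 1 = theta' 0 \<tau>"
  using fps_nth_fps_expansion[OF theta_has_fps_expansion[OF assms]] by (simp_all add: theta'_def)

lemma half_theta_fps_nth_0:
  assumes "\<tau> \<in> upper_half_plane"
  shows "fps_nth (half_theta_fps x y \<tau>) 0 = half_theta x y 0 \<tau>"
  using fps_nth_fps_expansion[OF half_theta_has_fps_expansion[OF assms], where n = 0] by simp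

lemma ratio_fps_nth_0:
  assumes "\<tau> \<in> upper_half_plane"
  shows "fps_nth (ratio_fps x y \<tau>) 0 = 1"
  using half_theta_0_nonzero[OF assms] theta'_0_nonzero[OF assms] theta_fps_nth[OF assms]
  by (simp add: ratio_fps_def half_theta_fps_nth_0[OF assms])

lemma ratio_has_fps_expansion:
  assumes "\<tau> \<in> upper_half_plane"
  shows "(\<lambda>z. if z = 0 then 1 else z * theta_ratio x y z \<tau>) has_fps_expansion ratio_fps x y \<tau>"
proof -
  have "subdegree (theta_fps \<tau>) \<ge> 1"
    using theta_fps_nth[OF assms] theta'_0_nonzero[OF assms]
    by (intro subdegree_geI) auto
  then have "(\<lambda>z. (theta' 0 \<tau> / half_theta x y 0 \<tau>) * half_theta x y z \<tau> *
      inverse (if z = 0 then theta' 0 \<tau> else theta z \<tau> / z ^ 1)) has_fps_expansion ratio_fps x y \<tau>"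
    unfolding ratio_fps_def using theta_fps_nth[OF assms] theta'_0_nonzero[OF assms]
    by (intro fps_expansion_intros half_theta_has_fps_expansion theta_has_fps_expansion assms) auto
  also have "(\<lambda>z. (theta' 0 \<tau> / half_theta x y 0 \<tau>) * half_theta x y z \<tau> *
      inverse (if z = 0 then theta' 0 \<tau> else theta z \<tau> / z ^ 1)) =
      (\<lambda>z. if z = 0 then 1 else z * theta_ratio x y z \<tau>)"
    using half_theta_0_nonzero[OF assms] theta'_0_nonzero[OF assms]
    by (auto simp: fun_eq_iff theta_ratio_def field_simps)
  finally show ?thesis .
qed

lemma theta_ratio_analytic:
  assumes "\<tau> \<in> upper_half_plane"
  shows "(\<lambda>z. theta_ratio x y z \<tau>) analytic_on {z. theta z \<tau> \<noteq> 0}"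
proof -
  have "(\<lambda>z. theta z \<tau>) analytic_on UNIV" "(\<lambda>z. half_theta x y z \<tau>) analytic_on UNIV"
    using holomorphic_theta[OF assms] holomorphic_half_theta[OF assms]
    by (simp_all add: analytic_on_open)
  then have "(\<lambda>z. theta z \<tau>) analytic_on {z. theta z \<tau> \<noteq> 0}"
    "(\<lambda>z. half_theta x y z \<tau>) analytic_on {z. theta z \<tau> \<noteq> 0}"
    by (auto intro: analytic_on_subset)
  then show ?thesis
    unfolding theta_ratio_def using half_theta_0_nonzero[OF assms]
    by (intro analytic_intros) auto
qed

lemma upper_half_plane_S: "\<tau> \<in> upper_half_plane \<Longrightarrow> - 1 / \<tau> \<in> upper_half_plane"
  by (auto simp: upper_half_plane_def Im_divide complex_eq_iff zero_less_divide_iff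
      intro!: divide_neg_pos sum_power2_gt_zero_iff[THEN iffD2])

text \<open>Both sides have the principal part 1/z at 0, since tau / (tau z) = 1/z. They have the
  same signs under the periods 1 and -1/tau: multiplied by tau these become tau and -1, so the two
  periods change roles, and with them x and y.\<close>

lemma theta_ratio_S:
  assumes \<tau>: "\<tau> \<in> upper_half_plane" and xy: "x \<or> y"
    and z: "\<And>m n::int. z \<noteq> of_int m + of_int n * (- 1 / \<tau>)"
  shows "theta_ratio x y z (- 1 / \<tau>) = \<tau> * theta_ratio y x (\<tau> * z) \<tau>"
proof -
  let ?\<omega> = "- 1 / \<tau>"
  have \<omega>: "?\<omega> \<in> upper_half_plane"
    by (rule upper_half_plane_S[OF \<tau>])
  have \<tau>0: "\<tau> \<noteq> 0"
    using \<tau> by (auto simp: upper_half_plane_def)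
  define f where "f w = theta_ratio x y w ?\<omega> - \<tau> * theta_ratio y x (\<tau> * w) \<tau>" for w
  define \<Lambda> where "\<Lambda> = {z. \<exists>m n::int. z = of_int m + of_int n * ?\<omega>}"
  have nz: "theta w ?\<omega> \<noteq> 0" if "w \<notin> \<Lambda>" for w
    using theta_zero[OF \<omega>] that by (auto simp: \<Lambda>_def)
  have nz': "theta (\<tau> * w) \<tau> \<noteq> 0" if "w \<notin> \<Lambda>" for w
  proof
    assume "theta (\<tau> * w) \<tau> = 0"
    then obtain m n :: int where "\<tau> * w = of_int m + of_int n * \<tau>"
      using theta_zero[OF \<tau>] by blast
    then have "w = of_int n + of_int (- m) * ?\<omega>"
      using \<tau>0 by (simp add: field_simps)
    with that show False unfolding \<Lambda>_def by blast
  qed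
  have "(\<lambda>w. theta_ratio x y w ?\<omega>) analytic_on - \<Lambda>"
    using nz by (intro analytic_on_subset[OF theta_ratio_analytic[OF \<omega>]]) auto
  moreover have "((\<lambda>w. theta_ratio y x w \<tau>) \<circ> (\<lambda>w. \<tau> * w)) analytic_on - \<Lambda>"
    using nz' by (intro analytic_on_compose_gen[OF _ theta_ratio_analytic[OF \<tau>]] analytic_intros) auto
  ultimately have an: "f analytic_on - \<Lambda>"
    unfolding f_def by (intro analytic_intros) (auto simp: o_def)
  define N where "N = (\<lambda>w. (if w = 0 then 1 else w * theta_ratio x y w ?\<omega>) -
    ((\<lambda>w. if w = 0 then 1 else w * theta_ratio y x w \<tau>) \<circ> (\<lambda>w. \<tau> * w)) w)"
  define F where "F = ratio_fps x y ?\<omega> - (ratio_fps y x \<tau> oo (fps_const \<tau> * fps_X))"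
  have "N has_fps_expansion F"
    unfolding N_def F_def
    by (intro fps_expansion_intros ratio_has_fps_expansion \<omega> \<tau>) simp
  moreover have "fps_nth F 0 = 0"
    using ratio_fps_nth_0[OF \<tau>] ratio_fps_nth_0[OF \<omega>] by (simp add: F_def)
  \<comment> \<open>The zero series has subdegree 0 and is therefore a case of its own.\<close>
  then have "F = 0 \<or> subdegree F \<ge> 1"
    by (metis less_one not_le nth_subdegree_nonzero)
  ultimately have "\<exists>c. (\<lambda>w. N w / w) \<midarrow>0\<rightarrow> c"
  proof (elim disjE)
    assume "N has_fps_expansion F" "subdegree F \<ge> 1"
    then have "(\<lambda>w. if w = 0 then fps_nth F 1 else N w / w ^ 1) has_fps_expansion fps_shift 1 F"
      by (intro has_fps_expansion_shift) auto
    from has_fps_expansion_imp_continuous[OF this, of UNIV]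
    have "(\<lambda>w. if w = 0 then fps_nth F 1 else N w / w) \<midarrow>0\<rightarrow> fps_nth F 1"
      by (simp add: isCont_def cong: if_cong)
    then have "(\<lambda>w. N w / w) \<midarrow>0\<rightarrow> fps_nth F 1"
      by (rule Lim_transform_eventually) (auto simp: eventually_at_filter)
    then show ?thesis ..
  next
    assume "N has_fps_expansion F" "F = 0"
    then have "\<forall>\<^sub>F w in nhds 0. N w = 0"
      by (simp add: has_fps_expansion_0_iff)
    then have "\<forall>\<^sub>F w in at 0. 0 = N w / w"
      unfolding eventually_at_filter by (rule eventually_mono) simp
    then have "(\<lambda>w. N w / w) \<midarrow>0\<rightarrow> 0"
      by (rule Lim_transform_eventually[OF tendsto_const])
    then show ?thesis ..
  qed
  then obtain c where "(\<lambda>w. N w / w) \<midarrow>0\<rightarrow> c" by blast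
  moreover have "\<forall>\<^sub>F w in at 0. N w / w = f w"
    using \<tau>0 by (auto simp: eventually_at_filter N_def f_def diff_divide_distrib)
  ultimately have lim: "f \<midarrow>0\<rightarrow> c"
    by (rule Lim_transform_eventually)
  have "f z = 0"
  proof (rule quasi_periodic_eq_0[where f = f and \<omega> = ?\<omega> and ?s1.0 = "if x then - 1 else 1"
        and ?s2.0 = "if y then - 1 else 1", OF \<Lambda>_def])
    fix w
    show "f (w + 1) = (if x then - 1 else 1) * f w"
      using theta_ratio_shift_1[OF \<omega>, of x y w] theta_ratio_shift_tau[OF \<tau>, of y x "\<tau> * w"] xy
      by (auto simp: f_def ring_distribs)
    \<comment> \<open>The period -1/tau becomes translation by -1, so the law for translation by 1
      is applied at the translated point; its sign is its own inverse.\<close>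
    have "theta_ratio y x (\<tau> * w) \<tau> = (if y then - 1 else 1) * theta_ratio y x (\<tau> * w - 1) \<tau>"
      using theta_ratio_shift_1[OF \<tau>, of y x "\<tau> * w - 1"] by simp
    moreover have "\<tau> * (w + ?\<omega>) = \<tau> * w - 1"
      using \<tau>0 by (simp add: field_simps)
    ultimately show "f (w + ?\<omega>) = (if y then - 1 else 1) * f w"
      using theta_ratio_shift_tau[OF \<omega> xy, of w] by (auto simp: f_def ring_distribs)
  qed (use an lim xy z \<omega> in \<open>auto simp: \<Lambda>_def upper_half_plane_def\<close>)
  then show ?thesis by (simp add: f_def)
qed

section \<open>Holomorphic dependence of Taylor coefficients on the modulus\<close>

lemma open_upper_half_plane: "open upper_half_plane"
  unfolding upper_half_plane_def by (rule open_halfspace_Im_gt)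

lemma has_fps_expansion_unique:
  fixes f :: "complex \<Rightarrow> complex"
  assumes "f has_fps_expansion F" "f has_fps_expansion G"
  shows "F = G"
  by (rule fps_ext) (simp add: fps_nth_fps_expansion[OF assms(1)] fps_nth_fps_expansion[OF assms(2)])

text \<open>Formal in z, holomorphic in tau: the property passes through the power series operations
  below because each coefficient of a result is a rational expression in finitely many given
  ones.\<close>

definition hol_coeffs :: "(complex \<Rightarrow> complex fps) \<Rightarrow> bool" where
  "hol_coeffs A \<longleftrightarrow> (\<forall>m. (\<lambda>\<tau>. fps_nth (A \<tau>) m) holomorphic_on upper_half_plane)"

lemma hol_coeffs_cong:
  "(\<And>\<tau>. \<tau> \<in> upper_half_plane \<Longrightarrow> A \<tau> = B \<tau>) \<Longrightarrow> hol_coeffs A = hol_coeffs B"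
  unfolding hol_coeffs_def by (intro iff_allI holomorphic_cong) auto

lemma hol_coeffs_const:
  "f holomorphic_on upper_half_plane \<Longrightarrow> hol_coeffs (\<lambda>\<tau>. fps_const (f \<tau>))"
  unfolding hol_coeffs_def
proof
  fix m show "f holomorphic_on upper_half_plane \<Longrightarrow>
      (\<lambda>\<tau>. fps_nth (fps_const (f \<tau>)) m) holomorphic_on upper_half_plane"
    by (cases m) simp_all
qed

lemma hol_coeffs_constant: "hol_coeffs (\<lambda>_. F)"
  by (auto simp: hol_coeffs_def)

lemma hol_coeffs_diff: "hol_coeffs A \<Longrightarrow> hol_coeffs B \<Longrightarrow> hol_coeffs (\<lambda>\<tau>. A \<tau> - B \<tau>)"
  by (auto simp: hol_coeffs_def intro!: holomorphic_intros)

lemma hol_coeffs_mult: "hol_coeffs A \<Longrightarrow> hol_coeffs B \<Longrightarrow> hol_coeffs (\<lambda>\<tau>. A \<tau> * B \<tau>)"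
  by (auto simp: hol_coeffs_def fps_mult_nth intro!: holomorphic_intros)

lemma hol_coeffs_prod:
  "(\<And>i. i \<in> I \<Longrightarrow> hol_coeffs (A i)) \<Longrightarrow> hol_coeffs (\<lambda>\<tau>. \<Prod>i\<in>I. A i \<tau>)"
  by (induction I rule: infinite_finite_induct) (auto intro: hol_coeffs_constant hol_coeffs_mult)

lemma hol_coeffs_deriv: "hol_coeffs A \<Longrightarrow> hol_coeffs (\<lambda>\<tau>. fps_deriv (A \<tau>))"
  by (auto simp: hol_coeffs_def intro!: holomorphic_intros)

lemma hol_coeffs_shift: "hol_coeffs A \<Longrightarrow> hol_coeffs (\<lambda>\<tau>. fps_shift n (A \<tau>))"
  by (auto simp: hol_coeffs_def)

lemma hol_coeffs_integral0: "hol_coeffs A \<Longrightarrow> hol_coeffs (\<lambda>\<tau>. fps_integral0 (A \<tau>))"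
  unfolding hol_coeffs_def
proof
  fix m
  show "\<forall>m. (\<lambda>\<tau>. fps_nth (A \<tau>) m) holomorphic_on upper_half_plane \<Longrightarrow>
      (\<lambda>\<tau>. fps_nth (fps_integral0 (A \<tau>)) m) holomorphic_on upper_half_plane"
    by (cases m) (auto intro!: holomorphic_intros)
qed

text \<open>Strong induction along the recursion for the coefficients of an inverse series, whose
  only division is by the constant coefficient.\<close>

lemma hol_coeffs_inverse:
  assumes "hol_coeffs A" "\<And>\<tau>. \<tau> \<in> upper_half_plane \<Longrightarrow> fps_nth (A \<tau>) 0 \<noteq> 0"
  shows "hol_coeffs (\<lambda>\<tau>. inverse (A \<tau>))"
  unfolding hol_coeffs_def
proof
  fix m
  show "(\<lambda>\<tau>. fps_nth (inverse (A \<tau>)) m) holomorphic_on upper_half_plane"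
  proof (induction m rule: less_induct)
    case (less m)
    show ?case
    proof (cases m)
      case 0
      then show ?thesis
        using assms by (auto simp: hol_coeffs_def intro!: holomorphic_intros)
    next
      case (Suc k)
      have "fps_nth (inverse (A \<tau>)) m = - inverse (fps_nth (A \<tau>) 0) *
          (\<Sum>i=1..m. fps_nth (A \<tau>) i * fps_nth (inverse (A \<tau>)) (m - i))"
        for \<tau>
        by (simp add: Suc fps_inverse_def del: sum.cl_ivl_Suc)
      moreover have "(\<lambda>\<tau>. - inverse (fps_nth (A \<tau>) 0) *
          (\<Sum>i=1..m. fps_nth (A \<tau>) i * fps_nth (inverse (A \<tau>)) (m - i))) holomorphic_on upper_half_plane"
        using assms less Suc by (intro holomorphic_intros less) (auto simp: hol_coeffs_def)
      ultimately show ?thesis by simp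
    qed
  qed
qed

text \<open>Values on the unit circle control the Taylor coefficients at 0: Cauchy's inequality
  turns uniform convergence on a compact set times the unit disc into uniform convergence of each
  coefficient, and a locally uniform limit of holomorphic functions is holomorphic.\<close>

lemma hol_coeffs_uniform_limit:
  fixes P :: "nat \<Rightarrow> complex \<Rightarrow> complex \<Rightarrow> complex"
  assumes P: "\<And>N \<tau>. \<tau> \<in> upper_half_plane \<Longrightarrow> P N \<tau> holomorphic_on UNIV"
    and K: "\<And>\<tau>. \<tau> \<in> upper_half_plane \<Longrightarrow> K \<tau> holomorphic_on UNIV"
    and hol: "\<And>N. hol_coeffs (\<lambda>\<tau>. fps_expansion (P N \<tau>) 0)"
    and lim: "\<And>C. compact C \<Longrightarrow> C \<subseteq> upper_half_plane \<Longrightarrow>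
      uniform_limit (C \<times> cball 0 1) (\<lambda>N (\<tau>, v). P N \<tau> v) (\<lambda>(\<tau>, v). K \<tau> v) sequentially"
  shows "hol_coeffs (\<lambda>\<tau>. fps_expansion (K \<tau>) 0)"
  unfolding hol_coeffs_def
proof
  fix m
  show "(\<lambda>\<tau>. fps_nth (fps_expansion (K \<tau>) 0) m) holomorphic_on upper_half_plane"
  proof (rule holomorphic_uniform_sequence[OF open_upper_half_plane])
    show "(\<lambda>\<tau>. fps_nth (fps_expansion (P N \<tau>) 0) m) holomorphic_on upper_half_plane" for N
      using hol by (auto simp: hol_coeffs_def)
    fix \<tau>0 assume "\<tau>0 \<in> upper_half_plane"
    then obtain d where d: "d > 0" "cball \<tau>0 d \<subseteq> upper_half_plane"
      using open_upper_half_plane open_contains_cball by metis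
    have "uniform_limit (cball \<tau>0 d) (\<lambda>N \<tau>. fps_nth (fps_expansion (P N \<tau>) 0) m)
        (\<lambda>\<tau>. fps_nth (fps_expansion (K \<tau>) 0) m) sequentially"
    proof (rule uniform_limitI)
      \<comment> \<open>Half of e is requested from the limit, since the Cauchy estimate returns a
        non-strict inequality.\<close>
      fix e :: real assume "e > 0"
      then have "\<forall>\<^sub>F N in sequentially. \<forall>x\<in>cball \<tau>0 d \<times> cball 0 1.
          dist (case x of (\<tau>, v) \<Rightarrow> P N \<tau> v) (case x of (\<tau>, v) \<Rightarrow> K \<tau> v) < e / 2"
        by (intro uniform_limitD[OF lim]) (use d in auto)
      then show "\<forall>\<^sub>F N in sequentially. \<forall>\<tau>\<in>cball \<tau>0 d.
          dist (fps_nth (fps_expansion (P N \<tau>) 0) m) (fps_nth (fps_expansion (K \<tau>) 0) m) < e"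
      proof (rule eventually_mono, intro ballI)
        fix N \<tau>
        assume N: "\<forall>x\<in>cball \<tau>0 d \<times> cball 0 1.
          dist (case x of (\<tau>, v) \<Rightarrow> P N \<tau> v) (case x of (\<tau>, v) \<Rightarrow> K \<tau> v) < e / 2"
          and \<tau>: "\<tau> \<in> cball \<tau>0 d"
        then have \<tau>H: "\<tau> \<in> upper_half_plane" using d by auto
        define D where "D v = P N \<tau> v - K \<tau> v" for v
        have D: "D holomorphic_on UNIV"
          unfolding D_def using P[OF \<tau>H] K[OF \<tau>H] by (intro holomorphic_intros)
        have "D has_fps_expansion fps_expansion (P N \<tau>) 0 - fps_expansion (K \<tau>) 0"
          unfolding D_def using P[OF \<tau>H] K[OF \<tau>H]
          by (intro fps_expansion_intros has_fps_expansion_fps_expansion[where A = UNIV]) auto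
        from fps_nth_fps_expansion[OF this, of m]
        have "fps_nth (fps_expansion (P N \<tau>) 0) m - fps_nth (fps_expansion (K \<tau>) 0) m =
            (deriv ^^ m) D 0 / fact m" by simp
        moreover have "norm ((deriv ^^ m) D 0) \<le> fact m * (e / 2) / 1 ^ m"
        proof (rule Cauchy_inequality)
          show "norm (D v) \<le> e / 2" if "norm (0 - v) = 1" for v
            using N[rule_format, of "(\<tau>, v)"] \<tau> that by (simp add: D_def dist_norm)
        qed (use D in \<open>auto intro: holomorphic_on_subset holomorphic_on_imp_continuous_on\<close>)
        then have "norm ((deriv ^^ m) D 0 / fact m) \<le> e / 2"
          by (simp add: norm_divide field_simps)
        ultimately have "dist (fps_nth (fps_expansion (P N \<tau>) 0) m) (fps_nth (fps_expansion (K \<tau>) 0) m) \<le> e / 2"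
          by (simp only: dist_norm)
        with \<open>e > 0\<close> show "dist (fps_nth (fps_expansion (P N \<tau>) 0) m) (fps_nth (fps_expansion (K \<tau>) 0) m) < e"
          by simp
      qed
    qed
    with d show "\<exists>d>0. cball \<tau>0 d \<subseteq> upper_half_plane \<and>
        uniform_limit (cball \<tau>0 d) (\<lambda>N \<tau>. fps_nth (fps_expansion (P N \<tau>) 0) m)
          (\<lambda>\<tau>. fps_nth (fps_expansion (K \<tau>) 0) m) sequentially"
      by blast
  qed
qed

lemma holomorphic_qpow: "(\<lambda>\<tau>. qpow \<tau> a) holomorphic_on S"
  unfolding qpow_def by (intro holomorphic_intros)

text \<open>The exponent c is a parameter so that one statement covers the factors in e^{2 pi i v}
  and e^{-2 pi i v} and, with c = 0, the factor (q;q), which is free of v.\<close>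

lemma hol_coeffs_qpoch:
  assumes b: "b holomorphic_on upper_half_plane"
  shows "hol_coeffs (\<lambda>\<tau>. fps_expansion (\<lambda>v. qpoch (exp (c * v) * b \<tau>) (qpow \<tau> 1)) 0)"
proof (rule hol_coeffs_uniform_limit[where P = "\<lambda>N \<tau> v. \<Prod>n<N. 1 - exp (c * v) * b \<tau> * qpow \<tau> 1 ^ n"])
  fix N
  have "(\<lambda>v. \<Prod>n<N. 1 - exp (c * v) * b \<tau> * qpow \<tau> 1 ^ n) has_fps_expansion
      (\<Prod>n<N. 1 - fps_exp c * fps_const (b \<tau>) * fps_const (qpow \<tau> 1 ^ n))" for \<tau>
    by (intro fps_expansion_intros)
  moreover have "(\<lambda>v. \<Prod>n<N. 1 - exp (c * v) * b \<tau> * qpow \<tau> 1 ^ n) has_fps_expansion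
      fps_expansion (\<lambda>v. \<Prod>n<N. 1 - exp (c * v) * b \<tau> * qpow \<tau> 1 ^ n) 0" for \<tau>
    by (rule has_fps_expansion_fps_expansion[of UNIV]) (auto intro!: holomorphic_intros)
  ultimately have "fps_expansion (\<lambda>v. \<Prod>n<N. 1 - exp (c * v) * b \<tau> * qpow \<tau> 1 ^ n) 0 =
      (\<Prod>n<N. 1 - fps_exp c * fps_const (b \<tau>) * fps_const (qpow \<tau> 1 ^ n))" for \<tau>
    using has_fps_expansion_unique by blast
  moreover have "hol_coeffs (\<lambda>\<tau>. \<Prod>n<N. 1 - fps_exp c * fps_const (b \<tau>) * fps_const (qpow \<tau> 1 ^ n))"
    by (intro hol_coeffs_prod hol_coeffs_diff hol_coeffs_mult hol_coeffs_constant hol_coeffs_const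
        holomorphic_intros holomorphic_qpow b)
  ultimately show "hol_coeffs (\<lambda>\<tau>. fps_expansion (\<lambda>v. \<Prod>n<N. 1 - exp (c * v) * b \<tau> * qpow \<tau> 1 ^ n) 0)"
    by simp
next
  fix C assume C: "compact C" "C \<subseteq> upper_half_plane"
  have "continuous_on (C \<times> cball 0 1) (\<lambda>x. b (fst x))"
    using C(2) by (intro continuous_on_compose2[OF holomorphic_on_imp_continuous_on[OF b]] continuous_intros) auto
  moreover have "continuous_on (C \<times> cball 0 1) (\<lambda>x. qpow (fst x) 1)"
    unfolding qpow_def by (intro continuous_intros)
  ultimately have "uniform_limit (C \<times> cball 0 1)
      (\<lambda>N x. \<Prod>n<N. 1 - (exp (c * snd x) * b (fst x)) * qpow (fst x) 1 ^ n)
      (\<lambda>x. qpoch (exp (c * snd x) * b (fst x)) (qpow (fst x) 1)) sequentially"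
    using C by (intro uniform_limit_qpoch compact_Times continuous_intros)
      (auto intro!: norm_qpow_1)
  then show "uniform_limit (C \<times> cball 0 1) (\<lambda>N (\<tau>, v). \<Prod>n<N. 1 - exp (c * v) * b \<tau> * qpow \<tau> 1 ^ n)
      (\<lambda>(\<tau>, v). qpoch (exp (c * v) * b \<tau>) (qpow \<tau> 1)) sequentially"
    by (simp add: case_prod_beta')
qed (auto intro!: holomorphic_intros norm_qpow_1)

lemma fps_expansion_qpoch:
  assumes "norm q < 1"
  shows "(\<lambda>v. qpoch (exp (c * v) * b) q) has_fps_expansion fps_expansion (\<lambda>v. qpoch (exp (c * v) * b) q) 0"
  by (rule has_fps_expansion_fps_expansion[of UNIV]) (use assms in \<open>auto intro!: holomorphic_intros\<close>)

text \<open>Common shape of all four theta functions: k is a sine, a cosine or 1, and b is q or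
  q^{1/2} up to sign.\<close>

lemma hol_coeffs_three_qpoch:
  assumes f: "\<And>\<tau> v. \<tau> \<in> upper_half_plane \<Longrightarrow> f \<tau> v = a \<tau> * k v *
      (qpoch (qpow \<tau> 1) (qpow \<tau> 1) * qpoch (evar v * b \<tau>) (qpow \<tau> 1) * qpoch (evar (- v) * b \<tau>) (qpow \<tau> 1))"
    and a: "a holomorphic_on upper_half_plane" and b: "b holomorphic_on upper_half_plane"
    and k: "k has_fps_expansion k'"
  shows "hol_coeffs (\<lambda>\<tau>. fps_expansion (f \<tau>) 0)"
proof -
  define E where "E c b \<tau> = fps_expansion (\<lambda>v. qpoch (exp (c * v) * b) (qpow \<tau> 1)) 0" for c b \<tau>
  define C where "C = 2 * of_real pi * \<i>"
  have "fps_expansion (f \<tau>) 0 = fps_const (a \<tau>) * k' * (E 0 (qpow \<tau> 1) \<tau> * E C (b \<tau>) \<tau> * E (- C) (b \<tau>) \<tau>)"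
    if \<tau>: "\<tau> \<in> upper_half_plane" for \<tau>
  proof -
    have *: "(\<lambda>v. qpoch (exp (c * v) * b) (qpow \<tau> 1)) has_fps_expansion E c b \<tau>" for b c
      unfolding E_def by (rule fps_expansion_qpoch[OF norm_qpow_1[OF \<tau>]])
    have "(\<lambda>v. a \<tau> * k v * (qpoch (exp (0 * v) * qpow \<tau> 1) (qpow \<tau> 1) *
        qpoch (exp (C * v) * b \<tau>) (qpow \<tau> 1) * qpoch (exp (- C * v) * b \<tau>) (qpow \<tau> 1)))
        has_fps_expansion fps_const (a \<tau>) * k' * (E 0 (qpow \<tau> 1) \<tau> * E C (b \<tau>) \<tau> * E (- C) (b \<tau>) \<tau>)"
      by (intro has_fps_expansion_mult has_fps_expansion_const k *)
    also have "(\<lambda>v. a \<tau> * k v * (qpoch (exp (0 * v) * qpow \<tau> 1) (qpow \<tau> 1) *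
        qpoch (exp (C * v) * b \<tau>) (qpow \<tau> 1) * qpoch (exp (- C * v) * b \<tau>) (qpow \<tau> 1))) = f \<tau>"
      by (simp add: f[OF \<tau>] evar_def C_def fun_eq_iff)
    finally have F: "f \<tau> has_fps_expansion
        fps_const (a \<tau>) * k' * (E 0 (qpow \<tau> 1) \<tau> * E C (b \<tau>) \<tau> * E (- C) (b \<tau>) \<tau>)" .
    then have "f \<tau> has_fps_expansion fps_expansion (f \<tau>) 0"
      using has_fps_expansion_imp_holomorphic has_fps_expansion_fps_expansion by metis
    with F show ?thesis by (rule has_fps_expansion_unique[rotated])
  qed
  moreover have "hol_coeffs (\<lambda>\<tau>. fps_const (a \<tau>) * k' *
      (E 0 (qpow \<tau> 1) \<tau> * E C (b \<tau>) \<tau> * E (- C) (b \<tau>) \<tau>))"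
    unfolding E_def
    by (intro hol_coeffs_mult hol_coeffs_const hol_coeffs_constant hol_coeffs_qpoch a b holomorphic_qpow)
  ultimately show ?thesis
    by (simp cong: hol_coeffs_cong)
qed

lemma hol_coeffs_theta_fps: "hol_coeffs theta_fps"
proof -
  have "hol_coeffs (\<lambda>\<tau>. fps_expansion ((\<lambda>\<tau> v. theta v \<tau>) \<tau>) 0)"
    by (rule hol_coeffs_three_qpoch[where a = "\<lambda>\<tau>. 2 * qpow \<tau> (1/8)" and b = "\<lambda>\<tau>. qpow \<tau> 1"])
       (auto simp: theta_eq_qpoch intro!: holomorphic_intros holomorphic_qpow has_fps_expansion_sin)
  then show ?thesis by (simp add: theta_fps_def[abs_def])
qed

lemma hol_coeffs_half_theta_fps: "hol_coeffs (half_theta_fps x y)"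
proof -
  have "hol_coeffs (\<lambda>\<tau>. fps_expansion ((\<lambda>\<tau> v. theta1 v \<tau>) \<tau>) 0)"
    by (rule hol_coeffs_three_qpoch[where a = "\<lambda>\<tau>. 2 * qpow \<tau> (1/8)" and b = "\<lambda>\<tau>. - qpow \<tau> 1"])
       (auto simp: theta_eq_qpoch intro!: holomorphic_intros holomorphic_qpow has_fps_expansion_cos)
  moreover have "hol_coeffs (\<lambda>\<tau>. fps_expansion ((\<lambda>\<tau> v. theta2 v \<tau>) \<tau>) 0)"
    by (rule hol_coeffs_three_qpoch[where a = "\<lambda>\<tau>. 1" and b = "\<lambda>\<tau>. qpow \<tau> (1/2)" and k = "\<lambda>v. 1"])
       (auto simp: theta_eq_qpoch intro!: holomorphic_intros holomorphic_qpow)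
  moreover have "hol_coeffs (\<lambda>\<tau>. fps_expansion ((\<lambda>\<tau> v. theta3 v \<tau>) \<tau>) 0)"
    by (rule hol_coeffs_three_qpoch[where a = "\<lambda>\<tau>. 1" and b = "\<lambda>\<tau>. - qpow \<tau> (1/2)" and k = "\<lambda>v. 1"])
       (auto simp: theta_eq_qpoch intro!: holomorphic_intros holomorphic_qpow)
  ultimately show ?thesis
    by (cases x; cases y) (simp_all add: half_theta_fps_def[abs_def] half_theta_def)
qed

lemma hol_coeffs_ratio_fps: "hol_coeffs (ratio_fps x y)"
proof -
  \<comment> \<open>The normalising constant is itself a quotient of Taylor coefficients, so its
    holomorphy comes from the series already treated.\<close>
  have "(\<lambda>\<tau>. fps_nth (theta_fps \<tau>) 1 / fps_nth (half_theta_fps x y \<tau>) 0) holomorphic_on upper_half_plane"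
    using hol_coeffs_theta_fps hol_coeffs_half_theta_fps
    by (intro holomorphic_intros) (auto simp: hol_coeffs_def half_theta_fps_nth_0 half_theta_0_nonzero)
  then have "(\<lambda>\<tau>. theta' 0 \<tau> / half_theta x y 0 \<tau>) holomorphic_on upper_half_plane"
    by (rule holomorphic_transform) (simp add: half_theta_fps_nth_0 theta_fps_nth[simplified])
  then show ?thesis
    unfolding ratio_fps_def[abs_def]
    by (intro hol_coeffs_mult hol_coeffs_const hol_coeffs_inverse hol_coeffs_shift
        hol_coeffs_theta_fps hol_coeffs_half_theta_fps)
       (use theta_fps_nth(2) theta'_0_nonzero in auto)
qed

section \<open>Taylor series of the characteristic functions\<close>

lemma fps_expansion_eqI:
  fixes f :: "complex \<Rightarrow> complex"
  assumes "f has_fps_expansion F"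
  shows "fps_expansion f 0 = F"
  by (rule fps_ext) (simp add: fps_expansion_def fps_nth_fps_expansion[OF assms])

text \<open>The value of \<open>remove_sings f\<close> at w depends only on a punctured
  neighbourhood of w. Hence f and g, which may differ at 0, have the same extension throughout a
  neighbourhood of 0, and for g, analytic at 0, this extension is g itself.\<close>

lemma remove_sings_has_fps_expansion:
  assumes g: "g has_fps_expansion F" and fg: "eventually (\<lambda>z. f z = g z) (at 0)"
  shows "remove_sings f has_fps_expansion F"
proof -
  obtain S where S: "open S" "0 \<in> S" "\<And>z. z \<in> S \<Longrightarrow> z \<noteq> 0 \<Longrightarrow> f z = g z"
    using fg by (auto simp: eventually_at_topological)
  have "remove_sings f w = remove_sings g w" if "w \<in> S" for w
  proof (rule remove_sings_cong)
    show "\<forall>\<^sub>F z in at w. f z = g z"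
    proof (cases "w = 0")
      case False
      then have "\<forall>\<^sub>F z in nhds w. z \<in> S - {0}"
        using S(1) that by (intro eventually_nhds_in_open) auto
      then show ?thesis
        using S(3) by (auto simp: eventually_at_filter elim: eventually_mono)
    qed (use fg in simp)
  qed simp
  then have "\<forall>\<^sub>F w in nhds 0. remove_sings f w = remove_sings g w"
    using S(1,2) eventually_nhds by blast
  moreover have "\<forall>\<^sub>F w in nhds 0. remove_sings g w = g w"
    by (rule eventually_remove_sings_eq_nhds[OF has_fps_expansion_imp_analytic_0[OF g]])
  ultimately have "\<forall>\<^sub>F w in nhds 0. remove_sings f w = g w"
    by eventually_elim simp
  from has_fps_expansion_cong[OF this refl] g show ?thesis
    by simp
qed

lemma taylor0_eqI:
  assumes "g has_fps_expansion F" "eventually (\<lambda>z. f z = g z) (at 0)"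
  shows "taylor0 f = F"
  unfolding taylor0_def by (rule fps_expansion_eqI[OF remove_sings_has_fps_expansion[OF assms]])

definition dlog_fps :: "complex fps \<Rightarrow> complex fps" where
  "dlog_fps A = fps_deriv A * inverse A"

text \<open>For constant term 1 this is the formal logarithm. As an integral of A'/A it makes both
  the rescaling of z and the dependence on tau follow from the inverse series.\<close>

definition log_fps :: "complex fps \<Rightarrow> complex fps" where
  "log_fps A = fps_integral0 (dlog_fps A)"

text \<open>The two series have the same derivative and vanishing constant terms. Constant term 1 in
  F keeps the values near 0 in the slit plane, where the principal branch is holomorphic.\<close>

lemma taylor0_Ln:
  assumes g: "g has_fps_expansion F" and fg: "eventually (\<lambda>z. f z = g z) (at 0)" and "fps_nth F 0 = 1"
  shows "taylor0 (\<lambda>z. Ln (remove_sings f z)) = log_fps F"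
proof -
  define r where "r = remove_sings f"
  have r: "r has_fps_expansion F"
    unfolding r_def by (rule remove_sings_has_fps_expansion[OF g fg])
  have r0: "r 0 = 1"
    using has_fps_expansion_imp_0_eq_fps_nth_0[OF r] assms by simp
  obtain S where S: "open S" "0 \<in> S" "r holomorphic_on S"
    using has_fps_expansion_imp_holomorphic[OF r] by metis
  define S' where "S' = S \<inter> r -` (- \<real>\<^sub>\<le>\<^sub>0)"
  have S': "open S'"
    unfolding S'_def using S holomorphic_on_imp_continuous_on[OF S(3)]
    by (intro continuous_open_preimage) (auto simp: open_Compl)
  have 0: "0 \<in> S'"
    using S r0 by (simp add: S'_def)
  have hol: "(\<lambda>z. Ln (r z)) holomorphic_on S'"
    by (intro holomorphic_intros holomorphic_on_subset[OF S(3)]) (auto simp: S'_def)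
  define L where "L = fps_expansion (\<lambda>z. Ln (r z)) 0"
  have L: "(\<lambda>z. Ln (r z)) has_fps_expansion L"
    unfolding L_def by (rule has_fps_expansion_fps_expansion[OF S' 0 hol])
  have "deriv (\<lambda>z. Ln (r z)) z = deriv r z * inverse (r z)" if "z \<in> S'" for z
  proof -
    have "(r has_field_derivative deriv r z) (at z)"
      using S that by (intro holomorphic_derivI[of r S]) (auto simp: S'_def)
    then have "((\<lambda>z. Ln (r z)) has_field_derivative deriv r z * inverse (r z)) (at z)"
      using that by (auto intro!: derivative_eq_intros simp: S'_def divide_inverse)
    then show ?thesis by (rule DERIV_imp_deriv)
  qed
  then have "\<forall>\<^sub>F z in nhds 0. deriv (\<lambda>z. Ln (r z)) z = deriv r z * inverse (r z)"
    using S' 0 eventually_nhds by blast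
  note cong = has_fps_expansion_cong[OF this refl]
  have "(\<lambda>z. deriv r z * inverse (r z)) has_fps_expansion dlog_fps F"
    unfolding dlog_fps_def using assms by (intro fps_expansion_intros r) simp
  then have "deriv (\<lambda>z. Ln (r z)) has_fps_expansion dlog_fps F"
    unfolding cong .
  then have "fps_deriv L = dlog_fps F"
    by (rule has_fps_expansion_unique[OF has_fps_expansion_deriv[OF L]])
  moreover have "fps_nth L 0 = 0"
    using has_fps_expansion_imp_0_eq_fps_nth_0[OF L] r0 by simp
  ultimately have "log_fps F = L"
    unfolding log_fps_def using fps_integral0_deriv[of L] by simp
  then show ?thesis
    using taylor0_eqI[OF L] by (simp add: r_def)
qed

definition half_theta' :: "bool \<Rightarrow> bool \<Rightarrow> complex \<Rightarrow> complex \<Rightarrow> complex" where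
  "half_theta' x y v \<tau> = deriv (\<lambda>v. half_theta x y v \<tau>) v"

text \<open>Filling in the value 1 makes z F(z) holomorphic near the origin, where the bare formula
  would give 0.\<close>

definition ratio0 :: "bool \<Rightarrow> bool \<Rightarrow> complex \<Rightarrow> complex \<Rightarrow> complex" where
  "ratio0 x y \<tau> z = (if z = 0 then 1 else z * theta_ratio x y z \<tau>)"

lemma ratio0_has_fps_expansion:
  "\<tau> \<in> upper_half_plane \<Longrightarrow> ratio0 x y \<tau> has_fps_expansion ratio_fps x y \<tau>"
  using ratio_has_fps_expansion unfolding ratio0_def[abs_def] .

lemma ratio0_nonzero:
  assumes "\<tau> \<in> upper_half_plane"
  shows "\<forall>\<^sub>F z in at 0. ratio0 x y \<tau> z \<noteq> 0"
proof -
  have "ratio0 x y \<tau> \<midarrow>0\<rightarrow> ratio0 x y \<tau> 0"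
    using has_fps_expansion_imp_continuous[OF ratio0_has_fps_expansion[OF assms], of UNIV]
    by (simp add: isCont_def)
  then show ?thesis
    by (rule tendsto_imp_eventually_ne) (simp add: ratio0_def)
qed

text \<open>The three summands are, up to sign, the logarithmic derivatives of z, theta and theta_i;
  the normalising constant drops out.\<close>

lemma theta_logderiv:
  assumes \<tau>: "\<tau> \<in> upper_half_plane" and z: "z \<noteq> 0" "theta z \<tau> \<noteq> 0" "half_theta x y z \<tau> \<noteq> 0"
  shows "1 / z - theta' z \<tau> / theta z \<tau> + half_theta' x y z \<tau> / half_theta x y z \<tau> =
    deriv (ratio0 x y \<tau>) z * inverse (ratio0 x y \<tau> z)"
proof -
  let ?c = "theta' 0 \<tau> / half_theta x y 0 \<tau>"
  have "((\<lambda>v. theta v \<tau>) has_field_derivative theta' z \<tau>) (at z)"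
    "((\<lambda>v. half_theta x y v \<tau>) has_field_derivative half_theta' x y z \<tau>) (at z)"
    using holomorphic_theta[OF \<tau>] holomorphic_half_theta[OF \<tau>]
    unfolding theta'_def half_theta'_def by (auto intro: holomorphic_derivI)
  then have "((\<lambda>v. v * half_theta x y v \<tau> / theta v \<tau>) has_field_derivative
      ((half_theta x y z \<tau> + z * half_theta' x y z \<tau>) * theta z \<tau> -
         z * half_theta x y z \<tau> * theta' z \<tau>) / (theta z \<tau> * theta z \<tau>)) (at z)"
    using z by (auto intro!: derivative_eq_intros simp: algebra_simps)
  from DERIV_cmult[OF this, of ?c]
  have "((\<lambda>v. ?c * (v * half_theta x y v \<tau> / theta v \<tau>)) has_field_derivative
      ?c * (((half_theta x y z \<tau> + z * half_theta' x y z \<tau>) * theta z \<tau> -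
         z * half_theta x y z \<tau> * theta' z \<tau>) / (theta z \<tau> * theta z \<tau>))) (at z)" .
  note D = this
  have "\<forall>\<^sub>F v in nhds z. ?c * (v * half_theta x y v \<tau> / theta v \<tau>) = ratio0 x y \<tau> v"
    using eventually_nhds_in_open[of "- {0}" z] z
    by (auto elim!: eventually_mono simp: ratio0_def theta_ratio_def field_simps)
  note D[unfolded DERIV_cong_ev[OF refl this refl]]
  then have "deriv (ratio0 x y \<tau>) z = ?c * (((half_theta x y z \<tau> + z * half_theta' x y z \<tau>) * theta z \<tau> -
         z * half_theta x y z \<tau> * theta' z \<tau>) / (theta z \<tau> * theta z \<tau>))"
    by (rule DERIV_imp_deriv)
  moreover have "ratio0 x y \<tau> z = ?c * (z * half_theta x y z \<tau> / theta z \<tau>)"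
    using z by (simp add: ratio0_def theta_ratio_def mult_ac)
  moreover have "?c \<noteq> 0"
    using theta'_0_nonzero[OF \<tau>] half_theta_0_nonzero[OF \<tau>] by simp
  moreover have "1 / z - t' / t + h' / h = c * (((h + z * h') * t - z * h * t') / (t * t)) * inverse (c * (z * h / t))"
    if "c \<noteq> 0" "t \<noteq> 0" "h \<noteq> 0" for c t t' h h'
    using that z(1) by (simp add: field_simps)
  ultimately show ?thesis
    using z by (simp only: not_False_eq_True)
qed

lemma theta_logderiv_taylor0:
  assumes \<tau>: "\<tau> \<in> upper_half_plane"
  shows "taylor0 (\<lambda>z. 1 / z - theta' z \<tau> / theta z \<tau> + half_theta' x y z \<tau> / half_theta x y z \<tau>) =
    dlog_fps (ratio_fps x y \<tau>)"
proof (rule taylor0_eqI)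
  show "(\<lambda>z. deriv (ratio0 x y \<tau>) z * inverse (ratio0 x y \<tau> z)) has_fps_expansion dlog_fps (ratio_fps x y \<tau>)"
    unfolding dlog_fps_def
    by (intro fps_expansion_intros ratio0_has_fps_expansion \<tau>) (simp add: ratio_fps_nth_0[OF \<tau>])
  show "\<forall>\<^sub>F z in at 0. 1 / z - theta' z \<tau> / theta z \<tau> + half_theta' x y z \<tau> / half_theta x y z \<tau> =
      deriv (ratio0 x y \<tau>) z * inverse (ratio0 x y \<tau> z)"
    using ratio0_nonzero[OF \<tau>, of x y] eventually_neq_at_within[of 0 0 UNIV]
  proof eventually_elim
    case (elim z)
    \<comment> \<open>Since division by 0 gives 0, \<open>ratio0\<close> being nonzero already says
      that neither theta nor the half theta vanishes at z.\<close>
    then show ?case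
      by (intro theta_logderiv \<tau>) (auto simp: ratio0_def theta_ratio_def)
  qed
qed

text \<open>Symmetric in the three quotients: unchanged by tau + 1 and merely rescaled by -1/tau,
  while the single quotients are permuted.\<close>

definition prod_fps :: "complex \<Rightarrow> complex fps" where
  "prod_fps \<tau> = ratio_fps False True \<tau> * ratio_fps True False \<tau> * ratio_fps True True \<tau>"

text \<open>Series of $F_i - F_1 F_2 F_3 / F_i^2$ for A the series of $z F_i$ and P that of $z^3 F_1 F_2 F_3$.\<close>

definition gap_fps :: "complex fps \<Rightarrow> complex fps \<Rightarrow> complex fps" where
  "gap_fps A P = fps_shift 1 (A - P * inverse (A * A))"

text \<open>All three residues are 1, so the simple poles of the two summands cancel: z f(z)
  vanishes at 0 and the shift by 1 divides it by z.\<close>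

lemma gap_taylor0:
  assumes \<tau>: "\<tau> \<in> upper_half_plane"
    and f: "\<And>z. z \<noteq> 0 \<Longrightarrow> theta z \<tau> \<noteq> 0 \<Longrightarrow> half_theta x y z \<tau> \<noteq> 0 \<Longrightarrow> f z = theta_ratio x y z \<tau> -
      theta_ratio False True z \<tau> * theta_ratio True False z \<tau> * theta_ratio True True z \<tau> *
      inverse (theta_ratio x y z \<tau> * theta_ratio x y z \<tau>)"
  shows "taylor0 f = gap_fps (ratio_fps x y \<tau>) (prod_fps \<tau>)"
proof -
  let ?A = "ratio_fps x y \<tau>" and ?P = "prod_fps \<tau>"
  define F where "F = ?A - ?P * inverse (?A * ?A)"
  define N where "N z = ratio0 x y \<tau> z - ratio0 False True \<tau> z * ratio0 True False \<tau> z * ratio0 True True \<tau> z *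
    inverse (ratio0 x y \<tau> z * ratio0 x y \<tau> z)" for z
  have N: "N has_fps_expansion F"
    unfolding N_def F_def prod_fps_def
    by (intro fps_expansion_intros ratio0_has_fps_expansion \<tau>) (simp add: ratio_fps_nth_0[OF \<tau>])
  have "fps_nth F 0 = 0"
    by (simp add: F_def prod_fps_def ratio_fps_nth_0[OF \<tau>])
  have ev: "\<forall>\<^sub>F z in at 0. f z = N z / z"
    using ratio0_nonzero[OF \<tau>, of x y] eventually_neq_at_within[of 0 0 UNIV]
  proof eventually_elim
    case (elim z)
    then have "f z = theta_ratio x y z \<tau> -
      theta_ratio False True z \<tau> * theta_ratio True False z \<tau> * theta_ratio True True z \<tau> *
      inverse (theta_ratio x y z \<tau> * theta_ratio x y z \<tau>)"
      by (intro f) (auto simp: ratio0_def theta_ratio_def)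
    also have "\<dots> = N z / z"
      using elim unfolding N_def ratio0_def by (simp add: field_simps)
    finally show ?case .
  qed
  show ?thesis
  proof (cases "F = 0")
    case True
    then have "\<forall>\<^sub>F z in nhds 0. N z = 0"
      using N by (simp add: has_fps_expansion_0_iff)
    then have "\<forall>\<^sub>F z in at 0. N z = 0"
      unfolding eventually_at_filter by (rule eventually_mono) simp
    with ev have "\<forall>\<^sub>F z in at 0. f z = 0"
      by eventually_elim simp
    then have "taylor0 f = 0"
      by (rule taylor0_eqI[OF has_fps_expansion_0])
    then show ?thesis
      using True unfolding gap_fps_def F_def by simp
  next
    case False
    then have "subdegree F \<ge> 1"
      using \<open>fps_nth F 0 = 0\<close> by (intro subdegree_geI) auto
    then have "(\<lambda>z. if z = 0 then fps_nth F 1 else N z / z ^ 1) has_fps_expansion fps_shift 1 F"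
      by (intro has_fps_expansion_shift N) auto
    moreover have "\<forall>\<^sub>F z in at 0. f z = (if z = 0 then fps_nth F 1 else N z / z ^ 1)"
      using ev eventually_neq_at_within[of 0 0 UNIV] by eventually_elim simp
    ultimately show ?thesis
      unfolding gap_fps_def F_def[symmetric] by (rule taylor0_eqI)
  qed
qed

section \<open>Modular transformations of the Taylor series\<close>

lemma ratio_fps_S:
  assumes \<tau>: "\<tau> \<in> upper_half_plane" and xy: "x \<or> y"
  shows "ratio_fps x y (- 1 / \<tau>) = ratio_fps y x \<tau> oo (fps_const \<tau> * fps_X)"
proof (rule has_fps_expansion_unique)
  let ?\<omega> = "- 1 / \<tau>"
  have \<omega>: "?\<omega> \<in> upper_half_plane"
    by (rule upper_half_plane_S[OF \<tau>])
  have \<tau>0: "\<tau> \<noteq> 0"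
    using \<tau> by (auto simp: upper_half_plane_def)
  show "ratio0 x y ?\<omega> has_fps_expansion ratio_fps x y ?\<omega>"
    by (rule ratio0_has_fps_expansion[OF \<omega>])
  have Im: "Im ?\<omega> > 0"
    using \<omega> by (simp add: upper_half_plane_def)
  \<comment> \<open>In this disc 0 is the only lattice point, so the law for the quotients applies
    away from 0; at 0 both sides are 1 by definition.\<close>
  have "ratio0 x y ?\<omega> z = (ratio0 y x \<tau> \<circ> (\<lambda>z. \<tau> * z)) z" if "norm z < min 1 (Im ?\<omega>)" for z
  proof (cases "z = 0")
    case False
    then have "z \<noteq> of_int m + of_int n * ?\<omega>" for m n
      using lattice_small_eq_0[OF Im, of m n] that by auto
    from theta_ratio_S[OF \<tau> xy this] False \<tau>0 show ?thesis
      by (simp add: ratio0_def)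
  qed (simp add: ratio0_def)
  then have ev: "\<forall>\<^sub>F z in nhds 0. ratio0 x y ?\<omega> z = (ratio0 y x \<tau> \<circ> (\<lambda>z. \<tau> * z)) z"
    using Im by (intro eventually_nhds_metric[THEN iffD2] exI[of _ "min 1 (Im ?\<omega>)"])
      (simp add: dist_norm del: o_apply)
  have "(ratio0 y x \<tau> \<circ> (\<lambda>z. \<tau> * z)) has_fps_expansion (ratio_fps y x \<tau> oo (fps_const \<tau> * fps_X))"
    by (intro fps_expansion_intros ratio0_has_fps_expansion \<tau>) simp
  then show "ratio0 x y ?\<omega> has_fps_expansion (ratio_fps y x \<tau> oo (fps_const \<tau> * fps_X))"
    unfolding has_fps_expansion_cong[OF ev refl] .
qed

lemma ratio_fps_T:
  assumes \<tau>: "\<tau> \<in> upper_half_plane"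
  shows "ratio_fps x y (\<tau> + 1) = ratio_fps x (x \<noteq> y) \<tau>"
proof (rule has_fps_expansion_unique)
  have "\<tau> + 1 \<in> upper_half_plane"
    using \<tau> by (simp add: upper_half_plane_def)
  then show "ratio0 x y (\<tau> + 1) has_fps_expansion ratio_fps x y (\<tau> + 1)"
    by (rule ratio0_has_fps_expansion)
  show "ratio0 x y (\<tau> + 1) has_fps_expansion ratio_fps x (x \<noteq> y) \<tau>"
    using ratio0_has_fps_expansion[OF \<tau>] by (simp only: ratio0_def[abs_def] theta_ratio_T[OF \<tau>])
qed

lemma prod_fps_S:
  assumes "\<tau> \<in> upper_half_plane"
  shows "prod_fps (- 1 / \<tau>) = prod_fps \<tau> oo (fps_const \<tau> * fps_X)"
proof -
  note S = ratio_fps_S[OF assms, OF disjI1[OF TrueI], of False] ratio_fps_S[OF assms, OF disjI1[OF TrueI], of True]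
    ratio_fps_S[OF assms, OF disjI2[OF TrueI], of False]
  show ?thesis
    unfolding prod_fps_def S by (simp add: fps_compose_mult_distrib)
qed

lemma prod_fps_T: "\<tau> \<in> upper_half_plane \<Longrightarrow> prod_fps (\<tau> + 1) = prod_fps \<tau>"
  by (simp add: prod_fps_def ratio_fps_T mult_ac)

text \<open>The factor c is the inner derivative; it becomes one of the two factors tau not counted
  by degree.\<close>

lemma dlog_fps_scale:
  assumes "fps_nth A 0 \<noteq> 0"
  shows "dlog_fps (A oo (fps_const c * fps_X)) = fps_const c * (dlog_fps A oo (fps_const c * fps_X))"
  using assms by (simp add: dlog_fps_def fps_compose_deriv fps_compose_mult_distrib fps_inverse_compose mult_ac)

text \<open>Here the inner derivative is undone by the integration, so the factor det^{1/2}
  contributes to the weight only through its degree.\<close>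

lemma log_fps_scale:
  assumes "fps_nth A 0 \<noteq> 0"
  shows "log_fps (A oo (fps_const c * fps_X)) = log_fps A oo (fps_const c * fps_X)"
proof (rule fps_ext)
  fix n
  show "fps_nth (log_fps (A oo (fps_const c * fps_X))) n = fps_nth (log_fps A oo (fps_const c * fps_X)) n"
    by (cases n) (simp_all add: log_fps_def dlog_fps_scale[OF assms])
qed

text \<open>The factor c arises because the numerator is evaluated at c z but divided by z; it
  becomes the second factor tau not counted by degree.\<close>

lemma gap_fps_scale:
  assumes "fps_nth A 0 \<noteq> 0"
  shows "gap_fps (A oo (fps_const c * fps_X)) (P oo (fps_const c * fps_X)) =
    fps_const c * (gap_fps A P oo (fps_const c * fps_X))"
proof -
  have "(A oo (fps_const c * fps_X)) - (P oo (fps_const c * fps_X)) *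
      inverse ((A oo (fps_const c * fps_X)) * (A oo (fps_const c * fps_X))) =
      (A - P * inverse (A * A)) oo (fps_const c * fps_X)"
    using assms by (simp add: fps_compose_sub_distrib fps_compose_mult_distrib fps_inverse_compose)
  then show ?thesis
    unfolding gap_fps_def by (intro fps_ext) (simp del: fps_inverse_mult)
qed

lemma hol_coeffs_dlog:
  assumes "hol_coeffs A" "\<And>\<tau>. \<tau> \<in> upper_half_plane \<Longrightarrow> fps_nth (A \<tau>) 0 = 1"
  shows "hol_coeffs (\<lambda>\<tau>. dlog_fps (A \<tau>))"
  unfolding dlog_fps_def using assms
  by (intro hol_coeffs_mult hol_coeffs_deriv hol_coeffs_inverse) auto

lemma hol_coeffs_log:
  assumes "hol_coeffs A" "\<And>\<tau>. \<tau> \<in> upper_half_plane \<Longrightarrow> fps_nth (A \<tau>) 0 = 1"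
  shows "hol_coeffs (\<lambda>\<tau>. log_fps (A \<tau>))"
  unfolding log_fps_def by (intro hol_coeffs_integral0 hol_coeffs_dlog assms)

lemma hol_coeffs_gap:
  assumes "hol_coeffs A" "hol_coeffs P" "\<And>\<tau>. \<tau> \<in> upper_half_plane \<Longrightarrow> fps_nth (A \<tau>) 0 = 1"
  shows "hol_coeffs (\<lambda>\<tau>. gap_fps (A \<tau>) (P \<tau>))"
  unfolding gap_fps_def using assms
  by (intro hol_coeffs_shift hol_coeffs_diff hol_coeffs_mult hol_coeffs_inverse) auto

lemma hol_coeffs_prod_fps: "hol_coeffs prod_fps"
  unfolding prod_fps_def[abs_def] by (intro hol_coeffs_mult hol_coeffs_ratio_fps)

section \<open>Grading of the exterior algebra\<close>

lemma ext_coeff_simps [simp]: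
  "ext_coeff 0 I = 0"
  "ext_coeff (x + y) I = ext_coeff x I + ext_coeff y I"
  "ext_coeff (x - y) I = ext_coeff x I - ext_coeff y I"
  "ext_coeff (c *\<^sub>C x) I = c * ext_coeff x I"
  by (transfer; simp)+

lemma ext_coeff_sum [simp]: "ext_coeff (\<Sum>i\<in>A. f i) I = (\<Sum>i\<in>A. ext_coeff (f i) I)"
  by (induction A rule: infinite_finite_induct) simp_all

lemma ext_coeff_mult:
  "ext_coeff (x * y) K = (\<Sum>I\<in>Pow K. (-1) ^ inversions I (K - I) * ext_coeff x I * ext_coeff y (K - I))"
  by transfer simp

lemma cscale_cscale [simp]: "a *\<^sub>C b *\<^sub>C x = (a * b) *\<^sub>C x"
  by (rule ext_eqI) simp

lemma cscale_one [simp]: "1 *\<^sub>C x = x"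
  by (rule ext_eqI) simp

lemma cscale_sum_right: "a *\<^sub>C (\<Sum>i\<in>A. f i) = (\<Sum>i\<in>A. a *\<^sub>C f i)"
  by (rule ext_eqI) (simp add: sum_distrib_left)

lemma mult_cscale_left [simp]: "(a *\<^sub>C x) * y = a *\<^sub>C (x * y)"
  by (rule ext_eqI) (simp add: ext_coeff_mult sum_distrib_left algebra_simps)

lemma mult_cscale_right [simp]: "x * (a *\<^sub>C y) = a *\<^sub>C (x * y)"
  by (rule ext_eqI) (simp add: ext_coeff_mult sum_distrib_left algebra_simps)

lift_definition grade_scale :: "complex \<Rightarrow> 'n ext \<Rightarrow> 'n ext" is
  "\<lambda>l x I. l ^ card I * x I" .

lemma ext_coeff_grade_scale [simp]: "ext_coeff (grade_scale l x) I = l ^ card I * ext_coeff x I"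
  by transfer simp

lemma grade_scale_sum: "grade_scale l (\<Sum>i\<in>A. f i) = (\<Sum>i\<in>A. grade_scale l (f i))"
  by (rule ext_eqI) (simp add: sum_distrib_left)

lemma grade_scale_cscale: "grade_scale l (c *\<^sub>C x) = c *\<^sub>C grade_scale l x"
  by (rule ext_eqI) simp

lemma grade_scale_0 [simp]: "grade_scale l 0 = 0"
  by (rule ext_eqI) simp

lemma grade_scale_1 [simp]: "grade_scale l 1 = 1"
  by (rule ext_eqI) (transfer, simp)

text \<open>In the coefficient at K only pairs I, K - I occur, whose cardinalities add up to that of
  K.\<close>

lemma grade_scale_mult:
  fixes x y :: "'n::{finite,linorder} ext"
  shows "grade_scale l (x * y) = grade_scale l x * grade_scale l y"
proof (rule ext_eqI)
  fix K :: "'n set"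
  have "l ^ card K = l ^ card I * l ^ card (K - I)" if "I \<in> Pow K" for I
    using that by (simp add: power_add[symmetric] card_Diff_subset card_mono)
  then have "l ^ card K * ((-1) ^ inversions I (K - I) * ext_coeff x I * ext_coeff y (K - I)) =
      (-1) ^ inversions I (K - I) * (l ^ card I * ext_coeff x I) * (l ^ card (K - I) * ext_coeff y (K - I))"
    if "I \<in> Pow K" for I
    using that by (simp only: mult_ac)
  then show "ext_coeff (grade_scale l (x * y)) K = ext_coeff (grade_scale l x * grade_scale l y) K"
    unfolding ext_coeff_grade_scale ext_coeff_mult sum_distrib_left by (intro sum.cong refl)
qed

lemma grade_scale_dx: "grade_scale l (dx i) = l *\<^sub>C dx i"
  by (rule ext_eqI) (transfer, simp)

lemma grade_scale_one_form: "grade_scale l (one_form w) = l *\<^sub>C one_form w"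
  by (simp add: one_form_def grade_scale_sum cscale_sum_right grade_scale_cscale grade_scale_dx mult.commute)

lemma grade_scale_two_form: "grade_scale l (two_form w) = l\<^sup>2 *\<^sub>C two_form w"
  by (simp add: two_form_def grade_scale_sum cscale_sum_right grade_scale_cscale grade_scale_dx
      grade_scale_mult power2_eq_square mult_ac)

lemma grade_scale_power:
  fixes x :: "'n::{finite,linorder} ext"
  assumes "grade_scale l x = c *\<^sub>C x"
  shows "grade_scale l (x ^ m) = c ^ m *\<^sub>C x ^ m"
  by (induction m) (simp_all add: grade_scale_mult assms mult_ac)

lemma grade_scale_ext_series:
  fixes x :: "'n::{finite,linorder} ext"
  shows "grade_scale l (ext_series F x) = ext_series F (grade_scale l x)"
proof -
  have "grade_scale l (x ^ m) = grade_scale l x ^ m" for m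
    by (induction m) (simp_all add: grade_scale_mult)
  then show ?thesis
    by (simp add: ext_series_def grade_scale_sum grade_scale_cscale)
qed

text \<open>On x^m both the rescaled variable and the endomorphism act by c^m. This trades a
  substitution in the series for a scaling by degree.\<close>

lemma ext_series_compose:
  fixes x :: "'n::{finite,linorder} ext"
  assumes "grade_scale l x = c *\<^sub>C x"
  shows "ext_series (F oo (fps_const c * fps_X)) x = grade_scale l (ext_series F x)"
  by (simp add: ext_series_def grade_scale_sum grade_scale_cscale grade_scale_power[OF assms] mult.commute[of "c ^ _"])

lemma ext_series_cmult: "ext_series (fps_const c * F) x = c *\<^sub>C ext_series F x"
  by (simp add: ext_series_def cscale_sum_right)

lemma mat_pow_Suc: "mat_pow Z (Suc m) = Z ** mat_pow Z m"
  by (simp add: mat_pow_def)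

lemma grade_scale_mat_pow:
  fixes Z :: "'n::{finite,linorder} ext^'r^'r"
  assumes "\<And>i j. grade_scale l (Z $ i $ j) = c *\<^sub>C (Z $ i $ j)"
  shows "grade_scale l (mat_pow Z m $ i $ j) = c ^ m *\<^sub>C (mat_pow Z m $ i $ j)"
proof (induction m arbitrary: i j)
  case 0
  then show ?case by (simp add: mat_pow_def mat_def)
next
  case (Suc m)
  then show ?case
    by (simp add: mat_pow_Suc matrix_matrix_mult_def grade_scale_sum grade_scale_mult assms
        cscale_sum_right mult_ac)
qed

lemma mat_series_compose:
  fixes Z :: "'n::{finite,linorder} ext^'r^'r"
  assumes "\<And>i j. grade_scale l (Z $ i $ j) = c *\<^sub>C (Z $ i $ j)"
  shows "mat_series (F oo (fps_const c * fps_X)) Z $ i $ j = grade_scale l (mat_series F Z $ i $ j)"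
  by (simp add: mat_series_def grade_scale_sum grade_scale_cscale grade_scale_mat_pow[OF assms] mult.commute[of "c ^ _"])

lemma mat_series_cmult: "mat_series (fps_const c * F) Z $ i $ j = c *\<^sub>C (mat_series F Z $ i $ j)"
  by (simp add: mat_series_def cscale_sum_right)

lemma trace_mult:
  fixes D M :: "'a::semiring_1^'r^'r"
  shows "trace (D ** M) = (\<Sum>i\<in>UNIV. \<Sum>k\<in>UNIV. D $ i $ k * M $ k $ i)"
  by (simp add: trace_def matrix_matrix_mult_def)

text \<open>Integrand common to the three transgressed forms, up to a constant: A is the series of z
  F_i, P that of z^3 F_1 F_2 F_3, Z the scaled curvature, D the difference of the
  connections.\<close>

definition transgression_term ::
    "complex fps \<Rightarrow> complex fps \<Rightarrow> 'n::{finite,linorder} ext^'r^'r \<Rightarrow> 'n ext \<Rightarrow> 'n ext^'r^'r \<Rightarrow> 'n ext" where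
  "transgression_term A P Z u D =
     ext_series (fps_exp 1) ((1/2) *\<^sub>C trace (mat_series (log_fps A) Z)) * ext_series (gap_fps A P) u *
     trace (D ** mat_series (dlog_fps A) Z)"

text \<open>\<open>gap_fps\<close> and \<open>dlog_fps\<close> give l^2 each, together l^4. D has
  degree 1 but no variable in it is rescaled, so the endomorphism produces one l too many; it is
  balanced by the l on the left in place of a division.\<close>

lemma transgression_term_scale:
  assumes Z: "\<And>i j. grade_scale l (Z $ i $ j) = l\<^sup>2 *\<^sub>C (Z $ i $ j)"
    and u: "grade_scale l u = l\<^sup>2 *\<^sub>C u"
    and D: "\<And>i j. grade_scale l (D $ i $ j) = l *\<^sub>C (D $ i $ j)"
    and A: "fps_nth A 0 \<noteq> 0"
  shows "l *\<^sub>C transgression_term (A oo (fps_const (l\<^sup>2) * fps_X)) (P oo (fps_const (l\<^sup>2) * fps_X)) Z u D =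
    l ^ 4 *\<^sub>C grade_scale l (transgression_term A P Z u D)"
proof -
  let ?s = "fps_const (l\<^sup>2) * fps_X"
  have "trace (mat_series (log_fps (A oo ?s)) Z) = grade_scale l (trace (mat_series (log_fps A) Z))"
    by (simp add: log_fps_scale[OF A] trace_def mat_series_compose[OF Z] grade_scale_sum)
  then have 1: "ext_series (fps_exp 1) ((1/2) *\<^sub>C trace (mat_series (log_fps (A oo ?s)) Z)) =
      grade_scale l (ext_series (fps_exp 1) ((1/2) *\<^sub>C trace (mat_series (log_fps A) Z)))"
    by (simp add: grade_scale_ext_series grade_scale_cscale)
  have 2: "ext_series (gap_fps (A oo ?s) (P oo ?s)) u = l\<^sup>2 *\<^sub>C grade_scale l (ext_series (gap_fps A P) u)"
    by (simp add: gap_fps_scale[OF A] ext_series_cmult ext_series_compose[OF u])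
  have 3: "l *\<^sub>C trace (D ** mat_series (dlog_fps (A oo ?s)) Z) =
      l\<^sup>2 *\<^sub>C grade_scale l (trace (D ** mat_series (dlog_fps A) Z))"
    by (simp add: dlog_fps_scale[OF A] trace_mult mat_series_cmult mat_series_compose[OF Z]
        grade_scale_sum grade_scale_mult D cscale_sum_right mult.commute[of l])
  have "l *\<^sub>C transgression_term (A oo ?s) (P oo ?s) Z u D =
      ext_series (fps_exp 1) ((1/2) *\<^sub>C trace (mat_series (log_fps (A oo ?s)) Z)) *
      ext_series (gap_fps (A oo ?s) (P oo ?s)) u *
      (l *\<^sub>C trace (D ** mat_series (dlog_fps (A oo ?s)) Z))"
    by (simp add: transgression_term_def)
  also have "\<dots> = l ^ 4 *\<^sub>C grade_scale l (transgression_term A P Z u D)"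
    unfolding 1 2 3 by (simp add: transgression_term_def grade_scale_mult power_add[symmetric])
  finally show ?thesis .
qed

section \<open>Dependence on the path parameter\<close>

text \<open>Curvature entries along the path of connections are only shown to agree with continuous functions off a
  finite set; this saves a proof that the Lie bracket of smooth fields is smooth.\<close>

definition ess_continuous :: "(real \<Rightarrow> complex) \<Rightarrow> bool" where
  "ess_continuous c \<longleftrightarrow> (\<exists>g N. finite N \<and> continuous_on {0..1} g \<and> (\<forall>t\<in>{0..1} - N. c t = g t))"

lemma ess_continuousI: "continuous_on {0..1} g \<Longrightarrow> finite N \<Longrightarrow> (\<And>t. t \<notin> N \<Longrightarrow> c t = g t) \<Longrightarrow> ess_continuous c"
  unfolding ess_continuous_def by blast

lemma ess_continuous_const: "ess_continuous (\<lambda>_. c)"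
  by (rule ess_continuousI[of "\<lambda>_. c" "{}"]) auto

lemma ess_continuous_add:
  assumes "ess_continuous c" "ess_continuous d"
  shows "ess_continuous (\<lambda>t. c t + d t)"
proof -
  obtain g N where "finite N" "continuous_on {0..1} g" "\<forall>t\<in>{0..1} - N. c t = g t"
    using assms(1) by (auto simp: ess_continuous_def)
  moreover obtain g' N' where "finite N'" "continuous_on {0..1} g'" "\<forall>t\<in>{0..1} - N'. d t = g' t"
    using assms(2) by (auto simp: ess_continuous_def)
  ultimately show ?thesis
    unfolding ess_continuous_def
    by (intro exI[of _ "\<lambda>t. g t + g' t"] exI[of _ "N \<union> N'"]) (auto intro!: continuous_intros)
qed

lemma ess_continuous_mult:
  assumes "ess_continuous c" "ess_continuous d"
  shows "ess_continuous (\<lambda>t. c t * d t)"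
proof -
  obtain g N where "finite N" "continuous_on {0..1} g" "\<forall>t\<in>{0..1} - N. c t = g t"
    using assms(1) by (auto simp: ess_continuous_def)
  moreover obtain g' N' where "finite N'" "continuous_on {0..1} g'" "\<forall>t\<in>{0..1} - N'. d t = g' t"
    using assms(2) by (auto simp: ess_continuous_def)
  ultimately show ?thesis
    unfolding ess_continuous_def
    by (intro exI[of _ "\<lambda>t. g t * g' t"] exI[of _ "N \<union> N'"]) (auto intro!: continuous_intros)
qed

lemma ess_continuous_sum: "(\<And>i. i \<in> A \<Longrightarrow> ess_continuous (c i)) \<Longrightarrow> ess_continuous (\<lambda>t. \<Sum>i\<in>A. c i t)"
  by (induction A rule: infinite_finite_induct) (simp_all add: ess_continuous_const ess_continuous_add)

lemma ess_continuous_integrable: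
  assumes "ess_continuous c"
  shows "c integrable_on {0..1}"
proof -
  obtain g N where gN: "finite N" "continuous_on {0..1} g" "\<forall>t\<in>{0..1} - N. c t = g t"
    using assms by (auto simp: ess_continuous_def)
  show ?thesis
    by (rule integrable_spike_finite[OF gN(1) _ integrable_continuous_real[OF gN(2)]]) (use gN(3) in auto)
qed

text \<open>Finite sums of products a(tau) c(t). Their integral over t is a finite linear
  combination of the functions a, so holomorphy requires no differentiation under the integral
  sign.\<close>

inductive separable :: "(complex \<Rightarrow> real \<Rightarrow> complex) \<Rightarrow> bool" where
  separable_prod: "a holomorphic_on upper_half_plane \<Longrightarrow> ess_continuous c \<Longrightarrow> separable (\<lambda>\<tau> t. a \<tau> * c t)"
| separable_add: "separable f \<Longrightarrow> separable g \<Longrightarrow> separable (\<lambda>\<tau> t. f \<tau> t + g \<tau> t)"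

lemma separable_nice: "ess_continuous c \<Longrightarrow> separable (\<lambda>\<tau>. c)"
  using separable_prod[of "\<lambda>_. 1" c] by simp

lemma separable_hol: "a holomorphic_on upper_half_plane \<Longrightarrow> separable (\<lambda>\<tau> t. a \<tau>)"
  using separable_prod[of a "\<lambda>_. 1"] by (simp add: ess_continuous_const)

lemma separable_mult:
  assumes "separable f" "separable g"
  shows "separable (\<lambda>\<tau> t. f \<tau> t * g \<tau> t)"
  using assms
proof (induction f rule: separable.induct)
  case (separable_prod a c)
  from separable_prod(3) separable_prod(1,2) show ?case
  proof (induction g rule: separable.induct)
    case (separable_prod b d)
    then have "separable (\<lambda>\<tau> t. (a \<tau> * b \<tau>) * (c t * d t))"
      by (intro separable.separable_prod holomorphic_intros ess_continuous_mult)
    then show ?case by (simp add: mult_ac)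
  next
    case (separable_add f g)
    then show ?case
      by (simp add: ring_distribs separable.separable_add)
  qed
next
  case (separable_add f g)
  then show ?case by (simp add: ring_distribs separable.separable_add)
qed

lemma separable_sum: "(\<And>i. i \<in> A \<Longrightarrow> separable (f i)) \<Longrightarrow> separable (\<lambda>\<tau> t. \<Sum>i\<in>A. f i \<tau> t)"
  by (induction A rule: infinite_finite_induct)
     (simp_all add: separable_nice ess_continuous_const separable_add)

lemma separable_integral:
  assumes "separable f"
  shows "(\<forall>\<tau>. f \<tau> integrable_on {0..1}) \<and> (\<lambda>\<tau>. integral {0..1} (f \<tau>)) holomorphic_on upper_half_plane"
  using assms
proof induction
  case (separable_prod a c)
  then have "c integrable_on {0..1}" by (rule_tac ess_continuous_integrable)
  with separable_prod show ?case
    by (auto intro!: holomorphic_intros integrable_on_mult_right)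
next
  case (separable_add f g)
  then show ?case
    by (auto simp: integral_add intro!: holomorphic_intros integrable_add)
qed

definition ext_separable :: "(complex \<Rightarrow> real \<Rightarrow> 'n ext) \<Rightarrow> bool" where
  "ext_separable X \<longleftrightarrow> (\<forall>I. separable (\<lambda>\<tau> t. ext_coeff (X \<tau> t) I))"

lemma ext_separable_const: "ext_separable (\<lambda>\<tau> t. x)"
  by (simp add: ext_separable_def separable_nice ess_continuous_const)

lemma ext_separable_mult:
  fixes X Y :: "complex \<Rightarrow> real \<Rightarrow> 'n::{finite,linorder} ext"
  assumes "ext_separable X" "ext_separable Y"
  shows "ext_separable (\<lambda>\<tau> t. X \<tau> t * Y \<tau> t)"
  using assms unfolding ext_separable_def
  by (auto simp: ext_coeff_mult intro!: separable_sum separable_mult separable_nice[OF ess_continuous_const])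

lemma ext_separable_cscale:
  assumes "a holomorphic_on upper_half_plane" "ext_separable X"
  shows "ext_separable (\<lambda>\<tau> t. a \<tau> *\<^sub>C X \<tau> t)"
  using assms unfolding ext_separable_def
  by (auto intro!: separable_mult separable_hol)

lemma ext_separable_sum:
  "(\<And>i. i \<in> A \<Longrightarrow> ext_separable (X i)) \<Longrightarrow> ext_separable (\<lambda>\<tau> t. \<Sum>i\<in>A. X i \<tau> t)"
  unfolding ext_separable_def by (auto intro!: separable_sum)

lemma ext_separable_power:
  fixes X :: "complex \<Rightarrow> real \<Rightarrow> 'n::{finite,linorder} ext"
  assumes "ext_separable X"
  shows "ext_separable (\<lambda>\<tau> t. X \<tau> t ^ m)"
  by (induction m) (simp_all add: ext_separable_const ext_separable_mult assms)

lemma ext_separable_series: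
  assumes "hol_coeffs F" "ext_separable X"
  shows "ext_separable (\<lambda>\<tau> t. ext_series (F \<tau>) (X \<tau> t))"
  unfolding ext_series_def using assms
  by (intro ext_separable_sum ext_separable_cscale ext_separable_power) (auto simp: hol_coeffs_def)

lemma ext_separable_mat_pow:
  fixes Z :: "complex \<Rightarrow> real \<Rightarrow> 'n::{finite,linorder} ext^'r^'r"
  assumes "\<And>i j. ext_separable (\<lambda>\<tau> t. Z \<tau> t $ i $ j)"
  shows "ext_separable (\<lambda>\<tau> t. mat_pow (Z \<tau> t) m $ i $ j)"
proof (induction m arbitrary: i j)
  case 0
  then show ?case by (simp add: mat_pow_def ext_separable_const)
next
  case (Suc m)
  then show ?case
    by (auto simp: mat_pow_Suc matrix_matrix_mult_def intro!: ext_separable_sum ext_separable_mult assms)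
qed

lemma ext_separable_mat_series:
  fixes Z :: "complex \<Rightarrow> real \<Rightarrow> 'n::{finite,linorder} ext^'r^'r"
  assumes "hol_coeffs F" "\<And>i j. ext_separable (\<lambda>\<tau> t. Z \<tau> t $ i $ j)"
  shows "ext_separable (\<lambda>\<tau> t. mat_series (F \<tau>) (Z \<tau> t) $ i $ j)"
  unfolding mat_series_def using assms
  by (auto intro!: ext_separable_sum ext_separable_cscale ext_separable_mat_pow simp: hol_coeffs_def)

text \<open>The two parameters enter through different ingredients: the series carry tau, the
  curvature carries t. Truncated series combine them by finitely many sums and products.\<close>

lemma ext_separable_transgression_term:
  assumes A: "hol_coeffs A" "\<And>\<tau>. \<tau> \<in> upper_half_plane \<Longrightarrow> fps_nth (A \<tau>) 0 = 1"
    and P: "hol_coeffs P" and Z: "\<And>i j. ext_separable (\<lambda>\<tau> t. Z t $ i $ j)"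
  shows "ext_separable (\<lambda>\<tau> t. transgression_term (A \<tau>) (P \<tau>) (Z t) u D)"
  unfolding transgression_term_def trace_mult unfolding trace_def
  by (intro ext_separable_mult ext_separable_series ext_separable_cscale ext_separable_sum
      ext_separable_mat_series hol_coeffs_constant hol_coeffs_log hol_coeffs_gap hol_coeffs_dlog
      ext_separable_const A P Z holomorphic_intros)

lemma ext_separable_two_form:
  assumes "\<And>i j. ess_continuous (\<lambda>t. of_real (w t i j))"
  shows "ext_separable (\<lambda>\<tau> t. c *\<^sub>C two_form (w t))"
  unfolding ext_separable_def two_form_def
  by (auto intro!: separable_nice ess_continuous_mult ess_continuous_sum ess_continuous_const assms)

text \<open>Off its span a basis represents every vector by 0. If w0 or w1 lies outside the span, so does the
  argument for all but at most one t, and the coordinate vanishes there.\<close>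

lemma ess_continuous_representation:
  assumes B: "independent B" and q: "q1 \<in> span B" "q2 \<in> span B" "q3 \<in> span B"
  shows "ess_continuous (\<lambda>t. of_real (representation B
    ((1 - t)\<^sup>2 *\<^sub>R q1 + ((1 - t) * t) *\<^sub>R q2 + t\<^sup>2 *\<^sub>R q3 - ((1 - t) *\<^sub>R w0 + t *\<^sub>R w1)) b))"
proof -
  define Q where "Q t = (1 - t)\<^sup>2 *\<^sub>R q1 + ((1 - t) * t) *\<^sub>R q2 + t\<^sup>2 *\<^sub>R q3" for t
  have Q: "Q t \<in> span B" for t
    unfolding Q_def by (intro span_add span_scale q)
  have V: "Q t - v \<in> span B \<longleftrightarrow> v \<in> span B" for t v
    using span_diff[OF Q, of v t] span_diff[OF Q, of "Q t - v" t] by auto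
  have W: "(1 - t) *\<^sub>R w0 + t *\<^sub>R w1 = w0 + t *\<^sub>R (w1 - w0)" for t
    by (simp add: algebra_simps)
  show ?thesis
  proof (cases "w0 \<in> span B \<and> w1 \<in> span B")
    case True
    have "representation B (Q t - ((1 - t) *\<^sub>R w0 + t *\<^sub>R w1)) b =
        (1 - t)\<^sup>2 * representation B q1 b + ((1 - t) * t) * representation B q2 b +
        t\<^sup>2 * representation B q3 b -
        ((1 - t) * representation B w0 b + t * representation B w1 b)" for t
      unfolding Q_def using True q
      by (simp add: representation_diff representation_add representation_scale B span_add span_scale)
    then show ?thesis
      unfolding Q_def[symmetric]
      by (intro ess_continuousI[where N = "{}" and g = "\<lambda>t. of_real ((1 - t)\<^sup>2 * representation B q1 b +
        ((1 - t) * t) * representation B q2 b + t\<^sup>2 * representation B q3 b -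
        ((1 - t) * representation B w0 b + t * representation B w1 b))"] continuous_intros) auto
  next
    case False
    let ?N = "{t. w0 + t *\<^sub>R (w1 - w0) \<in> span B}"
    have "t = t'" if "t \<in> ?N" "t' \<in> ?N" for t t'
    proof (rule ccontr)
      assume "t \<noteq> t'"
      have "(w0 + t *\<^sub>R (w1 - w0)) - (w0 + t' *\<^sub>R (w1 - w0)) \<in> span B"
        using that by (intro span_diff) auto
      then have "(t - t') *\<^sub>R (w1 - w0) \<in> span B"
        by (simp add: algebra_simps)
      then have "(1 / (t - t')) *\<^sub>R (t - t') *\<^sub>R (w1 - w0) \<in> span B"
        by (rule span_scale)
      then have d: "w1 - w0 \<in> span B"
        using \<open>t \<noteq> t'\<close> by simp
      have "(w0 + t *\<^sub>R (w1 - w0)) - t *\<^sub>R (w1 - w0) \<in> span B"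
        using that by (intro span_diff[OF _ span_scale[OF d]]) auto
      then have "w0 \<in> span B" by simp
      moreover from this d have "w1 \<in> span B"
        using span_add[of "w1 - w0" B w0] by simp
      ultimately show False using False by blast
    qed
    \<comment> \<open>The choice term names the only possible element without a separate case for
      the empty set.\<close>
    then have "?N \<subseteq> {SOME t. t \<in> ?N}"
      by (metis (mono_tags, lifting) insertI1 someI subsetI)
    then have "finite ?N"
      by (rule finite_subset) simp
    then show ?thesis
      unfolding Q_def[symmetric] W
      by (intro ess_continuousI[where N = ?N and g = "\<lambda>_. 0"]) (auto simp: representation_def V)
  qed
qed

section \<open>Real linearity of connections and the curvature along the path\<close>

lemma scaleR_fun_apply: "(c *\<^sub>R f) x = c *\<^sub>R f x"
  by (simp add: scaleR_fun_def)

lemma Ck_on_const: "Ck_on r S (\<lambda>x. c)"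
  by (induction r arbitrary: c) (auto simp: continuous_on_const)

lemma smooth_fun_const: "smooth_fun \<A> W (\<lambda>_. c)"
  by (auto simp: smooth_fun_def C_infinity_on_def o_def Ck_on_const)

text \<open>The Leibniz rule for 1 as the product of 1 with itself gives v(1) = 2 v(1); linearity
  extends this to all constants.\<close>

lemma tangent_const:
  assumes "v \<in> tangent_space \<A> p"
  shows "v (\<lambda>_. c) = 0"
proof -
  have lin: "v (\<lambda>q. a * f q + b * g q) = a * v f + b * v g"
    and mul: "v (\<lambda>q. f q * g q) = v f * g p + f p * v g"
    if "smooth_fun \<A> UNIV f" "smooth_fun \<A> UNIV g" for f g a b
    using assms that unfolding tangent_space_def by blast+
  have "v (\<lambda>_. 1) = 0"
    using mul[OF smooth_fun_const smooth_fun_const, of 1 1] by simp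
  then show ?thesis
    using lin[OF smooth_fun_const smooth_fun_const, of c 1 0 1] by simp
qed

lemma tangent_scaleR:
  assumes "v \<in> tangent_space \<A> p"
  shows "a *\<^sub>R v \<in> tangent_space \<A> p"
  using assms unfolding tangent_space_def scaleR_fun_def by (auto simp: algebra_simps)

lemma frechet_derivative_cong_open:
  assumes "open S" "x \<in> S" "\<And>x. x \<in> S \<Longrightarrow> f x = g x" "f differentiable (at x)"
  shows "g differentiable (at x)" "frechet_derivative g (at x) = frechet_derivative f (at x)"
proof -
  have "(f has_derivative frechet_derivative f (at x)) (at x)"
    using assms(4) by (simp add: frechet_derivative_works)
  then have "(g has_derivative frechet_derivative f (at x)) (at x)"
    by (rule has_derivative_transform_within_open[OF _ assms(1-3)])
  then show "g differentiable (at x)" "frechet_derivative g (at x) = frechet_derivative f (at x)"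
    by (auto simp: differentiable_def frechet_derivative_at[symmetric])
qed

text \<open>At a point of an open S the derivative sees only values in S, so agreement on S passes
  to the derivatives and the induction closes.\<close>

lemma Ck_on_cong:
  assumes "open S"
  shows "(\<And>x. x \<in> S \<Longrightarrow> f x = g x) \<Longrightarrow> Ck_on r S f \<Longrightarrow> Ck_on r S g"
proof (induction r arbitrary: f g)
  case 0
  then show ?case using continuous_on_cong by force
next
  case (Suc r)
  have f: "f differentiable (at x)" if "x \<in> S" for x
    using Suc.prems(2) that by simp
  have d: "g differentiable (at x)" "frechet_derivative g (at x) = frechet_derivative f (at x)"
    if "x \<in> S" for x
    by (rule frechet_derivative_cong_open[OF assms that _ f[OF that]], rule Suc.prems(1), assumption)+
  have "Ck_on r S (\<lambda>x. frechet_derivative g (at x) v)" for v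
  proof (rule Suc.IH)
    show "Ck_on r S (\<lambda>x. frechet_derivative f (at x) v)"
      using Suc.prems(2) by simp
  qed (simp add: d)
  then show ?case using d by simp
qed

lemma Ck_on_mult_const:
  fixes f :: "'a::euclidean_space \<Rightarrow> real"
  assumes "open S"
  shows "Ck_on r S f \<Longrightarrow> Ck_on r S (\<lambda>x. a * f x)"
proof (induction r arbitrary: f)
  case 0
  then show ?case by (simp add: continuous_on_mult_left)
next
  case (Suc r)
  have d: "((\<lambda>x. a * f x) has_derivative (\<lambda>v. a * frechet_derivative f (at x) v)) (at x)" if "x \<in> S" for x
    using Suc.prems that by (intro has_derivative_mult_right) (simp add: frechet_derivative_works)
  have "Ck_on r S (\<lambda>x. frechet_derivative (\<lambda>x. a * f x) (at x) v)" for v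
  proof (rule Ck_on_cong[OF assms])
    show "Ck_on r S (\<lambda>x. a * frechet_derivative f (at x) v)"
      using Suc by auto
    show "a * frechet_derivative f (at x) v = frechet_derivative (\<lambda>x. a * f x) (at x) v" if "x \<in> S" for x
      using frechet_derivative_at[OF d[OF that]] by metis
  qed
  then show ?case
    using d by (auto simp: differentiable_def)
qed

lemma open_chart_image:
  assumes "smooth_manifold \<A>" "(U, \<phi>) \<in> \<A>" "open W"
  shows "open (\<phi> ` (U \<inter> W))"
proof -
  have *: "open (\<phi> ` U)" "homeomorphism U (\<phi> ` U) \<phi> (inv_into U \<phi>)"
    using assms unfolding smooth_manifold_def by blast+
  have "openin (top_of_set (\<phi> ` U)) (\<phi> ` (U \<inter> W))"
    using assms(3) by (intro homeomorphism_imp_open_map[OF *(2)]) auto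
  then show ?thesis
    using *(1) openin_open_trans by blast
qed

lemma smooth_field_scaleR:
  assumes M: "smooth_manifold \<A>" and s: "smooth_field \<A> s"
  shows "smooth_field \<A> (a *\<^sub>R s)"
proof -
  \<comment> \<open>For a nonzero factor, scaling does not change membership in the span; outside
    the span, or for a dependent family, \<open>representation\<close> is 0 on both sides.\<close>
  have coord: "basis_coord e (a *\<^sub>R v) i = a * basis_coord e v i" for e and v :: "'a tvec" and i
  proof -
    consider "v \<in> span (range e)" "independent (range e)" | "a = 0" |
      "a \<noteq> 0" "v \<notin> span (range e) \<or> \<not> independent (range e)" by blast
    then show ?thesis
    proof cases
      case 3
      moreover have "v \<in> span (range e)" if "a *\<^sub>R v \<in> span (range e)"
        using span_scale[OF that, of "inverse a"] \<open>a \<noteq> 0\<close> by simp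
      ultimately show ?thesis
        by (auto simp: basis_coord_def representation_def)
    qed (simp_all add: basis_coord_def representation_scale representation_zero)
  qed
  have "a *\<^sub>R s p \<in> tangent_space \<A> p" for p
    using s by (auto simp: smooth_section_def tangent_bundle_def intro: tangent_scaleR)
  moreover have "smooth_fun \<A> (fst C) (\<lambda>p. basis_coord (\<lambda>i. coord_vector \<A> C i p) (a *\<^sub>R s p) i)"
    if "C \<in> \<A>" for C i
  proof -
    have "open (fst C)"
      using M that unfolding smooth_manifold_def by (cases C) auto
    moreover have "smooth_fun \<A> (fst C) (\<lambda>p. basis_coord (\<lambda>i. coord_vector \<A> C i p) (s p) i)"
      using s that by (auto simp: smooth_section_def tangent_bundle_def)
    ultimately show ?thesis
      unfolding smooth_fun_def C_infinity_on_def coord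
      by (auto simp: o_def intro!: Ck_on_mult_const open_chart_image[OF M])
  qed
  ultimately show ?thesis
    by (auto simp: smooth_section_def tangent_bundle_def scaleR_fun_def)
qed

text \<open>A real factor is a constant function, for which the derivative term in the Leibniz rule
  of a connection vanishes.\<close>

lemma connection_linear:
  assumes M: "smooth_manifold \<A>" and D: "connection \<A> (tangent_bundle \<A>) D"
    and X: "smooth_field \<A> X" and s: "smooth_field \<A> s" "smooth_field \<A> s'"
  shows "D X (a *\<^sub>R s + b *\<^sub>R s') = a *\<^sub>R D X s + b *\<^sub>R D X s'"
proof -
  have scale: "D X (c *\<^sub>R r) = c *\<^sub>R D X r" if "smooth_field \<A> r" for c r
  proof -
    have "D X (\<lambda>p. c *\<^sub>R r p) = (\<lambda>p. X p (\<lambda>_. c) *\<^sub>R r p + c *\<^sub>R D X r p)"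
      using D X that smooth_fun_const[of \<A> UNIV c] unfolding connection_def by blast
    moreover have "X p \<in> tangent_space \<A> p" for p
      using X by (simp add: smooth_section_def tangent_bundle_def)
    note tangent_const[OF this, where c = c]
    moreover have "c *\<^sub>R r = (\<lambda>p. c *\<^sub>R r p)" "c *\<^sub>R D X r = (\<lambda>p. c *\<^sub>R D X r p)"
      by (rule ext, rule scaleR_fun_apply)+
    ultimately show ?thesis by (simp only: scaleR_zero_left add_0_left)
  qed
  have "\<forall>X s s'. smooth_field \<A> X \<longrightarrow> smooth_field \<A> s \<longrightarrow> smooth_field \<A> s' \<longrightarrow>
      D X (s + s') = D X s + D X s'"
    using D unfolding connection_def by (elim conjE)
  then have "D X (a *\<^sub>R s + b *\<^sub>R s') = D X (a *\<^sub>R s) + D X (b *\<^sub>R s')"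
    using X smooth_field_scaleR[OF M s(1)] smooth_field_scaleR[OF M s(2)] by simp
  then show ?thesis by (simp add: scale s)
qed

text \<open>In t the second derivatives are quadratic with coefficients in the tangent space, while
  the bracket term is affine. The latter is not shown to lie in the tangent space;
  \<open>ess_continuous_representation\<close> covers both possibilities.\<close>

lemma ess_continuous_curvature_entry:
  assumes M: "smooth_manifold \<A>" and D0: "connection \<A> (tangent_bundle \<A>) D0"
    and D1: "connection \<A> (tangent_bundle \<A>) D1"
    and X: "smooth_field \<A> X" "smooth_field \<A> Y" "smooth_field \<A> s"
    and e: "basis_of (tangent_space \<A> p) e"
  shows "ess_continuous (\<lambda>t. of_real (basis_coord e (curvature (connection_path D0 D1 t) X Y s p) a))"
proof -
  let ?V = "tangent_space \<A> p"
  have B: "independent (range e)" "?V = span (range e)"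
    using e by (auto simp: basis_of_def)
  have smooth: "smooth_field \<A> (D0 W r)" "smooth_field \<A> (D1 W r)"
    if "smooth_field \<A> W" "smooth_field \<A> r" for W r
    using D0 D1 that by (simp_all add: connection_def)
  have mem: "r p \<in> ?V" if "smooth_field \<A> r" for r
    using that by (simp add: smooth_section_def tangent_bundle_def)
  have DD: "connection_path D0 D1 t W (connection_path D0 D1 t W' s) p =
      (1 - t)\<^sup>2 *\<^sub>R D0 W (D0 W' s) p + ((1 - t) * t) *\<^sub>R (D0 W (D1 W' s) p + D1 W (D0 W' s) p) +
      t\<^sup>2 *\<^sub>R D1 W (D1 W' s) p"
    if "smooth_field \<A> W" "smooth_field \<A> W'" for W W' t
  proof -
    note lin = connection_linear[OF M D0 that(1) smooth[OF that(2) X(3)]]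
      connection_linear[OF M D1 that(1) smooth[OF that(2) X(3)]]
    show ?thesis
      unfolding connection_path_def lin
      by (simp add: scaleR_fun_apply power2_eq_square scaleR_add_right mult.commute[of t "1 - t"] add_ac)
  qed
  \<comment> \<open>Coefficients of (1 - t)^2, (1 - t) t and t^2 in the commutator of the second
    derivatives.\<close>
  define q1 where "q1 = D0 X (D0 Y s) p - D0 Y (D0 X s) p"
  define q2 where "q2 = (D0 X (D1 Y s) p + D1 X (D0 Y s) p) - (D0 Y (D1 X s) p + D1 Y (D0 X s) p)"
  define q3 where "q3 = D1 X (D1 Y s) p - D1 Y (D1 X s) p"
  define w0 where "w0 = D0 (lie_bracket X Y) s p"
  define w1 where "w1 = D1 (lie_bracket X Y) s p"
  have path: "connection_path D0 D1 t W r p = (1 - t) *\<^sub>R D0 W r p + t *\<^sub>R D1 W r p" for t W r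
    by (simp add: connection_path_def scaleR_fun_apply)
  have "curvature (connection_path D0 D1 t) X Y s p =
      (1 - t)\<^sup>2 *\<^sub>R q1 + ((1 - t) * t) *\<^sub>R q2 + t\<^sup>2 *\<^sub>R q3 - ((1 - t) *\<^sub>R w0 + t *\<^sub>R w1)" for t
  proof -
    have "curvature (connection_path D0 D1 t) X Y s p =
        connection_path D0 D1 t X (connection_path D0 D1 t Y s) p -
        connection_path D0 D1 t Y (connection_path D0 D1 t X s) p -
        ((1 - t) *\<^sub>R w0 + t *\<^sub>R w1)"
      by (simp add: curvature_def w0_def w1_def path[of _ "lie_bracket X Y"])
    then show ?thesis
      unfolding DD[OF X(1,2)] DD[OF X(2,1)] q1_def q2_def q3_def
      by (simp add: scaleR_add_right scaleR_diff_right)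
  qed
  moreover have "q1 \<in> ?V" "q2 \<in> ?V" "q3 \<in> ?V"
    unfolding q1_def q2_def q3_def B(2)
    by (intro span_diff span_add mem[unfolded B(2)] smooth X)+
  ultimately show ?thesis
    unfolding basis_coord_def using ess_continuous_representation[OF B(1)] by (simp add: B(2))
qed

section \<open>Action of the modular group\<close>

text \<open>One translation adds x to y modulo 2, so n of them add n x; going down works because
  adding x twice changes nothing.\<close>

lemma int_translate_family:
  fixes \<Phi> :: "bool \<Rightarrow> bool \<Rightarrow> complex \<Rightarrow> complex"
  assumes T: "\<And>x y \<tau>. \<tau> \<in> upper_half_plane \<Longrightarrow> x \<or> y \<Longrightarrow> \<Phi> x y (\<tau> + 1) = \<Phi> x (x \<noteq> y) \<tau>"
    and \<tau>: "\<tau> \<in> upper_half_plane" and xy: "x \<or> y"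
  shows "\<Phi> x y (\<tau> + of_int n) = \<Phi> x (y \<noteq> (x \<and> odd n)) \<tau>"
proof -
  have H: "\<tau> + of_int m \<in> upper_half_plane" for m
    using \<tau> by (simp add: upper_half_plane_def)
  show ?thesis
    using xy
  proof (induction n arbitrary: y rule: int_induct[where k = 0])
    case (step1 i)
    have "\<Phi> x y (\<tau> + of_int (i + 1)) = \<Phi> x (x \<noteq> y) (\<tau> + of_int i)"
      using T[OF H[of i] step1.prems] by (simp add: add.assoc)
    also have "\<dots> = \<Phi> x ((x \<noteq> y) \<noteq> (x \<and> odd i)) \<tau>"
      using step1.prems by (intro step1.IH) auto
    also have "((x \<noteq> y) \<noteq> (x \<and> odd i)) = (y \<noteq> (x \<and> odd (i + 1)))"
      by auto
    finally show ?case .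
  next
    case (step2 i)
    have "\<Phi> x (x \<noteq> y) (\<tau> + of_int i) = \<Phi> x (x \<noteq> (x \<noteq> y)) (\<tau> + of_int (i - 1))"
      using T[OF H[of "i - 1"], of x "x \<noteq> y"] step2.prems by (auto simp: add.assoc)
    moreover have "(x \<noteq> (x \<noteq> y)) = y" by auto
    moreover have "\<Phi> x (x \<noteq> y) (\<tau> + of_int i) = \<Phi> x ((x \<noteq> y) \<noteq> (x \<and> odd i)) \<tau>"
      using step2.prems by (intro step2.IH) auto
    moreover have "((x \<noteq> y) \<noteq> (x \<and> odd i)) = (y \<noteq> (x \<and> odd (i - 1)))"
      by auto
    ultimately show ?case by simp
  qed simp
qed

text \<open>Right multiplication by the matrix acts on parity pairs; the induction is the Euclidean algorithm on (a, c).\<close>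

lemma moebius_family:
  fixes \<Phi> :: "bool \<Rightarrow> bool \<Rightarrow> complex \<Rightarrow> complex" and a b c d :: int
  assumes T: "\<And>x y \<tau>. \<tau> \<in> upper_half_plane \<Longrightarrow> x \<or> y \<Longrightarrow> \<Phi> x y (\<tau> + 1) = \<Phi> x (x \<noteq> y) \<tau>"
    and S: "\<And>x y \<tau>. \<tau> \<in> upper_half_plane \<Longrightarrow> x \<or> y \<Longrightarrow> \<Phi> x y (- 1 / \<tau>) = \<tau> ^ w * \<Phi> y x \<tau>"
    and w: "even w" and \<tau>: "\<tau> \<in> upper_half_plane" and "x \<or> y" "a * d - b * c = 1"
  shows "(of_int a * \<tau> + of_int b) / (of_int c * \<tau> + of_int d) \<in> upper_half_plane \<and>
    \<Phi> x y ((of_int a * \<tau> + of_int b) / (of_int c * \<tau> + of_int d)) =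
      (of_int c * \<tau> + of_int d) ^ w * \<Phi> ((x \<and> odd a) \<noteq> (y \<and> odd c)) ((x \<and> odd b) \<noteq> (y \<and> odd d)) \<tau>"
  using assms(5,6)
proof (induction "nat \<bar>c\<bar>" arbitrary: a b c d x y rule: less_induct)
  case less
  have Im: "Im \<tau> > 0"
    using \<tau> by (simp add: upper_half_plane_def)
  have nz: "of_int m * \<tau> + of_int n \<noteq> 0" if "m \<noteq> 0 \<or> n \<noteq> 0" for m n :: int
    using that Im by (auto simp: complex_eq_iff)
  show ?case
  proof (cases "c = 0")
    case True
    \<comment> \<open>The matrix is plus or minus a translation, by a b since a is its own inverse;
      the sign disappears in the even power.\<close>
    then have ad: "a = 1 \<and> d = 1 \<or> a = - 1 \<and> d = - 1"
      using less.prems(2) by (simp add: zmult_eq_1_iff)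
    then have q: "(of_int a * \<tau> + of_int b) / (of_int c * \<tau> + of_int d) = \<tau> + of_int (a * b)"
      using True by auto
    have "\<Phi> x y (\<tau> + of_int (a * b)) = \<Phi> x (y \<noteq> (x \<and> odd (a * b))) \<tau>"
      by (rule int_translate_family[where \<Phi> = \<Phi>, OF T \<tau> less.prems(1)])
    moreover have "(of_int c * \<tau> + of_int d) ^ w = (1 :: complex)"
      using ad True w by auto
    moreover have "x = ((x \<and> odd a) \<noteq> (y \<and> odd c))"
      "(y \<noteq> (x \<and> odd (a * b))) = ((x \<and> odd b) \<noteq> (y \<and> odd d))"
      using ad True by auto
    moreover have "\<tau> + of_int (a * b) \<in> upper_half_plane"
      using \<tau> by (simp add: upper_half_plane_def)
    ultimately show ?thesis
      unfolding q by simp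
  next
    case False
    \<comment> \<open>With T for tau + 1 and S for -1/tau, the matrix acts as T^n S times the one
      with rows (c, d) and (-a', -b'), whose lower left entry is smaller than c in absolute
      value.\<close>
    define n where "n = a div c"
    define a' where "a' = a mod c"
    define b' where "b' = b - n * d"
    define y' where "y' = (y \<noteq> (x \<and> odd n))"
    have a: "a = n * c + a'" and b: "b = n * d + b'"
      by (simp_all add: n_def a'_def b'_def)
    have small: "nat \<bar>- a'\<bar> < nat \<bar>c\<bar>"
      using abs_mod_less[OF False, of a] by (simp add: a'_def)
    have det: "c * (- b') - d * (- a') = 1"
      using less.prems(2) unfolding a b by (simp add: algebra_simps)
    have y': "y' \<or> x"
      using less.prems(1) by (auto simp: y'_def)
    define \<sigma> where "\<sigma> = (of_int c * \<tau> + of_int d) / (of_int (- a') * \<tau> + of_int (- b'))"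
    have IH: "\<sigma> \<in> upper_half_plane"
      "\<Phi> y' x \<sigma> = (of_int (- a') * \<tau> + of_int (- b')) ^ w *
        \<Phi> ((y' \<and> odd c) \<noteq> (x \<and> odd (- a'))) ((y' \<and> odd d) \<noteq> (x \<and> odd (- b'))) \<tau>"
      using less.hyps[OF small y' det] unfolding \<sigma>_def by blast+
    have j: "of_int c * \<tau> + of_int d \<noteq> 0"
      using nz False by blast
    have j': "of_int (- a') * \<tau> + of_int (- b') \<noteq> 0"
      using det by (intro nz) auto
    have q: "(of_int a * \<tau> + of_int b) / (of_int c * \<tau> + of_int d) = - 1 / \<sigma> + of_int n"
      using j j' unfolding a b \<sigma>_def by (simp add: field_simps)
    have "\<Phi> x y (- 1 / \<sigma> + of_int n) = \<Phi> x y' (- 1 / \<sigma>)"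
      unfolding y'_def by (rule int_translate_family[where \<Phi> = \<Phi>, OF T upper_half_plane_S[OF IH(1)] less.prems(1)])
    also have "\<dots> = \<sigma> ^ w * \<Phi> y' x \<sigma>"
      using S[OF IH(1)] y' by blast
    also have "\<dots> = (\<sigma> * (of_int (- a') * \<tau> + of_int (- b'))) ^ w *
        \<Phi> ((y' \<and> odd c) \<noteq> (x \<and> odd (- a'))) ((y' \<and> odd d) \<noteq> (x \<and> odd (- b'))) \<tau>"
      unfolding IH(2) power_mult_distrib by (simp only: mult.assoc)
    \<comment> \<open>Cocycle relation of the automorphy factors for S times the smaller
      matrix.\<close>
    also have "\<sigma> * (of_int (- a') * \<tau> + of_int (- b')) = of_int c * \<tau> + of_int d"
      using j' by (simp add: \<sigma>_def)
    also have "((y' \<and> odd c) \<noteq> (x \<and> odd (- a'))) = ((x \<and> odd a) \<noteq> (y \<and> odd c))"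
      unfolding y'_def a by auto
    also have "((y' \<and> odd d) \<noteq> (x \<and> odd (- b'))) = ((x \<and> odd b) \<noteq> (y \<and> odd d))"
      unfolding y'_def b by auto
    finally show ?thesis
      using upper_half_plane_S[OF IH(1)] unfolding q by (simp add: upper_half_plane_def)
  qed
qed

section \<open>Coefficients of the transgressed forms and their modularity\<close>

definition path_integral_coeff ::
    "('m, 'm tvec) connection_op \<Rightarrow> ('m, 'm tvec) connection_op \<Rightarrow>
      ('m, 'v::real_vector) connection_op \<Rightarrow> ('m, 'n::{finite,linorder}, 'v) frame \<Rightarrow> 'n set \<Rightarrow>
      bool \<Rightarrow> bool \<Rightarrow> complex \<Rightarrow> complex" where
  "path_integral_coeff D0 D1 D\<xi> = (\<lambda>(p, X, s) I x y \<tau>.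
     integral {0..1} (\<lambda>t. ext_coeff (transgression_term (ratio_fps x y \<tau>) (prod_fps \<tau>)
       (scaled_curvature (connection_path D0 D1 t) p X) (u_form D\<xi> p X s) (difference_matrix D0 D1 p X)) I))"

lemma half_theta'_simps:
  "half_theta' False True = theta1'" "half_theta' True False = theta2'" "half_theta' True True = theta3'"
  by (auto simp: fun_eq_iff half_theta'_def half_theta_def theta1'_def theta2'_def theta3'_def)

lemma det_half_eq:
  assumes "\<tau> \<in> upper_half_plane" "\<And>z. f z = z * theta_ratio x y z \<tau>"
  shows "det_half f Z = ext_series (fps_exp 1) ((1/2) *\<^sub>C trace (mat_series (log_fps (ratio_fps x y \<tau>)) Z))"
proof -
  have "\<forall>\<^sub>F z in at 0. f z = ratio0 x y \<tau> z"
    unfolding assms(2) using eventually_neq_at_within[of 0 0 UNIV]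
    by eventually_elim (simp add: ratio0_def)
  from taylor0_Ln[OF ratio0_has_fps_expansion[OF assms(1)] this ratio_fps_nth_0[OF assms(1)]]
  show ?thesis
    unfolding det_half_def by simp
qed

text \<open>Dictionary for the parity pairs: (False, True), (True, False) and (True, True) belong to
  L, W and W'. Beyond it only formal power series enter the forms, so poles and division by 0 no
  longer matter.\<close>

lemma theta_taylor0:
  assumes \<tau>: "\<tau> \<in> upper_half_plane"
  shows "taylor0 (h_L \<tau>) = dlog_fps (ratio_fps False True \<tau>)"
    and "taylor0 (h_W \<tau>) = dlog_fps (ratio_fps True False \<tau>)"
    and "taylor0 (h_W' \<tau>) = dlog_fps (ratio_fps True True \<tau>)"
    and "taylor0 (G_L \<tau>) = gap_fps (ratio_fps False True \<tau>) (prod_fps \<tau>)"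
    and "taylor0 (G_W \<tau>) = gap_fps (ratio_fps True False \<tau>) (prod_fps \<tau>)"
    and "taylor0 (G_W' \<tau>) = gap_fps (ratio_fps True True \<tau>) (prod_fps \<tau>)"
    and "det_half (f_L \<tau>) Z =
      ext_series (fps_exp 1) ((1/2) *\<^sub>C trace (mat_series (log_fps (ratio_fps False True \<tau>)) Z))"
    and "det_half (f_W \<tau>) Z =
      ext_series (fps_exp 1) ((1/2) *\<^sub>C trace (mat_series (log_fps (ratio_fps True False \<tau>)) Z))"
    and "det_half (f_W' \<tau>) Z =
      ext_series (fps_exp 1) ((1/2) *\<^sub>C trace (mat_series (log_fps (ratio_fps True True \<tau>)) Z))"
proof -
  show "taylor0 (h_L \<tau>) = dlog_fps (ratio_fps False True \<tau>)"
    "taylor0 (h_W \<tau>) = dlog_fps (ratio_fps True False \<tau>)"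
    "taylor0 (h_W' \<tau>) = dlog_fps (ratio_fps True True \<tau>)"
    using theta_logderiv_taylor0[OF \<tau>, of False True] theta_logderiv_taylor0[OF \<tau>, of True False]
      theta_logderiv_taylor0[OF \<tau>, of True True]
    unfolding half_theta'_simps by (simp_all add: half_theta_def h_L_def[abs_def] h_W_def[abs_def] h_W'_def[abs_def])
  have nz: "theta' 0 \<tau> \<noteq> 0" "theta1 0 \<tau> \<noteq> 0" "theta2 0 \<tau> \<noteq> 0" "theta3 0 \<tau> \<noteq> 0"
    using theta'_0_nonzero[OF \<tau>] half_theta_0_nonzero[OF \<tau>, of False True]
      half_theta_0_nonzero[OF \<tau>, of True False] half_theta_0_nonzero[OF \<tau>, of True True]
    by (simp_all add: half_theta_def)
  show "taylor0 (G_L \<tau>) = gap_fps (ratio_fps False True \<tau>) (prod_fps \<tau>)"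
    by (rule gap_taylor0[OF \<tau>])
       (use nz in \<open>simp add: G_L_def theta_ratio_def half_theta_def field_simps\<close>)
  show "taylor0 (G_W \<tau>) = gap_fps (ratio_fps True False \<tau>) (prod_fps \<tau>)"
    by (rule gap_taylor0[OF \<tau>])
       (use nz in \<open>simp add: G_W_def theta_ratio_def half_theta_def field_simps\<close>)
  show "taylor0 (G_W' \<tau>) = gap_fps (ratio_fps True True \<tau>) (prod_fps \<tau>)"
    by (rule gap_taylor0[OF \<tau>])
       (use nz in \<open>simp add: G_W'_def theta_ratio_def half_theta_def field_simps\<close>)
qed (rule det_half_eq[OF \<tau>], simp add: f_L_def f_W_def f_W'_def theta_ratio_def half_theta_def)+

lemma ext_coeff_integral01: "ext_coeff (ext_integral01 F) I = integral {0..1} (\<lambda>t. ext_coeff (F t) I)"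
  by (simp add: ext_integral01_def Abs_ext_inverse)

lemma CS_coeff:
  assumes "\<tau> \<in> upper_half_plane"
  shows "ext_coeff (CS_L k D0 D1 D\<xi> \<tau> fr) I =
      of_real (sqrt 2) / (8 * of_real pi ^ 2) * (of_real (sqrt 2) ^ (4 * k + 1) / (of_real pi * \<i>)) *
      path_integral_coeff D0 D1 D\<xi> fr I False True \<tau>"
    and "ext_coeff (CS_W D0 D1 D\<xi> \<tau> fr) I =
      1 / (8 * of_real pi ^ 2) * (1 / (2 * of_real pi * \<i>)) *
      path_integral_coeff D0 D1 D\<xi> fr I True False \<tau>"
    and "ext_coeff (CS_W' D0 D1 D\<xi> \<tau> fr) I =
      1 / (8 * of_real pi ^ 2) * (1 / (2 * of_real pi * \<i>)) *
      path_integral_coeff D0 D1 D\<xi> fr I True True \<tau>"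
  by (cases fr; simp add: CS_L_def CS_W_def CS_W'_def Phi_L_def Phi_W_def Phi_W'_def
      ext_coeff_integral01 theta_taylor0[OF assms] path_integral_coeff_def transgression_term_def)+

lemma grade_scale_scaled_curvature:
  "grade_scale l (scaled_curvature D p X $ i $ j) = l\<^sup>2 *\<^sub>C (scaled_curvature D p X $ i $ j)"
  by (simp add: scaled_curvature_def curvature_matrix_def grade_scale_cscale grade_scale_two_form mult.commute)

lemma grade_scale_u_form: "grade_scale l (u_form D p X s) = l\<^sup>2 *\<^sub>C u_form D p X s"
  by (simp add: u_form_def euler_form_def curvature_matrix_def grade_scale_cscale grade_scale_two_form mult_ac)

lemma grade_scale_difference_matrix:
  "grade_scale l (difference_matrix D0 D1 p X $ i $ j) = l *\<^sub>C (difference_matrix D0 D1 p X $ i $ j)"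
  by (simp add: difference_matrix_def grade_scale_one_form)

lemma path_integral_coeff_S:
  assumes \<tau>: "\<tau> \<in> upper_half_plane" and xy: "x \<or> y" and I: "card I = 4 * k + 1"
  shows "path_integral_coeff D0 D1 D\<xi> fr I x y (- 1 / \<tau>) =
    \<tau> ^ (2 * k + 2) * path_integral_coeff D0 D1 D\<xi> fr I y x \<tau>"
proof -
  obtain p X s where fr: "fr = (p, X, s)" by (cases fr)
  \<comment> \<open>The form degree is odd while curvatures must scale by tau, so a square root is
    needed; the final identity contains only powers of tau, and either root would do.\<close>
  define l where "l = csqrt \<tau>"
  have l2: "l\<^sup>2 = \<tau>" by (simp add: l_def)
  have l0: "l \<noteq> 0"
    using \<tau> by (auto simp: l_def upper_half_plane_def)
  define E where "E A P t = transgression_term A P (scaled_curvature (connection_path D0 D1 t) p X)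
    (u_form D\<xi> p X s) (difference_matrix D0 D1 p X)" for A P t
  have "l *\<^sub>C E (ratio_fps x y (- 1 / \<tau>)) (prod_fps (- 1 / \<tau>)) t =
      l ^ 4 *\<^sub>C grade_scale l (E (ratio_fps y x \<tau>) (prod_fps \<tau>) t)" for t
    unfolding E_def ratio_fps_S[OF \<tau> xy] prod_fps_S[OF \<tau>]
    by (rule transgression_term_scale[of l, unfolded l2, OF grade_scale_scaled_curvature[of l, unfolded l2]
        grade_scale_u_form[of l, unfolded l2] grade_scale_difference_matrix])
       (simp add: ratio_fps_nth_0[OF \<tau>])
  then have "ext_coeff (l *\<^sub>C E (ratio_fps x y (- 1 / \<tau>)) (prod_fps (- 1 / \<tau>)) t) I =
      ext_coeff (l ^ 4 *\<^sub>C grade_scale l (E (ratio_fps y x \<tau>) (prod_fps \<tau>) t)) I" for t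
    by simp
  \<comment> \<open>4 + (4k + 1) = 1 + 2 (2k + 2): one l remains in degree 4k + 1 and cancels the
    one on the left.\<close>
  moreover have "l ^ 4 * l ^ (4 * k + 1) = l * \<tau> ^ (2 * k + 2)"
    unfolding l2[symmetric] power_mult[symmetric] power_add[symmetric] power_Suc[symmetric]
    by (intro arg_cong[where f = "\<lambda>n. l ^ n"]) simp
  ultimately have "l * ext_coeff (E (ratio_fps x y (- 1 / \<tau>)) (prod_fps (- 1 / \<tau>)) t) I =
      l * (\<tau> ^ (2 * k + 2) * ext_coeff (E (ratio_fps y x \<tau>) (prod_fps \<tau>) t) I)" for t
    by (simp only: ext_coeff_simps ext_coeff_grade_scale I mult.assoc[symmetric])
  then have "ext_coeff (E (ratio_fps x y (- 1 / \<tau>)) (prod_fps (- 1 / \<tau>)) t) I =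
      \<tau> ^ (2 * k + 2) * ext_coeff (E (ratio_fps y x \<tau>) (prod_fps \<tau>) t) I" for t
    using l0 mult_left_cancel by blast
  then show ?thesis
    by (simp add: path_integral_coeff_def fr E_def)
qed

text \<open>Translation of tau does not rescale z, so the identity holds in every degree and not
  only in degree 4k + 1.\<close>

lemma path_integral_coeff_T:
  assumes "\<tau> \<in> upper_half_plane"
  shows "path_integral_coeff D0 D1 D\<xi> fr I x y (\<tau> + 1) = path_integral_coeff D0 D1 D\<xi> fr I x (x \<noteq> y) \<tau>"
  by (cases fr) (simp add: path_integral_coeff_def ratio_fps_T[OF assms] prod_fps_T[OF assms])

text \<open>Along the path only the curvature of the tangent bundle varies, with essentially
  continuous entries; the form u and the difference matrix are constant in t. Thus the integrand is
  separable.\<close>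

lemma path_integral_coeff_holomorphic:
  assumes M: "smooth_manifold \<A>" and D0: "connection \<A> (tangent_bundle \<A>) D0"
    and D1: "connection \<A> (tangent_bundle \<A>) D1" and fr: "fr \<in> adapted_frames \<A> \<xi> h"
  shows "path_integral_coeff D0 D1 D\<xi> fr I x y holomorphic_on upper_half_plane"
proof -
  obtain p X s where pXs: "fr = (p, X, s)" by (cases fr)
  have X: "smooth_field \<A> (X i)" "basis_of (tangent_space \<A> p) (\<lambda>i. X i p)" for i
    using fr by (auto simp: adapted_frames_def pXs)
  have "ext_separable (\<lambda>\<tau> t. scaled_curvature (connection_path D0 D1 t) p X $ i $ j)" for i j
    unfolding scaled_curvature_def curvature_matrix_def vec_lambda_beta
    by (intro ext_separable_two_form ess_continuous_curvature_entry[OF M D0 D1] X)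
  then have "ext_separable (\<lambda>\<tau> t. transgression_term (ratio_fps x y \<tau>) (prod_fps \<tau>)
       (scaled_curvature (connection_path D0 D1 t) p X) (u_form D\<xi> p X s) (difference_matrix D0 D1 p X))"
    by (intro ext_separable_transgression_term hol_coeffs_ratio_fps ratio_fps_nth_0 hol_coeffs_prod_fps)
  then show ?thesis
    unfolding ext_separable_def
    by (auto simp: path_integral_coeff_def[abs_def] pXs dest!: separable_integral spec[of _ I])
qed

text \<open>A matrix that fixes the pair (x, y) modulo 2 returns the member to itself with nothing
  but the automorphy factor, which is why the constant character 1 serves.\<close>

lemma modular_with_family:
  fixes \<Phi> :: "bool \<Rightarrow> bool \<Rightarrow> complex \<Rightarrow> complex" and g :: "int^2^2"
  assumes "\<And>x y \<tau>. \<tau> \<in> upper_half_plane \<Longrightarrow> x \<or> y \<Longrightarrow> \<Phi> x y (\<tau> + 1) = \<Phi> x (x \<noteq> y) \<tau>"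
    and "\<And>x y \<tau>. \<tau> \<in> upper_half_plane \<Longrightarrow> x \<or> y \<Longrightarrow> \<Phi> x y (- 1 / \<tau>) = \<tau> ^ w * \<Phi> y x \<tau>"
    and "even w" "x \<or> y" "\<Gamma> \<subseteq> SL2Z"
    and "\<And>g. g \<in> \<Gamma> \<Longrightarrow> ((x \<and> odd (g$1$1)) \<noteq> (y \<and> odd (g$2$1))) = x \<and>
      ((x \<and> odd (g$1$2)) \<noteq> (y \<and> odd (g$2$2))) = y"
    and "\<Phi> x y holomorphic_on upper_half_plane"
    and "\<And>\<tau>. \<tau> \<in> upper_half_plane \<Longrightarrow> f \<tau> = \<kappa> * \<Phi> x y \<tau>"
  shows "modular_with \<Gamma> (\<lambda>_. 1) w f"
  unfolding modular_with_def
proof (intro conjI ballI)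
  have "(\<lambda>\<tau>. \<kappa> * \<Phi> x y \<tau>) holomorphic_on upper_half_plane"
    using assms(7) by (intro holomorphic_intros)
  then show "f holomorphic_on upper_half_plane"
    by (rule holomorphic_transform) (simp add: assms(8))
  fix g \<tau> assume g: "g \<in> \<Gamma>" and \<tau>: "\<tau> \<in> upper_half_plane"
  have "g$1$1 * g$2$2 - g$1$2 * g$2$1 = 1"
    using g assms(5) by (auto simp: SL2Z_def det_2)
  from moebius_family[OF assms(1,2,3) \<tau> assms(4) this]
  have "moebius_act g \<tau> \<in> upper_half_plane"
    "\<Phi> x y (moebius_act g \<tau>) = automorphy g \<tau> ^ w * \<Phi> x y \<tau>"
    using assms(6)[OF g] by (simp_all add: moebius_act_def automorphy_def)
  then show "f (moebius_act g \<tau>) = 1 * automorphy g \<tau> ^ w * f \<tau>"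
    using assms(8) \<tau> by simp
qed

lemma ext_coeff_degree_part: "ext_coeff (degree_part d x) I = (if card I = d then ext_coeff x I else 0)"
  by transfer simp

lemma trivial_group_character: "group_character \<Gamma> (\<lambda>_. 1)"
  by (simp add: group_character_def)

lemma modular_form_family:
  fixes D\<xi> :: "('m::{t2_space,second_countable_topology}, 'v::real_vector) connection_op"
    and \<A> :: "('m, 'n::{finite,linorder}) chart set"
  assumes M: "smooth_manifold \<A>" and D0: "connection \<A> (tangent_bundle \<A>) D0"
    and D1: "connection \<A> (tangent_bundle \<A>) D1"
    and "x \<or> y" "\<Gamma> \<subseteq> SL2Z"
    and \<Gamma>: "\<And>g. g \<in> \<Gamma> \<Longrightarrow> ((x \<and> odd (g$1$1)) \<noteq> (y \<and> odd (g$2$1))) = x \<and>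
      ((x \<and> odd (g$1$2)) \<noteq> (y \<and> odd (g$2$2))) = y"
    and F: "\<And>\<tau> fr I. \<tau> \<in> upper_half_plane \<Longrightarrow>
      ext_coeff (F \<tau> fr) I = \<kappa> * path_integral_coeff D0 D1 D\<xi> fr I x y \<tau>"
  shows "modular_form (adapted_frames \<A> \<xi> h) \<Gamma> (2 * k + 2) (\<lambda>\<tau> fr. degree_part (4 * k + 1) (F \<tau> fr))"
  unfolding modular_form_def
proof (intro exI[of _ "\<lambda>_. 1"] conjI ballI allI trivial_group_character)
  fix fr :: "('m, 'n, 'v) frame" and I
  assume fr: "fr \<in> adapted_frames \<A> \<xi> h"
  show "modular_with \<Gamma> (\<lambda>_. 1) (2 * k + 2) (\<lambda>\<tau>. ext_coeff (degree_part (4 * k + 1) (F \<tau> fr)) I)"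
  proof (cases "card I = 4 * k + 1")
    case True
    show ?thesis
    proof (rule modular_with_family[where \<Phi> = "path_integral_coeff D0 D1 D\<xi> fr I", OF _ _ _ assms(4,5) \<Gamma>])
      show "path_integral_coeff D0 D1 D\<xi> fr I x y holomorphic_on upper_half_plane"
        by (rule path_integral_coeff_holomorphic[OF M D0 D1 fr])
      show "ext_coeff (degree_part (4 * k + 1) (F \<tau> fr)) I = \<kappa> * path_integral_coeff D0 D1 D\<xi> fr I x y \<tau>"
        if "\<tau> \<in> upper_half_plane" for \<tau>
        using True by (simp add: ext_coeff_degree_part F[OF that])
    qed (rule path_integral_coeff_T path_integral_coeff_S True | assumption | simp)+
  next
    case False
    then show ?thesis
      by (simp add: ext_coeff_degree_part modular_with_def)
  qed
qed

theorem theorem4p1: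
  fixes k :: nat
    and \<A> :: "('m::{t2_space,second_countable_topology}, 'n::{finite,linorder}) chart set"
    and g :: "'m \<Rightarrow> 'm tvec \<Rightarrow> 'm tvec \<Rightarrow> real"
    and D0 D1 :: "('m, 'm tvec) connection_op"
    and \<xi> :: "('m, 'v::real_vector, 2) vbundle"
    and h :: "'m \<Rightarrow> 'v \<Rightarrow> 'v \<Rightarrow> real"
    and D\<xi> :: "('m, 'v) connection_op"
  assumes "k \<ge> 1" and "CARD('n) = 4 * k + 1"
    and "smooth_manifold \<A>"
    and "bundle_metric \<A> (tangent_bundle \<A>) g"
    and "connection \<A> (tangent_bundle \<A>) D0"
    and "connection \<A> (tangent_bundle \<A>) D1"
    and "oriented_bundle \<A> \<xi>"
    and "bundle_metric \<A> \<xi> h"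
    and "euclidean_connection \<A> \<xi> h D\<xi>"
  shows
    "modular_form (adapted_frames \<A> \<xi> h) Gamma_lower0 (2 * k + 2)
       (\<lambda>\<tau> fr. degree_part (4 * k + 1) (CS_L k D0 D1 D\<xi> \<tau> fr)) \<and>
     modular_form (adapted_frames \<A> \<xi> h) Gamma_upper0 (2 * k + 2)
       (\<lambda>\<tau> fr. degree_part (4 * k + 1) (CS_W D0 D1 D\<xi> \<tau> fr)) \<and>
     modular_form (adapted_frames \<A> \<xi> h) Gamma_theta (2 * k + 2)
       (\<lambda>\<tau> fr. degree_part (4 * k + 1) (CS_W' D0 D1 D\<xi> \<tau> fr)) \<and>
     (\<forall>\<tau>\<in>upper_half_plane. \<forall>fr\<in>adapted_frames \<A> \<xi> h.
       degree_part (4 * k + 1) (CS_L k D0 D1 D\<xi> (- 1 / \<tau>) fr) =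
         (2 * \<tau>) ^ (2 * k + 2) *\<^sub>C degree_part (4 * k + 1) (CS_W D0 D1 D\<xi> \<tau> fr)) \<and>
     (\<forall>\<tau>\<in>upper_half_plane. \<forall>fr\<in>adapted_frames \<A> \<xi> h.
       CS_W D0 D1 D\<xi> (\<tau> + 1) fr = CS_W' D0 D1 D\<xi> \<tau> fr)"
proof (intro conjI ballI)
  \<comment> \<open>Determinant 1 and an even off-diagonal entry force an odd diagonal; this is what
    makes Gamma_0(2) fix (False, True) and Gamma^0(2) fix (True, False).\<close>
  have parity: "odd (g$1$1) \<and> odd (g$2$2)" if "g \<in> SL2Z" "even (g$1$2) \<or> even (g$2$1)" for g :: "int^2^2"
  proof -
    have "g$1$1 * g$2$2 = 1 + g$1$2 * g$2$1"
      using that(1) by (simp add: SL2Z_def det_2)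
    then have "odd (g$1$1 * g$2$2)"
      using that(2) by auto
    then show ?thesis by simp
  qed
  note fam = modular_form_family[OF assms(3,5,6)]
  show "modular_form (adapted_frames \<A> \<xi> h) Gamma_lower0 (2 * k + 2)
       (\<lambda>\<tau> fr. degree_part (4 * k + 1) (CS_L k D0 D1 D\<xi> \<tau> fr))"
    by (rule fam[OF _ _ _ CS_coeff(1)]) (use parity in \<open>auto simp: Gamma_lower0_def\<close>)
  show "modular_form (adapted_frames \<A> \<xi> h) Gamma_upper0 (2 * k + 2)
       (\<lambda>\<tau> fr. degree_part (4 * k + 1) (CS_W D0 D1 D\<xi> \<tau> fr))"
    by (rule fam[OF _ _ _ CS_coeff(2)]) (use parity in \<open>auto simp: Gamma_upper0_def\<close>)
  show "modular_form (adapted_frames \<A> \<xi> h) Gamma_theta (2 * k + 2)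
       (\<lambda>\<tau> fr. degree_part (4 * k + 1) (CS_W' D0 D1 D\<xi> \<tau> fr))"
    by (rule fam[OF _ _ _ CS_coeff(3)]) (auto simp: Gamma_theta_def)
  fix \<tau> and fr :: "('m, 'n, 'v) frame"
  assume \<tau>: "\<tau> \<in> upper_half_plane"
  \<comment> \<open>The roots of 2 in the L form combine to 2^{2k+1}, and 1/(pi i) against 1/(2 pi
    i) gives one more 2: this is the origin of the 2 in (2 tau)^{2k+2}.\<close>
  have "of_real (sqrt 2) * of_real (sqrt 2) ^ (4 * k + 1) = (of_real ((sqrt 2)\<^sup>2 ^ (2 * k + 1)) :: complex)"
    by (simp only: of_real_mult[symmetric] of_real_power[symmetric] power_mult[symmetric] power_Suc[symmetric])
       simp
  then have "of_real (sqrt 2) / (8 * of_real pi ^ 2) * (of_real (sqrt 2) ^ (4 * k + 1) / (of_real pi * \<i>)) =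
      2 ^ (2 * k + 2) * (1 / (8 * of_real pi ^ 2) * (1 / (2 * of_real pi * \<i>)) :: complex)"
    by (simp add: field_simps)
  note const = this
  show "degree_part (4 * k + 1) (CS_L k D0 D1 D\<xi> (- 1 / \<tau>) fr) =
         (2 * \<tau>) ^ (2 * k + 2) *\<^sub>C degree_part (4 * k + 1) (CS_W D0 D1 D\<xi> \<tau> fr)"
  proof (rule ext_eqI)
    fix I :: "'n set"
    show "ext_coeff (degree_part (4 * k + 1) (CS_L k D0 D1 D\<xi> (- 1 / \<tau>) fr)) I =
      ext_coeff ((2 * \<tau>) ^ (2 * k + 2) *\<^sub>C degree_part (4 * k + 1) (CS_W D0 D1 D\<xi> \<tau> fr)) I"
    proof (cases "card I = 4 * k + 1")
      case True
      then show ?thesis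
        unfolding ext_coeff_simps ext_coeff_degree_part if_P[OF True] CS_coeff(1)[OF upper_half_plane_S[OF \<tau>]]
          CS_coeff(2)[OF \<tau>] const path_integral_coeff_S[OF \<tau> disjI2[OF TrueI] True]
        by (simp only: power_mult_distrib mult_ac)
    qed (simp add: ext_coeff_degree_part)
  qed
  have "\<tau> + 1 \<in> upper_half_plane"
    using \<tau> by (simp add: upper_half_plane_def)
  then show "CS_W D0 D1 D\<xi> (\<tau> + 1) fr = CS_W' D0 D1 D\<xi> \<tau> fr"
    by (intro ext_eqI) (simp add: CS_coeff \<tau> path_integral_coeff_T)
qed

end
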